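(* Let $g^{ij}$ and $\tilde g^{ij}$ be two nondegenerate flat metrics (with upper indices) on the same $n$-dimensional phase space with coordinates $u^1,\dots,u^n$, and let $$A^{ij}=g^{ij}\frac{d}{dx}+b^{ij}_k u^k_x,\quad b^{ij}_k=-g^{is}\Gamma^j_{sk},\qquad \tilde A^{ij}=\tilde g^{ij}\frac{d}{dx}+\tilde b^{ij}_k u^k_x,\quad \tilde b^{ij}_k=-\tilde g^{is}\tilde\Gamma^j_{sk},$$ be the corresponding Hamiltonian operators of hydrodynamic type, where $\Gamma^j_{sk}$ and $\tilde\Gamma^j_{sk}$ are the Christoffel symbols of the Levi-Civita connections of $g$ and $\tilde g$ respectively. Put $r^i_j=\tilde g^{is}g_{sj}$ and $r^{ij}=r^i_sg^{sj}=\tilde g^{ij}$. Then $A^{ij}$ and $\tilde A^{ij}$ are compatible if and only if the following two conditions are satisfied: 1. The Nijenhuis tensor of $r^i_j$ vanishes: $$N^i_{jk}=r^s_j\partial_s r^i_k-r^s_k\partial_s r^i_j-r^i_s(\partial_j r^s_k-\partial_k r^s_j)=0.$$ 2. The metric coefficients $\tilde g^{ij}=r^{ij}$ satisfy the equations $$\nabla^i\nabla^j r^{kl}+\nabla^k\nabla^l r^{ij}=\nabla^i\nabla^k r^{jl}+\nabla^j\nabla^l r^{ik},$$ where $\nabla^i=g^{is}\nabla_s$ is the covariant differentiation corresponding to the metric $g^{ij}$. Moreover, the vanishing of the Nijenhuis tensor implies the following expression for the coefficients $\tilde b^{ij}_k$ in terms of $r^i_j$: $$2\tilde b^{ij}_k=\nabla^i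 r^j_k-\nabla^j r^i_k+\nabla_k r^{ij}+2b^{sj}_k r^i_s.$$
   Context: Summation over repeated upper and lower indices is understood; $\partial_k=\partial/\partial u^k$; $g_{ij}$ denotes the inverse matrix of $g^{ij}$, and the metric $g$ is used to raise and lower indices. The operator $r^i_j$ is automatically symmetric with respect to $g$: $r^i_sg^{sj}=r^j_sg^{si}$. An operator $A^{ij}=g^{ij}\frac{d}{dx}+b^{ij}_ku^k_x$ (with $g^{ij}$, $b^{ij}_k$ functions of $u$) is called Hamiltonian if the bracket on functionals $$\{F,G\}=\int\frac{\delta F}{\delta u^i}A^{ij}\frac{\delta G}{\delta u^j}\,dx$$ is skew-symmetric and satisfies the Jacobi identity. (Dubrovin–Novikov: if $\det g^{ij}\neq0$ and $b^{ij}_k=-g^{is}\Gamma^j_{sk}$, this holds if and only if the metric $g^{ij}$ is flat and $\Gamma^j_{sk}$ are the Christoffel symbols of its Levi-Civita connection.) Two Hamiltonian operators $A^{ij}$, $\tilde A^{ij}$ are called compatible if their linear combinations $\tilde A^{ij}+\lambda A^{ij}$ (with metric part $\tilde g^{ij}+\lambda g^{ij}$ and coefficients $\tilde b^{ij}_k+\lambda b^{ij}_k$) are Hamiltonian for every constant $\lambda$. *)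

theory Defs
  imports "HOL-Analysis.Analysis"
begin

section \<open>Smooth functions on the phase space\<close>

text \<open>
  The phase space is an open set \<open>U\<close> of \<open>real^'n\<close>, with \<open>u $ k\<close> the coordinate \<open>u^k\<close>.
  Components of tensors are functions of their indices and, last, of the point.
\<close>

definition pd :: "'n \<Rightarrow> (real^'n \<Rightarrow> real) \<Rightarrow> real^'n \<Rightarrow> real" where
  "pd k f u = deriv (\<lambda>t. f (u + t *\<^sub>R axis k 1)) 0"

definition smooth_fun :: "(real^'n) set \<Rightarrow> (real^'n \<Rightarrow> real) \<Rightarrow> bool" where
  "smooth_fun U f \<longleftrightarrow> (\<forall>ks. foldr pd ks f differentiable_on U)"


section \<open>Flat metrics with upper indices\<close>

text \<open>
  \<open>g u $ i $ j\<close> is \<open>g^{ij}(u)\<close>. No signature is prescribed: nondegenerate means \<open>det \<noteq> 0\<close>.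
\<close>

definition lower_metric :: "(real^'n \<Rightarrow> real^'n^'n) \<Rightarrow> 'n \<Rightarrow> 'n \<Rightarrow> real^'n \<Rightarrow> real" where
  "lower_metric g i j u = matrix_inv (g u) $ i $ j"

text \<open>\<open>christoffel g j s k\<close> is \<open>\<Gamma>^j_{sk}\<close>.\<close>

definition christoffel ::
    "(real^'n \<Rightarrow> real^'n^'n) \<Rightarrow> 'n \<Rightarrow> 'n \<Rightarrow> 'n \<Rightarrow> real^'n \<Rightarrow> real" where
  "christoffel g j s k u =
     (\<Sum>l\<in>UNIV. g u $ j $ l *
        (pd s (lower_metric g l k) u + pd k (lower_metric g s l) u - pd l (lower_metric g s k) u)) / 2"

text \<open>\<open>riemann g i j k l\<close> is \<open>R^i_{jkl}\<close>.\<close>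

definition riemann ::
    "(real^'n \<Rightarrow> real^'n^'n) \<Rightarrow> 'n \<Rightarrow> 'n \<Rightarrow> 'n \<Rightarrow> 'n \<Rightarrow> real^'n \<Rightarrow> real" where
  "riemann g i j k l u =
     pd k (christoffel g i l j) u - pd l (christoffel g i k j) u
     + (\<Sum>m\<in>UNIV. christoffel g i k m u * christoffel g m l j u
                  - christoffel g i l m u * christoffel g m k j u)"

definition nondegenerate_metric :: "(real^'n) set \<Rightarrow> (real^'n \<Rightarrow> real^'n^'n) \<Rightarrow> bool" where
  "nondegenerate_metric U g \<longleftrightarrow>
     (\<forall>i j. smooth_fun U (\<lambda>u. g u $ i $ j)) \<and>
     (\<forall>u\<in>U. transpose (g u) = g u \<and> det (g u) \<noteq> 0)"

definition flat_metric :: "(real^'n) set \<Rightarrow> (real^'n \<Rightarrow> real^'n^'n) \<Rightarrow> bool" where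
  "flat_metric U g \<longleftrightarrow>
     nondegenerate_metric U g \<and> (\<forall>u\<in>U. \<forall>i j k l. riemann g i j k l u = 0)"

text \<open>\<open>hydro_coeff g i j k\<close> is \<open>b^{ij}_k = - g^{is} \<Gamma>^j_{sk}\<close>.\<close>

definition hydro_coeff ::
    "(real^'n \<Rightarrow> real^'n^'n) \<Rightarrow> 'n \<Rightarrow> 'n \<Rightarrow> 'n \<Rightarrow> real^'n \<Rightarrow> real" where
  "hydro_coeff g i j k u = - (\<Sum>s\<in>UNIV. g u $ i $ s * christoffel g j s k u)"


section \<open>Covariant differentiation\<close>

text \<open>
  The first index after the tensor is the index of differentiation. The suffix gives the numbers of
  upper and lower indices, the upper ones being listed first.
\<close>

definition cov11 :: "(real^'n \<Rightarrow> real^'n^'n) \<Rightarrow> ('n \<Rightarrow> 'n \<Rightarrow> real^'n \<Rightarrow> real) \<Rightarrow>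
    'n \<Rightarrow> 'n \<Rightarrow> 'n \<Rightarrow> real^'n \<Rightarrow> real" where
  "cov11 g T m i j u = pd m (T i j) u
     + (\<Sum>s\<in>UNIV. christoffel g i m s u * T s j u)
     - (\<Sum>s\<in>UNIV. christoffel g s m j u * T i s u)"

definition cov20 :: "(real^'n \<Rightarrow> real^'n^'n) \<Rightarrow> ('n \<Rightarrow> 'n \<Rightarrow> real^'n \<Rightarrow> real) \<Rightarrow>
    'n \<Rightarrow> 'n \<Rightarrow> 'n \<Rightarrow> real^'n \<Rightarrow> real" where
  "cov20 g T m i j u = pd m (T i j) u
     + (\<Sum>s\<in>UNIV. christoffel g i m s u * T s j u)
     + (\<Sum>s\<in>UNIV. christoffel g j m s u * T i s u)"

definition cov30 :: "(real^'n \<Rightarrow> real^'n^'n) \<Rightarrow> ('n \<Rightarrow> 'n \<Rightarrow> 'n \<Rightarrow> real^'n \<Rightarrow> real) \<Rightarrow>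
    'n \<Rightarrow> 'n \<Rightarrow> 'n \<Rightarrow> 'n \<Rightarrow> real^'n \<Rightarrow> real" where
  "cov30 g T m i j k u = pd m (T i j k) u
     + (\<Sum>s\<in>UNIV. christoffel g i m s u * T s j k u)
     + (\<Sum>s\<in>UNIV. christoffel g j m s u * T i s k u)
     + (\<Sum>s\<in>UNIV. christoffel g k m s u * T i j s u)"

text \<open>The operators \<open>\<nabla>^i = g^{is} \<nabla>_s\<close>.\<close>

definition covup11 :: "(real^'n \<Rightarrow> real^'n^'n) \<Rightarrow> ('n \<Rightarrow> 'n \<Rightarrow> real^'n \<Rightarrow> real) \<Rightarrow>
    'n \<Rightarrow> 'n \<Rightarrow> 'n \<Rightarrow> real^'n \<Rightarrow> real" where
  "covup11 g T i j k u = (\<Sum>s\<in>UNIV. g u $ i $ s * cov11 g T s j k u)"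

definition covup20 :: "(real^'n \<Rightarrow> real^'n^'n) \<Rightarrow> ('n \<Rightarrow> 'n \<Rightarrow> real^'n \<Rightarrow> real) \<Rightarrow>
    'n \<Rightarrow> 'n \<Rightarrow> 'n \<Rightarrow> real^'n \<Rightarrow> real" where
  "covup20 g T i j k u = (\<Sum>s\<in>UNIV. g u $ i $ s * cov20 g T s j k u)"

definition covup30 :: "(real^'n \<Rightarrow> real^'n^'n) \<Rightarrow> ('n \<Rightarrow> 'n \<Rightarrow> 'n \<Rightarrow> real^'n \<Rightarrow> real) \<Rightarrow>
    'n \<Rightarrow> 'n \<Rightarrow> 'n \<Rightarrow> 'n \<Rightarrow> real^'n \<Rightarrow> real" where
  "covup30 g T i j k l u = (\<Sum>s\<in>UNIV. g u $ i $ s * cov30 g T s j k l u)"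


section \<open>The affinor of a pair of metrics and its Nijenhuis tensor\<close>

text \<open>\<open>affinor g gt i j\<close> is \<open>r^i_j\<close> and \<open>affinor_up g gt i j\<close> is \<open>r^{ij}\<close>, with \<open>gt\<close> in the role of the
  second metric.\<close>

definition affinor :: "(real^'n \<Rightarrow> real^'n^'n) \<Rightarrow> (real^'n \<Rightarrow> real^'n^'n) \<Rightarrow>
    'n \<Rightarrow> 'n \<Rightarrow> real^'n \<Rightarrow> real" where
  "affinor g gt i j u = (\<Sum>s\<in>UNIV. gt u $ i $ s * lower_metric g s j u)"

definition affinor_up :: "(real^'n \<Rightarrow> real^'n^'n) \<Rightarrow> (real^'n \<Rightarrow> real^'n^'n) \<Rightarrow>
    'n \<Rightarrow> 'n \<Rightarrow> real^'n \<Rightarrow> real" where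
  "affinor_up g gt i j u = (\<Sum>s\<in>UNIV. affinor g gt i s u * g u $ s $ j)"

lemma affinor_up_eq:
  assumes "det (g u) \<noteq> 0"
  shows "affinor_up g gt i j u = gt u $ i $ j"
proof -
  have "invertible (g u)"
    using assms by (simp add: invertible_det_nz)
  then have "matrix_inv (g u) ** g u = mat 1"
    unfolding invertible_def matrix_inv_def by (rule someI2_ex) simp
  then have "gt u ** matrix_inv (g u) ** g u = gt u"
    by (simp flip: matrix_mul_assoc)
  moreover have "affinor_up g gt i j u = (gt u ** matrix_inv (g u) ** g u) $ i $ j"
    by (simp add: affinor_up_def affinor_def lower_metric_def matrix_matrix_mult_def)
  ultimately show ?thesis by simp
qed

definition nijenhuis :: "('n \<Rightarrow> 'n \<Rightarrow> real^'n \<Rightarrow> real) \<Rightarrow>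
    'n \<Rightarrow> 'n \<Rightarrow> 'n \<Rightarrow> real^'n \<Rightarrow> real" where
  "nijenhuis r i j k u =
     (\<Sum>s\<in>UNIV. r s j u * pd s (r i k) u - r s k u * pd s (r i j) u
                  - r i s u * (pd j (r s k) u - pd k (r s j) u))"


section \<open>Local functionals on the loop space\<close>

text \<open>
  Fields are smooth loops with values in \<open>U\<close>, written as functions of period 1, so that the
  integral over \<open>x\<close> is an integral over one period and no boundary terms occur.
\<close>

definition xderiv :: "(real \<Rightarrow> real^'n) \<Rightarrow> real \<Rightarrow> real^'n" where
  "xderiv w = (\<lambda>x. vector_derivative w (at x))"

definition smooth_loops :: "(real \<Rightarrow> real^'n) set" where
  "smooth_loops =
     {w. (\<forall>k. (xderiv ^^ k) w differentiable_on UNIV) \<and> (\<forall>x. w (x + 1) = w x)}"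

definition fields :: "(real^'n) set \<Rightarrow> (real \<Rightarrow> real^'n) set" where
  "fields U = {u \<in> smooth_loops. range u \<subseteq> U}"

text \<open>
  A density is a function \<open>f (x, u, u_x, u_xx, \<dots>)\<close>; in \<open>(x, J)\<close> the entry \<open>J k $ i\<close> stands for the
  \<open>k\<close>-th \<open>x\<close>-derivative of \<open>u^i\<close>. Coordinate \<open>None\<close> is \<open>x\<close>, coordinate \<open>Some (k, i)\<close> is \<open>J k $ i\<close>.
  The space of jets carries no norm; since a density depends on finitely many coordinates only,
  smoothness amounts to existence and continuity of all iterated partial derivatives (continuity
  being meant for the product topology).
\<close>

type_synonym 'n jet = "real \<times> (nat \<Rightarrow> real^'n)"

fun jet_shift :: "(nat \<times> 'n::finite) option \<Rightarrow> real \<Rightarrow> 'n jet \<Rightarrow> 'n jet" where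
  "jet_shift None t (x, J) = (x + t, J)"
| "jet_shift (Some (k, i)) t (x, J) = (x, J(k := J k + t *\<^sub>R axis i 1))"

definition jet_pd :: "(nat \<times> 'n::finite) option \<Rightarrow> ('n jet \<Rightarrow> real) \<Rightarrow> 'n jet \<Rightarrow> real" where
  "jet_pd c f p = deriv (\<lambda>t. f (jet_shift c t p)) 0"

definition jets :: "(real^'n) set \<Rightarrow> 'n jet set" where
  "jets U = {(x, J). J 0 \<in> U}"

definition smooth_jet_fun :: "(real^'n) set \<Rightarrow> ('n jet \<Rightarrow> real) \<Rightarrow> bool" where
  "smooth_jet_fun U f \<longleftrightarrow>
     (\<forall>cs. continuous_on (jets U) (foldr jet_pd cs f) \<and>
           (\<forall>c. \<forall>p\<in>jets U. (\<lambda>t. foldr jet_pd cs f (jet_shift c t p)) differentiable at 0))"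

definition density :: "(real^'n) set \<Rightarrow> ('n jet \<Rightarrow> real) \<Rightarrow> bool" where
  "density U f \<longleftrightarrow>
     smooth_jet_fun U f \<and>
     (\<exists>m. \<forall>x J J'. (\<forall>k\<le>m. J k = J' k) \<longrightarrow> f (x, J) = f (x, J')) \<and>
     (\<forall>x J. f (x + 1, J) = f (x, J))"

definition prolong :: "(real \<Rightarrow> real^'n) \<Rightarrow> real \<Rightarrow> 'n jet" where
  "prolong u x = (x, \<lambda>k. (xderiv ^^ k) u x)"

definition local_functional :: "(real^'n) set \<Rightarrow> ((real \<Rightarrow> real^'n) \<Rightarrow> real) \<Rightarrow> bool" where
  "local_functional U F \<longleftrightarrow>
     (\<exists>f. density U f \<and> (\<forall>u\<in>fields U. F u = integral {0..1} (\<lambda>x. f (prolong u x))))"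

text \<open>
  The variational derivative is defined by the first variation,
  \<open>d/d\<epsilon> F[u + \<epsilon> v] = \<integral> (\<delta>F/\<delta>u^i) v^i dx\<close> at \<open>\<epsilon> = 0\<close>. For a field \<open>u\<close> in the open set \<open>U\<close>, the loop
  \<open>u + \<epsilon> v\<close> stays in \<open>U\<close> for small \<open>\<epsilon>\<close>; a smooth loop with this property is unique.
\<close>

definition has_variational_derivative ::
    "((real \<Rightarrow> real^'n) \<Rightarrow> real) \<Rightarrow> (real \<Rightarrow> real^'n) \<Rightarrow> (real \<Rightarrow> real^'n) \<Rightarrow> bool" where
  "has_variational_derivative F u w \<longleftrightarrow>
     w \<in> smooth_loops \<and>
     (\<forall>v\<in>smooth_loops.
        ((\<lambda>\<epsilon>. F (\<lambda>x. u x + \<epsilon> *\<^sub>R v x)) has_real_derivative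
           integral {0..1} (\<lambda>x. \<Sum>i\<in>UNIV. w x $ i * v x $ i)) (at 0))"

definition variational_derivative ::
    "((real \<Rightarrow> real^'n) \<Rightarrow> real) \<Rightarrow> (real \<Rightarrow> real^'n) \<Rightarrow> real \<Rightarrow> real^'n" where
  "variational_derivative F u = (THE w. has_variational_derivative F u w)"


section \<open>Hamiltonian operators of hydrodynamic type\<close>

text \<open>
  \<open>hydro_op g b u\<close> is the operator \<open>g^{ij}(u) d/dx + b^{ij}_k(u) u^k_x\<close>. Here \<open>g\<close> is any matrix
  function, possibly degenerate, and \<open>b\<close> need not come from \<open>g\<close>.
\<close>

definition hydro_op ::
    "(real^'n \<Rightarrow> real^'n^'n) \<Rightarrow> ('n \<Rightarrow> 'n \<Rightarrow> 'n \<Rightarrow> real^'n \<Rightarrow> real) \<Rightarrow>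
     (real \<Rightarrow> real^'n) \<Rightarrow> (real \<Rightarrow> real^'n) \<Rightarrow> real \<Rightarrow> real^'n" where
  "hydro_op g b u \<psi> x = (\<chi> i. \<Sum>j\<in>UNIV.
      g (u x) $ i $ j * xderiv \<psi> x $ j + (\<Sum>k\<in>UNIV. b i j k (u x) * xderiv u x $ k) * \<psi> x $ j)"

definition hydro_bracket ::
    "(real^'n \<Rightarrow> real^'n^'n) \<Rightarrow> ('n \<Rightarrow> 'n \<Rightarrow> 'n \<Rightarrow> real^'n \<Rightarrow> real) \<Rightarrow>
     ((real \<Rightarrow> real^'n) \<Rightarrow> real) \<Rightarrow> ((real \<Rightarrow> real^'n) \<Rightarrow> real) \<Rightarrow> (real \<Rightarrow> real^'n) \<Rightarrow> real" where
  "hydro_bracket g b F G u =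
     integral {0..1} (\<lambda>x. \<Sum>i\<in>UNIV.
       variational_derivative F u x $ i * hydro_op g b u (variational_derivative G u) x $ i)"

definition hamiltonian ::
    "(real^'n) set \<Rightarrow> (real^'n \<Rightarrow> real^'n^'n) \<Rightarrow> ('n \<Rightarrow> 'n \<Rightarrow> 'n \<Rightarrow> real^'n \<Rightarrow> real) \<Rightarrow> bool" where
  "hamiltonian U g b \<longleftrightarrow>
     (\<forall>F G. local_functional U F \<longrightarrow> local_functional U G \<longrightarrow>
        (\<forall>u\<in>fields U. hydro_bracket g b F G u = - hydro_bracket g b G F u)) \<and>
     (\<forall>F G H. local_functional U F \<longrightarrow> local_functional U G \<longrightarrow> local_functional U H \<longrightarrow>
        (\<forall>u\<in>fields U.
           hydro_bracket g b (hydro_bracket g b F G) H u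
         + hydro_bracket g b (hydro_bracket g b G H) F u
         + hydro_bracket g b (hydro_bracket g b H F) G u = 0))"

definition compatible ::
    "(real^'n) set \<Rightarrow>
     (real^'n \<Rightarrow> real^'n^'n) \<Rightarrow> ('n \<Rightarrow> 'n \<Rightarrow> 'n \<Rightarrow> real^'n \<Rightarrow> real) \<Rightarrow>
     (real^'n \<Rightarrow> real^'n^'n) \<Rightarrow> ('n \<Rightarrow> 'n \<Rightarrow> 'n \<Rightarrow> real^'n \<Rightarrow> real) \<Rightarrow> bool" where
  "compatible U g b gt bt \<longleftrightarrow>
     hamiltonian U g b \<and> hamiltonian U gt bt \<and>
     (\<forall>c::real. hamiltonian U (\<lambda>u. gt u + c *\<^sub>R g u) (\<lambda>i j k u. bt i j k u + c * b i j k u))"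

end

theory Submission
  imports Defs
begin

text \<open>
  Write \<open>A = g d/dx + b u_x\<close> and \<open>L\<^sub>v A\<close> for the derivative of \<open>A\<close> at the field \<open>u\<close> in the direction \<open>v\<close>.

  \<^bold>\<open>Operators.\<close> Let \<open>g\<close> be symmetric, possibly degenerate, with \<open>\<partial>\<^sub>k g^{ij} = b^{ij}_k + b^{ji}_k\<close>, so that \<open>A\<close>
  is skew-adjoint. The derivative of \<open>{F, G}\<close> in the direction \<open>A \<delta>H\<close> is \<open>{{F, G}, H}\<close>. It consists of
  two terms with the Hessians of \<open>F\<close> and \<open>G\<close> and of \<open>\<integral> \<delta>F (L\<^sub>v A) \<delta>G\<close>. Hessians are symmetric, hence the
  Hessian terms cancel in the cyclic sum, and integration by parts turns the rest into
  \<open>\<integral> \<delta>H \<sqdot> J(\<delta>F, \<delta>G)\<close> for a differential expression \<open>J\<close> (lemma \<open>jacobi_sum\<close>). Linear functionals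
  have arbitrary gradients, so \<open>A\<close> is Hamiltonian if and only if \<open>J\<close> vanishes identically
  (\<open>hamiltonian_iff_jacobiator\<close>). In the matrix notation \<open>(b\<^sup>j)_{ik} = b^{ij}_k\<close>,
  \<open>(B^{ij})_{ks} = \<partial>\<^sub>k b^{ij}_s - \<partial>\<^sub>s b^{ij}_k\<close>, vanishing of \<open>J\<close> implies that every \<open>b\<^sup>k g\<close> is symmetric and
  that \<open>g B^{ij} = b\<^sup>i b\<^sup>j - b\<^sup>j b\<^sup>i\<close>; conversely, these two conditions together with the cyclic condition
  \<open>\<Sum> (b\<^sup>l y) \<sqdot> (B^{ij} y) = 0\<close> (sum over the cyclic permutations of \<open>i, j, l\<close>) imply \<open>J = 0\<close>. Where \<open>g\<close> is
  invertible the cyclic condition is a consequence of the first two.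

  \<^bold>\<open>Pencils.\<close> For a flat metric with \<open>b\<^sup>j = - g \<Gamma>\<^sup>j\<close>, where \<open>(\<Gamma>\<^sup>j)_{sk} = \<Gamma>^j_{sk}\<close>, flatness says
  \<open>B^{ij} = \<Gamma>\<^sup>i g \<Gamma>\<^sup>j - \<Gamma>\<^sup>j g \<Gamma>\<^sup>i\<close>. No derivatives remain, and with \<open>D\<^sup>j\<close> the difference of the
  two matrices \<open>\<Gamma>\<^sup>j\<close> the conditions on the pencil \<open>gt + c g\<close> become
  \<open>gt D\<^sup>k g = g D\<^sup>k gt\<close> and \<open>D\<^sup>i gt D\<^sup>j = D\<^sup>j gt D\<^sup>i\<close> (\<open>pencil_quadratic_conditions\<close>). The pencil may
  degenerate, but the cyclic condition is quadratic in \<open>c\<close>, and it holds for \<open>g\<close>, for \<open>gt\<close> and, under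
  these conditions, for small \<open>c\<close>; hence it holds for all \<open>c\<close>.

  \<^bold>\<open>Tensors.\<close> Put \<open>S^{ijk} = - (gt D\<^sup>j g)_{ik}\<close>; then \<open>\<nabla>\<^sup>k r^{ij} = S^{ijk} + S^{jik}\<close>. The Nijenhuis tensor is,
  up to the invertible factors \<open>r\<close> and \<open>g\<close>, a combination of the antisymmetric parts of \<open>S\<close> in its outer
  indices from which these can be recovered, so it vanishes exactly if \<open>gt D\<^sup>k g = g D\<^sup>k gt\<close>. Given this
  symmetry, \<open>S\<close> is determined by \<open>\<nabla>r\<close> as Christoffel symbols are by the derivatives of a metric, which is
  the formula for the coefficients. Finally \<open>\<nabla>\<^sup>l S^{ijk} - \<nabla>\<^sup>k S^{ijl}\<close> is the commutator
  \<open>D\<^sup>i gt D\<^sup>j - D\<^sup>j gt D\<^sup>i\<close> with raised indices (\<open>curl_conn_low\<close>), while the second-order condition says that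
  this difference vanishes once it is written in terms of \<open>S\<close>.
\<close>

section \<open>Smoothness as regularity of all iterated derivatives\<close>

text \<open>
  Smoothness on the phase space, on jets and on the circle is in each case regularity of all iterated
  derivatives, and its closure properties follow from locality and the product rule.
\<close>

locale derivations =
  fixes S :: "'p set"
    and reg :: "('p \<Rightarrow> real) \<Rightarrow> bool"
    and d :: "'c \<Rightarrow> ('p \<Rightarrow> real) \<Rightarrow> 'p \<Rightarrow> real"
  assumes reg_cong: "(\<And>p. p \<in> S \<Longrightarrow> f p = f' p) \<Longrightarrow> reg f \<Longrightarrow> reg f'"
    and d_cong: "(\<And>p. p \<in> S \<Longrightarrow> f p = f' p) \<Longrightarrow> p \<in> S \<Longrightarrow> d c f p = d c f' p"
    and reg_const: "reg (\<lambda>p. a)"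
    and d_const: "p \<in> S \<Longrightarrow> d c (\<lambda>p. a) p = 0"
    and reg_add: "reg f \<Longrightarrow> reg f' \<Longrightarrow> reg (\<lambda>p. f p + f' p)"
    and d_add: "reg f \<Longrightarrow> reg f' \<Longrightarrow> p \<in> S \<Longrightarrow> d c (\<lambda>p. f p + f' p) p = d c f p + d c f' p"
    and reg_mult: "reg f \<Longrightarrow> reg f' \<Longrightarrow> reg (\<lambda>p. f p * f' p)"
    and d_mult: "reg f \<Longrightarrow> reg f' \<Longrightarrow> p \<in> S \<Longrightarrow>
      d c (\<lambda>p. f p * f' p) p = d c f p * f' p + f p * d c f' p"
begin

text \<open>
  Finite levels of smoothness, so that closure properties can be proved by induction on the level.
\<close>

primrec regs :: "nat \<Rightarrow> ('p \<Rightarrow> real) \<Rightarrow> bool" where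
  "regs 0 f \<longleftrightarrow> True"
| "regs (Suc n) f \<longleftrightarrow> reg f \<and> (\<forall>c. regs n (d c f))"

definition smooth :: "('p \<Rightarrow> real) \<Rightarrow> bool" where
  "smooth f \<longleftrightarrow> (\<forall>n. regs n f)"

lemma regs_foldr: "(\<forall>n. regs n f) \<longleftrightarrow> (\<forall>cs. reg (foldr d cs f))"
proof
  assume *: "\<forall>n. regs n f"
  have "regs (Suc (length cs)) f \<Longrightarrow> reg (foldr d cs f)" for cs f
    by (induction cs arbitrary: f rule: rev_induct) auto
  with * show "\<forall>cs. reg (foldr d cs f)" by blast
next
  assume *: "\<forall>cs. reg (foldr d cs f)"
  have "\<forall>cs. reg (foldr d cs f) \<Longrightarrow> regs n f" for n f
  proof (induction n arbitrary: f)
    case (Suc n)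
    have "reg (foldr d cs (d c f))" for cs c
      using Suc.prems[rule_format, of "cs @ [c]"] by simp
    then show ?case using Suc.IH Suc.prems[rule_format, of "[]"] by simp
  qed simp
  with * show "\<forall>n. regs n f" by blast
qed

lemma smooth_foldr: "smooth f \<longleftrightarrow> (\<forall>cs. reg (foldr d cs f))"
  by (simp add: smooth_def regs_foldr)

lemma regs_cong: "(\<And>p. p \<in> S \<Longrightarrow> f p = f' p) \<Longrightarrow> regs n f \<Longrightarrow> regs n f'"
proof (induction n arbitrary: f f')
  case (Suc n)
  have "regs n (d c f')" for c
    using Suc.IH[of "d c f" "d c f'"] Suc.prems d_cong[of f f'] by simp
  with Suc.prems reg_cong[of f f'] show ?case by simp
qed simp

lemma regs_weaken: "regs (Suc n) f \<Longrightarrow> regs n f"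
  by (induction n arbitrary: f) auto

lemma regs_const: "regs n (\<lambda>p. a)"
proof (induction n arbitrary: a)
  case (Suc n)
  then show ?case
    using regs_cong[of "\<lambda>p. 0" "d c (\<lambda>p. a)" n for c] by (simp add: reg_const d_const)
qed simp

lemma regs_add: "regs n f \<Longrightarrow> regs n f' \<Longrightarrow> regs n (\<lambda>p. f p + f' p)"
proof (induction n arbitrary: f f')
  case (Suc n)
  have "regs n (d c (\<lambda>p. f p + f' p))" for c
    by (rule regs_cong[OF d_add[symmetric]]) (use Suc in auto)
  with Suc.prems show ?case by (simp add: reg_add)
qed simp

lemma regs_mult: "regs n f \<Longrightarrow> regs n f' \<Longrightarrow> regs n (\<lambda>p. f p * f' p)"
proof (induction n arbitrary: f f')
  case (Suc n)
  have "regs n (d c (\<lambda>p. f p * f' p))" for c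
    by (rule regs_cong[OF d_mult[symmetric]])
      (use Suc regs_weaken in \<open>auto intro!: regs_add Suc.IH\<close>)
  with Suc.prems show ?case by (simp add: reg_mult)
qed simp

lemma smooth_reg: "smooth f \<Longrightarrow> reg f"
  unfolding smooth_def using regs.simps(2) by blast

lemma smooth_d: "smooth f \<Longrightarrow> smooth (d c f)"
  unfolding smooth_def using regs.simps(2) by blast

lemma smooth_iff: "smooth f \<longleftrightarrow> reg f \<and> (\<forall>c. smooth (d c f))"
  using regs.simps(2) regs.simps(1) unfolding smooth_def by (metis not0_implies_Suc)

lemma smooth_cong: "(\<And>p. p \<in> S \<Longrightarrow> f p = f' p) \<Longrightarrow> smooth f \<Longrightarrow> smooth f'"
  unfolding smooth_def using regs_cong by blast

lemma smooth_const: "smooth (\<lambda>p. a)"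
  unfolding smooth_def using regs_const by blast

lemma smooth_add: "smooth f \<Longrightarrow> smooth f' \<Longrightarrow> smooth (\<lambda>p. f p + f' p)"
  unfolding smooth_def using regs_add by blast

lemma smooth_mult: "smooth f \<Longrightarrow> smooth f' \<Longrightarrow> smooth (\<lambda>p. f p * f' p)"
  unfolding smooth_def using regs_mult by blast

lemma smooth_uminus: "smooth f \<Longrightarrow> smooth (\<lambda>p. - f p)"
  using smooth_mult[OF smooth_const[of "-1"], of f] by simp

lemma smooth_diff: "smooth f \<Longrightarrow> smooth f' \<Longrightarrow> smooth (\<lambda>p. f p - f' p)"
  using smooth_add[OF _ smooth_uminus, of f f'] by simp

lemma smooth_divide_const: "smooth f \<Longrightarrow> smooth (\<lambda>p. f p / a)"
  using smooth_mult[OF _ smooth_const[of "inverse a"], of f] by (simp add: field_simps)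

lemma smooth_sum: "(\<And>i. i \<in> I \<Longrightarrow> smooth (f i)) \<Longrightarrow> smooth (\<lambda>p. \<Sum>i\<in>I. f i p)"
  by (induction I rule: infinite_finite_induct) (auto simp: smooth_const intro!: smooth_add)

lemma smooth_prod: "(\<And>i. i \<in> I \<Longrightarrow> smooth (f i)) \<Longrightarrow> smooth (\<lambda>p. \<Prod>i\<in>I. f i p)"
  by (induction I rule: infinite_finite_induct) (auto simp: smooth_const intro!: smooth_mult)

lemmas smooth_intros = smooth_const smooth_add smooth_mult smooth_uminus smooth_diff
  smooth_divide_const smooth_sum smooth_d

lemma d_uminus: "reg f \<Longrightarrow> p \<in> S \<Longrightarrow> d c (\<lambda>p. - f p) p = - d c f p"
  using d_mult[OF reg_const[of "-1"], of f p c] by (simp add: d_const)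

lemma reg_uminus: "reg f \<Longrightarrow> reg (\<lambda>p. - f p)"
  using reg_mult[OF reg_const[of "-1"], of f] by simp

lemma d_diff: "reg f \<Longrightarrow> reg f' \<Longrightarrow> p \<in> S \<Longrightarrow> d c (\<lambda>p. f p - f' p) p = d c f p - d c f' p"
  using d_add[OF _ reg_uminus, of f f' p c] by (simp add: d_uminus)

lemma reg_sum: "(\<And>i. i \<in> I \<Longrightarrow> reg (f i)) \<Longrightarrow> reg (\<lambda>p. \<Sum>i\<in>I. f i p)"
  by (induction I rule: infinite_finite_induct) (auto simp: reg_const intro!: reg_add)

lemma d_sum:
  assumes "finite I" "\<And>i. i \<in> I \<Longrightarrow> reg (f i)" "p \<in> S"
  shows "d c (\<lambda>p. \<Sum>i\<in>I. f i p) p = (\<Sum>i\<in>I. d c (f i) p)"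
  using assms by (induction I rule: finite_induct) (auto simp: d_const d_add reg_sum)

end


subsection \<open>Equality of mixed derivatives\<close>

text \<open>
  Both values are limits of the same second difference quotient: the mean value theorem, applied first
  in one variable and then in the other, expresses the quotient by either mixed derivative.
\<close>

lemma mixed_derivatives_eq:
  fixes \<phi> \<phi>s \<phi>t \<phi>st \<phi>ts :: "real \<Rightarrow> real \<Rightarrow> real"
  assumes e: "e > 0"
    and d1: "\<And>s t. \<bar>s\<bar> < e \<Longrightarrow> \<bar>t\<bar> < e \<Longrightarrow> ((\<lambda>s. \<phi> s t) has_real_derivative \<phi>s s t) (at s)"
    and d2: "\<And>s t. \<bar>s\<bar> < e \<Longrightarrow> \<bar>t\<bar> < e \<Longrightarrow> ((\<lambda>t. \<phi> s t) has_real_derivative \<phi>t s t) (at t)"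
    and d12: "\<And>s t. \<bar>s\<bar> < e \<Longrightarrow> \<bar>t\<bar> < e \<Longrightarrow> ((\<lambda>t. \<phi>s s t) has_real_derivative \<phi>st s t) (at t)"
    and d21: "\<And>s t. \<bar>s\<bar> < e \<Longrightarrow> \<bar>t\<bar> < e \<Longrightarrow> ((\<lambda>s. \<phi>t s t) has_real_derivative \<phi>ts s t) (at s)"
    and c12: "isCont (\<lambda>z. \<phi>st (fst z) (snd z)) (0, 0)"
    and c21: "isCont (\<lambda>z. \<phi>ts (fst z) (snd z)) (0, 0)"
  shows "\<phi>st 0 0 = \<phi>ts 0 0"
proof (rule ccontr)
  assume ne: "\<phi>st 0 0 \<noteq> \<phi>ts 0 0"
  define r where "r = \<bar>\<phi>st 0 0 - \<phi>ts 0 0\<bar> / 2"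
  have r: "r > 0" using ne by (simp add: r_def)
  obtain \<delta>1 where \<delta>1: "\<delta>1 > 0" "\<And>z. dist z (0,0) < \<delta>1 \<Longrightarrow> \<bar>\<phi>st (fst z) (snd z) - \<phi>st 0 0\<bar> < r"
    using c12 r unfolding continuous_at_eps_delta by (auto simp: dist_real_def)
  obtain \<delta>2 where \<delta>2: "\<delta>2 > 0" "\<And>z. dist z (0,0) < \<delta>2 \<Longrightarrow> \<bar>\<phi>ts (fst z) (snd z) - \<phi>ts 0 0\<bar> < r"
    using c21 r unfolding continuous_at_eps_delta by (auto simp: dist_real_def)
  define h where "h = min e (min \<delta>1 \<delta>2) / 2"
  have h: "h > 0" "h < e" "2 * h \<le> \<delta>1" "2 * h \<le> \<delta>2"
    using e \<delta>1(1) \<delta>2(1) by (auto simp: h_def min_def)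
  have dist: "dist (s, t) (0, 0) < 2 * h" if "0 < s" "s < h" "0 < t" "t < h" for s t :: real
  proof -
    have "dist (s, t) (0, 0) \<le> \<bar>s\<bar> + \<bar>t\<bar>"
      using norm_Pair_le[of s t] by (simp add: dist_norm zero_prod_def)
    with that show ?thesis by simp
  qed
  have ab: "\<bar>s\<bar> < e" if "0 \<le> s" "s \<le> h" for s using that h by simp
  obtain s where s: "0 < s" "s < h"
    "(\<phi> h h - \<phi> h 0) - (\<phi> 0 h - \<phi> 0 0) = (h - 0) * (\<phi>s s h - \<phi>s s 0)"
    using MVT2[OF h(1), of "\<lambda>s. \<phi> s h - \<phi> s 0" "\<lambda>s. \<phi>s s h - \<phi>s s 0",
      OF DERIV_diff[OF d1 d1]] h ab by fastforce
  obtain t where t: "0 < t" "t < h" "\<phi>s s h - \<phi>s s 0 = (h - 0) * \<phi>st s t"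
    using MVT2[OF h(1), of "\<lambda>t. \<phi>s s t" "\<lambda>t. \<phi>st s t", OF d12] h ab s by fastforce
  obtain t' where t': "0 < t'" "t' < h"
    "(\<phi> h h - \<phi> 0 h) - (\<phi> h 0 - \<phi> 0 0) = (h - 0) * (\<phi>t h t' - \<phi>t 0 t')"
    using MVT2[OF h(1), of "\<lambda>t. \<phi> h t - \<phi> 0 t" "\<lambda>t. \<phi>t h t - \<phi>t 0 t",
      OF DERIV_diff[OF d2 d2]] h ab by fastforce
  obtain s' where s': "0 < s'" "s' < h" "\<phi>t h t' - \<phi>t 0 t' = (h - 0) * \<phi>ts s' t'"
    using MVT2[OF h(1), of "\<lambda>s. \<phi>t s t'" "\<lambda>s. \<phi>ts s t'", OF d21] h ab t' by fastforce
  have "(h - 0) * ((h - 0) * \<phi>st s t) = (h - 0) * ((h - 0) * \<phi>ts s' t')"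
    using s(3)[unfolded t(3)] t'(3)[unfolded s'(3)] by linarith
  then have "\<phi>st s t = \<phi>ts s' t'" using h by simp
  moreover have "\<bar>\<phi>st s t - \<phi>st 0 0\<bar> < r"
    using \<delta>1(2)[of "(s, t)"] dist[OF s(1,2) t(1,2)] h by simp
  moreover have "\<bar>\<phi>ts s' t' - \<phi>ts 0 0\<bar> < r"
    using \<delta>2(2)[of "(s', t')"] dist[OF s'(1,2) t'(1,2)] h by simp
  ultimately show False unfolding r_def by (auto simp: abs_if split: if_splits)
qed


section \<open>Smooth functions on the phase space\<close>

lemma sum_mult_axis: "(\<Sum>j\<in>UNIV. e j * (axis k 1 :: real^'n) $ j) = e k"
  by (simp add: axis_def mult_delta_right)

lemma pd_has_derivative:
  assumes "(f has_derivative D) (at u)"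
  shows "((\<lambda>t. f (u + t *\<^sub>R axis k 1)) has_real_derivative D (axis k 1)) (at 0)"
    and "pd k f u = D (axis k 1)"
proof -
  have "((\<lambda>t. u + t *\<^sub>R axis k 1) has_derivative (\<lambda>t. t *\<^sub>R axis k 1)) (at 0)"
    by (auto intro!: derivative_eq_intros)
  from has_derivative_compose[OF this, of f D] assms
  have "((\<lambda>t. f (u + t *\<^sub>R axis k 1)) has_derivative (\<lambda>t. D (t *\<^sub>R axis k 1))) (at 0)"
    by simp
  moreover have "D (t *\<^sub>R axis k 1) = t * D (axis k 1)" for t
    using linear_scale[OF has_derivative_linear[OF assms]] by simp
  ultimately show *: "((\<lambda>t. f (u + t *\<^sub>R axis k 1)) has_real_derivative D (axis k 1)) (at 0)"
    by (simp add: has_field_derivative_def mult_commute_abs)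
  show "pd k f u = D (axis k 1)"
    unfolding pd_def by (rule DERIV_imp_deriv[OF *])
qed

lemma has_derivative_pd:
  assumes "f differentiable (at u)"
  shows "(f has_derivative (\<lambda>v. \<Sum>k\<in>UNIV. pd k f u * v $ k)) (at u)"
proof -
  obtain D where D: "(f has_derivative D) (at u)"
    using assms by (auto simp: differentiable_def)
  have "D v = (\<Sum>k\<in>UNIV. pd k f u * v $ k)" for v
  proof -
    have "v = (\<Sum>k\<in>UNIV. (v $ k) *\<^sub>R axis k 1)"
      using basis_expansion[of v] by (simp add: scalar_mult_eq_scaleR)
    from arg_cong[OF this, of D] have "D v = D (\<Sum>k\<in>UNIV. (v $ k) *\<^sub>R axis k 1)" .
    also have "\<dots> = (\<Sum>k\<in>UNIV. pd k f u * v $ k)"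
      by (simp add: linear_sum[OF has_derivative_linear[OF D]]
        linear_scale[OF has_derivative_linear[OF D]] pd_has_derivative(2)[OF D] mult.commute)
    finally show ?thesis .
  qed
  then have "D = (\<lambda>v. \<Sum>k\<in>UNIV. pd k f u * v $ k)" by (rule ext)
  with D show ?thesis by simp
qed

lemma chain_rule_pd:
  assumes "f differentiable (at (w t))" and "(w has_vector_derivative w') (at t)"
  shows "((\<lambda>t. f (w t)) has_real_derivative (\<Sum>k\<in>UNIV. pd k f (w t) * w' $ k)) (at t)"
proof -
  have "(\<lambda>x. \<Sum>k\<in>UNIV. pd k f (w t) * (x *\<^sub>R w') $ k) = (*) (\<Sum>k\<in>UNIV. pd k f (w t) * w' $ k)"
    by (auto simp: fun_eq_iff sum_distrib_left mult_ac)
  with has_derivative_compose[OF assms(2)[unfolded has_vector_derivative_def]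
    has_derivative_pd[OF assms(1)]]
  show ?thesis by (simp add: has_field_derivative_def)
qed

lemma pd_eventually_cong:
  assumes "eventually (\<lambda>v. f v = f' v) (nhds u)"
  shows "pd k f u = pd k f' u"
proof -
  have "((\<lambda>t. u + t *\<^sub>R axis k 1) \<longlongrightarrow> u + 0 *\<^sub>R axis k (1::real)) (nhds 0)"
    by (intro tendsto_intros filterlim_ident)
  then have "eventually (\<lambda>t. f (u + t *\<^sub>R axis k 1) = f' (u + t *\<^sub>R axis k 1)) (nhds 0)"
    using assms by (auto dest!: filterlim_iff[THEN iffD1, rule_format])
  then show ?thesis unfolding pd_def by (intro deriv_cong_ev) auto
qed

lemma pd_inverse:
  fixes f :: "real^'n \<Rightarrow> real"
  assumes "f differentiable (at u)" "f u \<noteq> 0"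
  shows "pd k (\<lambda>v. inverse (f v)) u = - (pd k f u * inverse (f u) * inverse (f u))"
proof -
  have "pd k (\<lambda>v. inverse (f v)) u
      = - (inverse (f u) * (\<Sum>j\<in>UNIV. pd j f u * (axis k 1 :: real^'n) $ j) * inverse (f u))"
    by (rule pd_has_derivative(2)) (intro Deriv.has_derivative_inverse has_derivative_pd assms)
  then show ?thesis by (simp add: sum_mult_axis mult_ac)
qed

locale phase_space =
  fixes U :: "(real^'n) set"
  assumes open_U: "open U"
begin

lemma diff_on_iff: "f differentiable_on U \<longleftrightarrow> (\<forall>u\<in>U. f differentiable (at u))"
  unfolding differentiable_on_def using at_within_open[OF _ open_U] by metis

lemma pd_cong: "(\<And>p. p \<in> U \<Longrightarrow> f p = f' p) \<Longrightarrow> u \<in> U \<Longrightarrow> pd k f u = pd k f' u"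
  by (rule pd_eventually_cong) (use open_U in \<open>auto simp: eventually_nhds\<close>)

sublocale phase_fun: derivations U "\<lambda>f. f differentiable_on U" pd
  rewrites phase_fun_eq: "phase_fun.smooth = smooth_fun U"
proof -
  show d: "derivations U (\<lambda>f. f differentiable_on U) pd"
  proof
    fix f f' :: "real^'n \<Rightarrow> real"
    assume "\<And>p. p \<in> U \<Longrightarrow> f p = f' p" "f differentiable_on U"
    then show "f' differentiable_on U"
      unfolding diff_on_iff differentiable_def
      using has_derivative_transform_within_open[OF _ open_U] by blast
  next
    fix f f' :: "real^'n \<Rightarrow> real" and p c
    assume "f differentiable_on U" "f' differentiable_on U" and p: "p \<in> U"
    then have f: "f differentiable (at p)" "f' differentiable (at p)" by (auto simp: diff_on_iff)
    have "pd c (\<lambda>p. f p + f' p) p = (\<Sum>k\<in>UNIV. pd k f p * (axis c 1 :: real^'n) $ k)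
        + (\<Sum>k\<in>UNIV. pd k f' p * (axis c 1 :: real^'n) $ k)"
      by (rule pd_has_derivative(2)) (intro has_derivative_add has_derivative_pd f)
    then show "pd c (\<lambda>p. f p + f' p) p = pd c f p + pd c f' p" by (simp add: sum_mult_axis)
    have "pd c (\<lambda>p. f p * f' p) p = f p * (\<Sum>k\<in>UNIV. pd k f' p * (axis c 1 :: real^'n) $ k)
        + (\<Sum>k\<in>UNIV. pd k f p * (axis c 1 :: real^'n) $ k) * f' p"
      by (rule pd_has_derivative(2)) (intro has_derivative_mult has_derivative_pd f)
    then show "pd c (\<lambda>p. f p * f' p) p = pd c f p * f' p + f p * pd c f' p" by (simp add: sum_mult_axis)
  next
    fix f f' :: "real^'n \<Rightarrow> real" and p c
    assume "\<And>p. p \<in> U \<Longrightarrow> f p = f' p" "p \<in> U"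
    then show "pd c f p = pd c f' p" by (rule pd_cong)
  next
    fix a p c show "pd c (\<lambda>p. a) p = 0" by (simp add: pd_def)
  qed (auto intro: differentiable_on_add differentiable_on_mult)
  show "derivations.smooth (\<lambda>f. f differentiable_on U) pd = smooth_fun U"
    by (intro ext) (simp add: derivations.smooth_foldr[OF d] smooth_fun_def)
qed

lemma smooth_differentiable: "smooth_fun U f \<Longrightarrow> u \<in> U \<Longrightarrow> f differentiable (at u)"
  using phase_fun.smooth_reg by (auto simp: diff_on_iff)

lemma smooth_continuous_on: "smooth_fun U f \<Longrightarrow> continuous_on U f"
  using phase_fun.smooth_reg by (auto intro: differentiable_imp_continuous_on)

text \<open>
  The derivative of \<open>1 / f\<close> is a polynomial in derivatives of \<open>f\<close> and \<open>1 / f\<close> itself, so the level of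
  smoothness goes up by one.
\<close>

lemma smooth_inverse:
  assumes "smooth_fun U f" and nz: "\<And>u. u \<in> U \<Longrightarrow> f u \<noteq> 0"
  shows "smooth_fun U (\<lambda>u. inverse (f u))"
proof -
  have "phase_fun.regs n (\<lambda>u. inverse (f u))" for n
  proof (induction n)
    case (Suc n)
    have f: "phase_fun.regs n (pd k f)" for k
      using phase_fun.smooth_d[OF assms(1)] by (simp add: phase_fun.smooth_def)
    have "phase_fun.regs n (pd k (\<lambda>u. inverse (f u)))" for k
    proof (rule phase_fun.regs_cong)
      show "phase_fun.regs n (\<lambda>u. - 1 * (pd k f u * inverse (f u) * inverse (f u)))"
        by (intro phase_fun.regs_mult phase_fun.regs_const f Suc.IH)
      show "- 1 * (pd k f u * inverse (f u) * inverse (f u)) = pd k (\<lambda>u. inverse (f u)) u"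
        if "u \<in> U" for u
        using pd_inverse[OF smooth_differentiable[OF assms(1) that] nz[OF that]] by simp
    qed
    moreover have "(\<lambda>u. inverse (f u)) differentiable_on U"
      using smooth_differentiable[OF assms(1)] nz
      by (auto simp: diff_on_iff intro: differentiable_inverse)
    ultimately show ?case by simp
  qed simp
  then show ?thesis by (simp add: phase_fun.smooth_def)
qed

lemma pd_commute:
  assumes f: "smooth_fun U f" and u: "u \<in> U"
  shows "pd j (pd k f) u = pd k (pd j f) u"
proof -
  define w where "w s t = u + s *\<^sub>R axis j 1 + t *\<^sub>R (axis k 1 :: real^'n)" for s t
  have cw: "continuous (at (a, b)) (\<lambda>z. w (fst z) (snd z))" for a b
    unfolding w_def by (intro continuous_intros)
  obtain e' where e': "e' > 0" "ball u e' \<subseteq> U"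
    using open_U u by (rule openE)
  define e where "e = e' / 2"
  have e: "e > 0" "ball u (2 * e) \<subseteq> U"
    using e' by (auto simp: e_def)
  have wU: "w s t \<in> U" if "\<bar>s\<bar> < e" "\<bar>t\<bar> < e" for s t
  proof -
    have "dist u (w s t) = norm (s *\<^sub>R axis j 1 + t *\<^sub>R (axis k 1 :: real^'n))"
      unfolding dist_norm by (subst norm_minus_commute) (simp add: w_def add.assoc)
    also have "\<dots> \<le> \<bar>s\<bar> + \<bar>t\<bar>"
      by (rule order_trans[OF norm_triangle_ineq]) simp
    finally show ?thesis using that e by auto
  qed
  have D1: "((\<lambda>s. h (w s t)) has_real_derivative pd j h (w s t)) (at s)"
    if "smooth_fun U h" "\<bar>s\<bar> < e" "\<bar>t\<bar> < e" for h s t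
  proof -
    have "((\<lambda>s. w s t) has_vector_derivative axis j 1) (at s)"
      unfolding w_def by (auto intro!: derivative_eq_intros)
    from chain_rule_pd[OF smooth_differentiable[OF that(1) wU] this] that(2,3)
    show ?thesis by (simp add: sum_mult_axis)
  qed
  have D2: "((\<lambda>t. h (w s t)) has_real_derivative pd k h (w s t)) (at t)"
    if "smooth_fun U h" "\<bar>s\<bar> < e" "\<bar>t\<bar> < e" for h s t
  proof -
    have "((\<lambda>t. w s t) has_vector_derivative axis k 1) (at t)"
      unfolding w_def by (auto intro!: derivative_eq_intros)
    from chain_rule_pd[OF smooth_differentiable[OF that(1) wU] this] that(2,3)
    show ?thesis by (simp add: sum_mult_axis)
  qed
  have C: "isCont (\<lambda>z. h (w (fst z) (snd z))) (0, 0)" if "smooth_fun U h" for h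
  proof -
    have "isCont h (w (fst (0, 0)) (snd (0, 0)))"
      using differentiable_imp_continuous_within[OF smooth_differentiable[OF that wU[of 0 0]]] e(1)
      by simp
    then show ?thesis by (rule isCont_o2[OF cw[of 0 0]])
  qed
  have "pd k (pd j f) (w 0 0) = pd j (pd k f) (w 0 0)"
    using e(1) f
    by (intro mixed_derivatives_eq[where e=e and \<phi>="\<lambda>s t. f (w s t)" and
      \<phi>s="\<lambda>s t. pd j f (w s t)" and \<phi>t="\<lambda>s t. pd k f (w s t)"] D1 D2 C phase_fun.smooth_d) auto
  then show ?thesis by (simp add: w_def)
qed

end


section \<open>Smooth loops\<close>

interpretation loop: derivations "UNIV :: real set" "\<lambda>h. h differentiable_on UNIV" "\<lambda>_::unit. deriv"
proof
  fix h h' :: "real \<Rightarrow> real" and x :: real and c :: unit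
  assume "h differentiable_on UNIV" "h' differentiable_on UNIV"
  then have *: "h field_differentiable at x" "h' field_differentiable at x"
    by (auto simp: differentiable_on_def real_differentiable_def field_differentiable_def)
  show "deriv (\<lambda>x. h x + h' x) x = deriv h x + deriv h' x"
    using * by (rule deriv_add)
  show "deriv (\<lambda>x. h x * h' x) x = deriv h x * h' x + h x * deriv h' x"
    using deriv_mult[OF *] by simp
next
  fix f f' :: "real \<Rightarrow> real" and p :: real and c :: unit
  assume "\<And>p. p \<in> UNIV \<Longrightarrow> f p = f' p"
  then have "f = f'" by auto
  then show "deriv f p = deriv f' p" and "f differentiable_on UNIV \<Longrightarrow> f' differentiable_on UNIV"
    by simp_all
qed (auto intro: differentiable_on_add differentiable_on_mult)

definition sloop :: "(real \<Rightarrow> real) \<Rightarrow> bool" where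
  "sloop h \<longleftrightarrow> loop.smooth h \<and> (\<forall>x. h (x + 1) = h x)"

lemma sloop_DERIV:
  assumes "sloop h" shows "(h has_real_derivative deriv h x) (at x)"
proof -
  have "h differentiable (at x)"
    using assms loop.smooth_reg by (auto simp: sloop_def differentiable_on_def)
  then show ?thesis by (simp add: DERIV_deriv_iff_real_differentiable)
qed

lemma sloop_continuous_on: "sloop h \<Longrightarrow> continuous_on S h"
  using DERIV_isCont[OF sloop_DERIV] by (simp add: continuous_at_imp_continuous_on)

lemma sloop_const: "sloop (\<lambda>x. a)"
  by (simp add: sloop_def loop.smooth_const)

lemma sloop_add: "sloop h \<Longrightarrow> sloop h' \<Longrightarrow> sloop (\<lambda>x. h x + h' x)"
  by (simp add: sloop_def loop.smooth_add)

lemma sloop_mult: "sloop h \<Longrightarrow> sloop h' \<Longrightarrow> sloop (\<lambda>x. h x * h' x)"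
  by (simp add: sloop_def loop.smooth_mult)

lemma sloop_uminus: "sloop h \<Longrightarrow> sloop (\<lambda>x. - h x)"
  by (simp add: sloop_def loop.smooth_uminus)

lemma sloop_diff: "sloop h \<Longrightarrow> sloop h' \<Longrightarrow> sloop (\<lambda>x. h x - h' x)"
  by (simp add: sloop_def loop.smooth_diff)

lemma sloop_sum: "(\<And>i. i \<in> I \<Longrightarrow> sloop (h i)) \<Longrightarrow> sloop (\<lambda>x. \<Sum>i\<in>I. h i x)"
  by (simp add: sloop_def loop.smooth_sum)

lemma sloop_deriv: assumes "sloop h" shows "sloop (deriv h)"
proof -
  have "deriv h (x + 1) = deriv h x" for x
  proof (rule DERIV_imp_deriv[symmetric])
    have "((\<lambda>y. h (y + 1)) has_real_derivative deriv h (x + 1) * 1) (at x)"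
      by (rule DERIV_chain2[OF sloop_DERIV[OF assms]]) (auto intro!: derivative_eq_intros)
    then show "(h has_real_derivative deriv h (x + 1)) (at x)"
      using assms by (simp add: sloop_def)
  qed
  with assms show ?thesis by (simp add: sloop_def loop.smooth_d)
qed

lemma sloop_deriv_funpow: "sloop h \<Longrightarrow> sloop ((deriv ^^ k) h)"
  by (induction k) (auto intro: sloop_deriv)

lemmas sloop_intros = sloop_const sloop_add sloop_mult sloop_uminus sloop_diff sloop_sum
  sloop_deriv sloop_deriv_funpow

lemma sloop_integrable: "sloop h \<Longrightarrow> h integrable_on {a..b}"
  by (intro integrable_continuous_real sloop_continuous_on)

lemma sloop_integral_deriv:
  assumes "sloop h"
  shows "integral {0..1} (deriv h) = 0"
proof -
  have "(deriv h has_integral h 1 - h 0) {0..1}"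
    by (rule fundamental_theorem_of_calculus)
      (auto intro!: has_field_derivative_at_within sloop_DERIV assms
        simp flip: has_real_derivative_iff_has_vector_derivative)
  moreover have "h 1 = h 0" using assms unfolding sloop_def by (metis add_0)
  ultimately show ?thesis by (simp add: integral_unique)
qed

lemma sloop_integral_0:
  assumes "sloop H" and "\<And>x. (H has_real_derivative h x) (at x)"
  shows "integral {0..1} h = 0"
proof -
  have "h = deriv H" using assms(2) by (intro ext) (metis DERIV_imp_deriv)
  with sloop_integral_deriv[OF assms(1)] show ?thesis by simp
qed

lemma sloop_by_parts:
  assumes "sloop p" "sloop q"
  shows "integral {0..1} (\<lambda>x. p x * deriv q x) = - integral {0..1} (\<lambda>x. deriv p x * q x)"
proof -
  have "integral {0..1} (\<lambda>x. deriv p x * q x + p x * deriv q x) = 0"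
    by (rule sloop_integral_0[OF sloop_mult[OF assms]])
      (auto intro!: derivative_eq_intros sloop_DERIV assms)
  moreover have "integral {0..1} (\<lambda>x. deriv p x * q x + p x * deriv q x)
      = integral {0..1} (\<lambda>x. deriv p x * q x) + integral {0..1} (\<lambda>x. p x * deriv q x)"
    by (intro integral_add sloop_integrable sloop_intros assms)
  ultimately show ?thesis by simp
qed

text \<open>
  No boundary terms occur on the circle.
\<close>

lemma sloop_by_parts_funpow:
  assumes "sloop p" "sloop q"
  shows "integral {0..1} (\<lambda>x. p x * (deriv ^^ k) q x)
       = integral {0..1} (\<lambda>x. (-1) ^ k * (deriv ^^ k) p x * q x)"
  using assms(2)
proof (induction k arbitrary: q)
  case (Suc k)
  have "integral {0..1} (\<lambda>x. p x * (deriv ^^ Suc k) q x)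
      = integral {0..1} (\<lambda>x. p x * (deriv ^^ k) (deriv q) x)"
    by (simp only: funpow_Suc_right o_apply)
  also have "\<dots> = integral {0..1} (\<lambda>x. ((-1) ^ k * (deriv ^^ k) p x) * deriv q x)"
    using Suc by (simp add: sloop_deriv)
  also have "\<dots> = - integral {0..1} (\<lambda>x. deriv (\<lambda>x. (-1) ^ k * (deriv ^^ k) p x) x * q x)"
    by (intro sloop_by_parts sloop_intros assms Suc.prems)
  also have "deriv (\<lambda>x. (-1) ^ k * (deriv ^^ k) p x) = (\<lambda>x. (-1) ^ k * (deriv ^^ Suc k) p x)"
    using sloop_DERIV[OF sloop_deriv_funpow[OF assms(1), of k]]
    by (intro ext DERIV_imp_deriv) (auto intro!: derivative_eq_intros)
  finally show ?case by simp
qed simp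


subsection \<open>Vector-valued loops\<close>

lemma has_vector_derivative_vec_iff:
  fixes w :: "real \<Rightarrow> real^'n"
  shows "(w has_vector_derivative w') (at x) \<longleftrightarrow>
    (\<forall>i. ((\<lambda>x. w x $ i) has_real_derivative w' $ i) (at x))"
proof
  assume "(w has_vector_derivative w') (at x)"
  then show "\<forall>i. ((\<lambda>x. w x $ i) has_real_derivative w' $ i) (at x)"
    using bounded_linear.has_vector_derivative[OF bounded_linear_vec_nth]
    by (auto simp: has_real_derivative_iff_has_vector_derivative)
next
  assume *: "\<forall>i. ((\<lambda>x. w x $ i) has_real_derivative w' $ i) (at x)"
  have e: "v = (\<Sum>i\<in>UNIV. (v $ i) *\<^sub>R axis i 1)" for v :: "real^'n"
    using basis_expansion[of v] by (simp add: scalar_mult_eq_scaleR)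
  have "((\<lambda>x. \<Sum>i\<in>UNIV. (w x $ i) *\<^sub>R axis i 1) has_vector_derivative
      (\<Sum>i\<in>UNIV. (w' $ i) *\<^sub>R (axis i 1 :: real^'n))) (at x)"
    by (rule has_vector_derivative_sum)
      (use * in \<open>auto intro!: derivative_eq_intros simp: has_real_derivative_iff_has_vector_derivative\<close>)
  then show "(w has_vector_derivative w') (at x)"
    by (simp flip: e)
qed

lemma differentiable_vec_iff:
  fixes w :: "real \<Rightarrow> real^'n"
  shows "w differentiable (at x) \<longleftrightarrow> (\<forall>i. (\<lambda>x. w x $ i) differentiable (at x))"
proof
  assume "w differentiable (at x)"
  then have "(w has_vector_derivative vector_derivative w (at x)) (at x)"
    by (simp add: vector_derivative_works)
  then show "\<forall>i. (\<lambda>x. w x $ i) differentiable (at x)"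
    unfolding has_vector_derivative_vec_iff by (auto simp: real_differentiable_def)
next
  assume "\<forall>i. (\<lambda>x. w x $ i) differentiable (at x)"
  then have "\<forall>i. ((\<lambda>x. w x $ i) has_real_derivative (\<chi> i. deriv (\<lambda>x. w x $ i) x) $ i) (at x)"
    by (simp add: DERIV_deriv_iff_real_differentiable)
  then show "w differentiable (at x)"
    unfolding has_vector_derivative_vec_iff[symmetric] by (rule differentiableI_vector)
qed

lemma xderiv_nth:
  assumes "w differentiable_on UNIV"
  shows "xderiv w x $ i = deriv (\<lambda>x. w x $ i) x"
proof -
  have "(w has_vector_derivative xderiv w x) (at x)"
    using assms unfolding xderiv_def by (simp add: differentiable_on_def flip: vector_derivative_works)
  then show ?thesis
    unfolding has_vector_derivative_vec_iff by (metis DERIV_imp_deriv)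
qed

lemma smooth_loops_xderiv_nth:
  assumes "\<And>j. j < k \<Longrightarrow> (xderiv ^^ j) w differentiable_on UNIV"
  shows "(xderiv ^^ k) w x $ i = (deriv ^^ k) (\<lambda>x. w x $ i) x"
  using assms
proof (induction k arbitrary: x)
  case (Suc k)
  have "(xderiv ^^ Suc k) w x $ i = deriv (\<lambda>x. (xderiv ^^ k) w x $ i) x"
    using xderiv_nth[OF Suc.prems[of k]] by simp
  also have "(\<lambda>x. (xderiv ^^ k) w x $ i) = (deriv ^^ k) (\<lambda>x. w x $ i)"
    using Suc by (intro ext) simp
  finally show ?case by simp
qed simp

lemma foldr_const_deriv: "foldr (\<lambda>_. deriv) cs h = (deriv ^^ length cs) h"
  by (induction cs) auto

lemma sloop_iff_funpow:
  "sloop h \<longleftrightarrow> (\<forall>k. (deriv ^^ k) h differentiable_on UNIV) \<and> (\<forall>x. h (x + 1) = h x)"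
proof -
  have "(\<forall>cs::unit list. (deriv ^^ length cs) h differentiable_on UNIV)
      \<longleftrightarrow> (\<forall>k. (deriv ^^ k) h differentiable_on UNIV)"
    by (metis length_replicate)
  then show ?thesis
    by (simp add: sloop_def loop.smooth_foldr foldr_const_deriv)
qed

lemma smooth_loops_iff:
  "w \<in> smooth_loops \<longleftrightarrow> (\<forall>i. sloop (\<lambda>x. w x $ i))"
proof
  assume w: "w \<in> smooth_loops"
  then have d: "(xderiv ^^ j) w differentiable_on UNIV" for j by (simp add: smooth_loops_def)
  have "(\<lambda>x. w x $ i) (x + 1) = (\<lambda>x. w x $ i) x" for i x using w by (simp add: smooth_loops_def)
  moreover have "(deriv ^^ k) (\<lambda>x. w x $ i) differentiable_on UNIV" for i k
  proof -
    have "(\<lambda>x. (xderiv ^^ k) w x $ i) differentiable_on UNIV"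
      using d[of k] unfolding differentiable_on_def by (simp add: differentiable_vec_iff)
    then show ?thesis by (simp add: smooth_loops_xderiv_nth d)
  qed
  ultimately show "\<forall>i. sloop (\<lambda>x. w x $ i)" by (simp add: sloop_iff_funpow)
next
  assume w: "\<forall>i. sloop (\<lambda>x. w x $ i)"
  have "(xderiv ^^ k) w differentiable_on UNIV" for k
  proof (induction k rule: less_induct)
    case (less k)
    have "(\<lambda>x. (xderiv ^^ k) w x $ i) differentiable_on UNIV" for i
      using w less by (simp add: smooth_loops_xderiv_nth sloop_iff_funpow)
    then show ?case by (simp add: differentiable_on_def differentiable_vec_iff)
  qed
  moreover have "w (x + 1) = w x" for x
    using w by (simp add: vec_eq_iff sloop_def)
  ultimately show "w \<in> smooth_loops" by (simp add: smooth_loops_def)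
qed

lemma sloop_nth: "w \<in> smooth_loops \<Longrightarrow> sloop (\<lambda>x. w x $ i)"
  by (simp add: smooth_loops_iff)

lemma funpow_xderiv_nth:
  "w \<in> smooth_loops \<Longrightarrow> (xderiv ^^ k) w x $ i = (deriv ^^ k) (\<lambda>x. w x $ i) x"
  by (rule smooth_loops_xderiv_nth) (simp add: smooth_loops_def)

lemma smooth_loops_xderiv: "w \<in> smooth_loops \<Longrightarrow> xderiv w \<in> smooth_loops"
  using funpow_xderiv_nth[of w 1] by (simp add: smooth_loops_iff sloop_deriv cong: if_cong)

lemma smooth_loops_funpow_xderiv: "w \<in> smooth_loops \<Longrightarrow> (xderiv ^^ k) w \<in> smooth_loops"
  by (induction k) (auto intro: smooth_loops_xderiv)

lemma smooth_loops_has_vector_derivative: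
  "w \<in> smooth_loops \<Longrightarrow> (w has_vector_derivative xderiv w x) (at x)"
  using funpow_xderiv_nth[of w 1]
  by (auto simp: has_vector_derivative_vec_iff sloop_nth intro: sloop_DERIV)

lemma smooth_loops_DERIV:
  "w \<in> smooth_loops \<Longrightarrow> ((\<lambda>x. w x $ i) has_real_derivative xderiv w x $ i) (at x)"
  using smooth_loops_has_vector_derivative has_vector_derivative_vec_iff by blast

lemma smooth_loops_continuous_on: "w \<in> smooth_loops \<Longrightarrow> continuous_on S w"
  by (meson smooth_loops_has_vector_derivative continuous_at_imp_continuous_on
      has_vector_derivative_continuous)

lemma smooth_loops_combine:
  assumes "u \<in> smooth_loops" "v \<in> smooth_loops"
  shows "(\<lambda>x. u x + e *\<^sub>R v x) \<in> smooth_loops"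
    and "(xderiv ^^ k) (\<lambda>x. u x + e *\<^sub>R v x) x = (xderiv ^^ k) u x + e *\<^sub>R (xderiv ^^ k) v x"
proof -
  show *: "(\<lambda>x. u x + e *\<^sub>R v x) \<in> smooth_loops"
    using assms by (auto simp: smooth_loops_iff intro!: sloop_intros)
  have "(deriv ^^ k) (\<lambda>x. a x + e * b x) = (\<lambda>x. (deriv ^^ k) a x + e * (deriv ^^ k) b x)"
    if "sloop a" "sloop b" for a b
  proof (induction k)
    case (Suc k)
    show ?case
      using sloop_DERIV[OF sloop_deriv_funpow[OF that(1)]] sloop_DERIV[OF sloop_deriv_funpow[OF that(2)]]
      by (auto simp: Suc intro!: ext DERIV_imp_deriv derivative_eq_intros)
  qed simp
  with assms * show "(xderiv ^^ k) (\<lambda>x. u x + e *\<^sub>R v x) x = (xderiv ^^ k) u x + e *\<^sub>R (xderiv ^^ k) v x"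
    by (simp add: vec_eq_iff funpow_xderiv_nth sloop_nth)
qed

text \<open>
  Tested against \<open>w\<close> itself the hypothesis makes the continuous function \<open>|w|\<^sup>2\<close> integrate to zero.
\<close>

lemma loop_integral_inner_eq_0:
  assumes w: "w \<in> smooth_loops"
    and zero: "\<And>v. v \<in> smooth_loops \<Longrightarrow> integral {0..1} (\<lambda>x. \<Sum>i\<in>UNIV. w x $ i * v x $ i) = 0"
  shows "w x = 0"
proof -
  define h where "h x = (\<Sum>i\<in>UNIV. w x $ i * w x $ i)" for x
  have h: "sloop h" unfolding h_def using w by (intro sloop_intros sloop_nth)
  have "integral {0..1} h = 0" unfolding h_def by (rule zero[OF w])
  moreover have "h x \<ge> 0" for x unfolding h_def by (intro sum_nonneg) simp
  ultimately have h0: "h x = 0" if "x \<in> {0..1}" for x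
    using integral_eq_0_iff[OF sloop_continuous_on[OF h], of 0 1] that by simp
  have "h x = h (frac x)"
  proof -
    have "h (y + real n) = h y" for y n
      by (induction n) (use h in \<open>auto simp: sloop_def simp flip: add.assoc\<close>,
        metis add.assoc add.commute)
    from this[of "frac x" "nat \<lfloor>x\<rfloor>"] this[of x "nat (- \<lfloor>x\<rfloor>)"] show ?thesis
      by (cases "\<lfloor>x\<rfloor> \<ge> 0") (auto simp: frac_def)
  qed
  also have "\<dots> = 0" by (rule h0) (simp add: less_imp_le[OF frac_lt_1])
  finally show ?thesis by (simp add: h_def sum_nonneg_eq_0_iff vec_eq_iff)
qed


section \<open>Smooth functions of jets\<close>

text \<open>
  Continuity into the space of jets, which carries the product topology, and equality of jets are both
  detected by these coordinates.
\<close>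

fun jet_coord :: "(nat \<times> 'n::finite) option \<Rightarrow> 'n jet \<Rightarrow> real" where
  "jet_coord None p = fst p"
| "jet_coord (Some (k, i)) p = snd p k $ i"

lemma jet_coord_shift:
  "jet_coord c (jet_shift c' t p) = jet_coord c p + (if c = c' then t else 0)"
  by (cases c; cases c'; cases p) (auto simp: axis_def split: if_splits)

lemma jet_eqI: "(\<And>c. jet_coord c p = jet_coord c q) \<Longrightarrow> p = q"
  by (cases p; cases q)
    (auto simp: vec_eq_iff fun_eq_iff dest: spec[of _ None] intro: jet_coord.simps,
     metis fst_conv jet_coord.simps(1), metis snd_conv jet_coord.simps(2))

lemma jet_shift_add: "jet_shift c s (jet_shift c t p) = jet_shift c (s + t) p"
  by (rule jet_eqI) (simp add: jet_coord_shift)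

lemma jet_shift_commute: "jet_shift c s (jet_shift c' t p) = jet_shift c' t (jet_shift c s p)"
  by (rule jet_eqI) (simp add: jet_coord_shift)

lemma jet_shift_0 [simp]: "jet_shift c 0 p = p"
  by (rule jet_eqI) (simp add: jet_coord_shift)

lemma norm_jet_shift_le: "norm (snd (jet_shift c s p) 0 - snd p 0) \<le> \<bar>s\<bar>"
  by (cases c; cases p) auto

lemma tendsto_fun:
  fixes l :: "'b \<Rightarrow> 'c::topological_space"
  assumes "\<And>k. ((\<lambda>t. J t k) \<longlongrightarrow> l k) F"
  shows "(J \<longlongrightarrow> l) F"
  using assms limitin_componentwise[of "\<lambda>_::'b. euclidean :: 'c topology" UNIV J l F]
  by (simp add: euclidean_product_topology)

lemma tendsto_jetI:
  fixes p :: "'n::finite jet"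
  assumes "\<And>c. ((\<lambda>t. jet_coord c (q t)) \<longlongrightarrow> jet_coord c p) F"
  shows "(q \<longlongrightarrow> p) F"
proof -
  have "((\<lambda>t. fst (q t)) \<longlongrightarrow> fst p) F" using assms[of None] by simp
  moreover have "((\<lambda>t. snd (q t)) \<longlongrightarrow> snd p) F"
    using assms[of "Some (k, i)" for k i] by (intro tendsto_fun vec_tendstoI) simp
  ultimately have "((\<lambda>t. (fst (q t), snd (q t))) \<longlongrightarrow> (fst p, snd p)) F"
    by (rule tendsto_Pair)
  then show ?thesis by simp
qed

lemma isCont_jetI:
  assumes "\<And>c. isCont (\<lambda>t. jet_coord c (q t)) a"
  shows "isCont q a"
  using assms tendsto_jetI unfolding isCont_def by blast

lemma continuous_on_jetI:
  assumes "\<And>c. continuous_on A (\<lambda>t. jet_coord c (q t))"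
  shows "continuous_on A q"
  using assms tendsto_jetI unfolding continuous_on_def by blast

lemma continuous_on_snd_0: "continuous_on A (\<lambda>p :: 'n::finite jet. snd p 0)"
proof -
  have "continuous_on UNIV (\<lambda>J :: nat \<Rightarrow> real^'n. J 0)" by simp
  from continuous_on_compose2[OF this continuous_on_snd[OF continuous_on_id]]
  show ?thesis by simp
qed

lemma continuous_on_jet_coord: "continuous_on A (jet_coord c :: 'n::finite jet \<Rightarrow> real)"
proof (cases c)
  case (Some ki)
  have "continuous_on UNIV (\<lambda>J :: nat \<Rightarrow> real^'n. J (fst ki))" by simp
  from continuous_on_compose2[OF this continuous_on_snd[OF continuous_on_id[of A]]]
  have "continuous_on A (\<lambda>p :: 'n jet. snd p (fst ki) $ snd ki)"
    by (intro continuous_intros) simp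
  moreover have "jet_coord c = (\<lambda>p :: 'n jet. snd p (fst ki) $ snd ki)"
    using Some by (cases ki) (auto simp: fun_eq_iff)
  ultimately show ?thesis by simp
next
  case None
  then have "jet_coord c = (fst :: 'n jet \<Rightarrow> real)" by (auto simp: fun_eq_iff)
  then show ?thesis by (simp add: continuous_on_fst)
qed

lemma mean_value_shift:
  fixes F :: "real \<Rightarrow> real"
  assumes "\<And>s. \<bar>s\<bar> \<le> \<bar>h\<bar> \<Longrightarrow> (F has_real_derivative F' s) (at s)"
  shows "\<exists>\<theta>. \<bar>\<theta>\<bar> \<le> \<bar>h\<bar> \<and> F h - F 0 = h * F' \<theta>"
proof (cases h "0 :: real" rule: linorder_cases)
  case less
  from MVT2[of h 0 F F'] less assms obtain z where "h < z" "z < 0" "F 0 - F h = (0 - h) * F' z"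
    by auto
  then show ?thesis by (intro exI[of _ z]) (auto simp: algebra_simps)
next
  case greater
  from MVT2[of 0 h F F'] greater assms obtain z where "0 < z" "z < h" "F h - F 0 = (h - 0) * F' z"
    by auto
  then show ?thesis by (intro exI[of _ z]) auto
qed auto

definition order_le :: "nat \<Rightarrow> ('n::finite jet \<Rightarrow> real) \<Rightarrow> bool" where
  "order_le m f \<longleftrightarrow> (\<forall>x J J'. (\<forall>k\<le>m. J k = J' k) \<longrightarrow> f (x, J) = f (x, J'))"

text \<open>
  The coordinates on which a function of order at most \<open>m\<close> depends.
\<close>

definition jet_coords :: "nat \<Rightarrow> (nat \<times> 'n::finite) option set" where
  "jet_coords m = insert None (Some ` ({..m} \<times> UNIV))"

lemma finite_jet_coords [simp]: "finite (jet_coords m)"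
  by (simp add: jet_coords_def)

lemma sum_jet_coords:
  "(\<Sum>c\<in>jet_coords m. h c) = h None + (\<Sum>k\<le>m. \<Sum>i\<in>UNIV. h (Some (k, i)))"
proof -
  have "(\<Sum>c\<in>jet_coords m. h c) = h None + (\<Sum>c\<in>Some ` ({..m} \<times> UNIV). h c)"
    unfolding jet_coords_def by (subst sum.insert) auto
  also have "(\<Sum>c\<in>Some ` ({..m} \<times> UNIV). h c) = (\<Sum>ki\<in>{..m} \<times> UNIV. h (Some ki))"
    by (subst sum.reindex) auto
  finally show ?thesis by (simp add: sum.cartesian_product)
qed

lemma order_le_cong:
  assumes "order_le m f" and "\<And>c. c \<in> jet_coords m \<Longrightarrow> jet_coord c p = jet_coord c q"
  shows "f p = f q"
proof -
  have "fst p = fst q" using assms(2)[of None] by (simp add: jet_coords_def)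
  moreover have "snd p k = snd q k" if "k \<le> m" for k
    using assms(2)[of "Some (k, i)" for i] that by (auto simp: vec_eq_iff jet_coords_def)
  ultimately show ?thesis
    using assms(1) unfolding order_le_def by (metis prod.collapse)
qed

lemma order_leI:
  assumes "\<And>p q. (\<And>c. c \<in> jet_coords m \<Longrightarrow> jet_coord c p = jet_coord c q) \<Longrightarrow> f p = f q"
  shows "order_le m f"
  unfolding order_le_def by (auto simp: jet_coords_def intro!: assms)

lemma order_le_jet_pd: "order_le m f \<Longrightarrow> order_le m (jet_pd c f)"
  unfolding jet_pd_def
  by (rule order_leI, rule arg_cong[where f="\<lambda>F. deriv F 0"], rule ext, rule order_le_cong)
    (auto simp: jet_coord_shift)

context phase_space
begin

lemma open_jets: "open (jets U)"
proof -
  have "jets U = (\<lambda>p. snd p 0) -` U" by (auto simp: jets_def)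
  then show ?thesis by (simp add: open_vimage[OF open_U continuous_on_snd_0])
qed

lemma jets_iff: "p \<in> jets U \<longleftrightarrow> snd p 0 \<in> U"
  by (cases p) (simp add: jets_def)

lemma eventually_shift_jets:
  assumes "p \<in> jets U" "((\<lambda>t. snd (q t) 0) \<longlongrightarrow> snd p 0) F" "(h \<longlongrightarrow> (0::real)) F"
  shows "\<forall>\<^sub>F t in F. \<forall>s. \<bar>s\<bar> \<le> \<bar>h t\<bar> \<longrightarrow> jet_shift c s (q t) \<in> jets U"
proof -
  obtain e where e: "e > 0" "ball (snd p 0) e \<subseteq> U"
    using assms(1) open_U by (auto simp: jets_iff elim: openE)
  have "\<forall>\<^sub>F t in F. dist (snd (q t) 0) (snd p 0) < e / 2"
    using tendstoD[OF assms(2), of "e/2"] e by simp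
  moreover have "\<forall>\<^sub>F t in F. \<bar>h t\<bar> < e / 2"
    using tendstoD[OF assms(3), of "e/2"] e by simp
  ultimately show ?thesis
  proof eventually_elim
    case (elim t)
    show ?case
    proof (intro allI impI)
      fix s assume s: "\<bar>s\<bar> \<le> \<bar>h t\<bar>"
      have "dist (snd (jet_shift c s (q t)) 0) (snd p 0)
          \<le> dist (snd (jet_shift c s (q t)) 0) (snd (q t) 0) + dist (snd (q t) 0) (snd p 0)"
        by (rule dist_triangle)
      also have "\<dots> < e"
        using elim s norm_jet_shift_le[of c s "q t"] by (simp add: dist_norm)
      finally show "jet_shift c s (q t) \<in> jets U"
        using e(2) by (auto simp: jets_iff dist_commute)
    qed
  qed
qed

lemma eventually_jets: "p \<in> jets U \<Longrightarrow> \<forall>\<^sub>F t in nhds 0. jet_shift c t p \<in> jets U"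
  using eventually_shift_jets[of p "\<lambda>_. p" "nhds 0" "\<lambda>t. t" c]
  by (auto simp: filterlim_ident elim: eventually_mono)

definition jet_reg :: "('n jet \<Rightarrow> real) \<Rightarrow> bool" where
  "jet_reg f \<longleftrightarrow> continuous_on (jets U) f \<and>
     (\<forall>c. \<forall>p\<in>jets U. (\<lambda>t. f (jet_shift c t p)) differentiable at 0)"

lemma jet_reg_DERIV:
  assumes "jet_reg f" "jet_shift c s p \<in> jets U"
  shows "((\<lambda>s. f (jet_shift c s p)) has_real_derivative jet_pd c f (jet_shift c s p)) (at s)"
proof -
  have "((\<lambda>t. f (jet_shift c t (jet_shift c s p))) has_real_derivative jet_pd c f (jet_shift c s p)) (at 0)"
    using assms unfolding jet_reg_def jet_pd_def by (simp add: DERIV_deriv_iff_real_differentiable)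
  then have "((\<lambda>t. f (jet_shift c (t + s) p)) has_real_derivative jet_pd c f (jet_shift c s p)) (at 0)"
    by (simp add: jet_shift_add)
  then show ?thesis by (subst (asm) DERIV_shift[symmetric]) simp
qed

lemma jet_pdI:
  assumes "((\<lambda>t. f (jet_shift c t p)) has_real_derivative D) (at 0)"
  shows "jet_pd c f p = D"
  unfolding jet_pd_def by (rule DERIV_imp_deriv[OF assms])

sublocale jet_fun: derivations "jets U" jet_reg jet_pd
  rewrites jet_fun_eq: "jet_fun.smooth = smooth_jet_fun U"
proof -
  have D: "((\<lambda>t. f (jet_shift c t p)) has_real_derivative jet_pd c f p) (at 0)"
    if "jet_reg f" "p \<in> jets U" for f c p
    using jet_reg_DERIV[of f c 0 p] that by simp
  show d: "derivations (jets U) jet_reg jet_pd"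
  proof
    fix f f' :: "'n jet \<Rightarrow> real" and p c
    assume eq: "\<And>p. p \<in> jets U \<Longrightarrow> f p = f' p"
    have ev: "\<forall>\<^sub>F t in nhds 0. f (jet_shift c t p) = f' (jet_shift c t p)" if "p \<in> jets U" for c p
      using eventually_jets[OF that] by eventually_elim (rule eq)
    show "p \<in> jets U \<Longrightarrow> jet_pd c f p = jet_pd c f' p"
      unfolding jet_pd_def by (intro deriv_cong_ev ev) auto
    assume f: "jet_reg f"
    have "continuous_on (jets U) f'"
      using f eq by (auto simp: jet_reg_def cong: continuous_on_cong)
    moreover have "(\<lambda>t. f' (jet_shift c t p)) differentiable at 0" if "p \<in> jets U" for c p
      using DERIV_cong_ev[THEN iffD1, OF refl ev[OF that] refl D[OF f that]]
      by (auto simp: real_differentiable_def)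
    ultimately show "jet_reg f'" by (simp add: jet_reg_def)
  next
    fix f f' :: "'n jet \<Rightarrow> real" and p c
    assume f: "jet_reg f" "jet_reg f'"
    then show "jet_reg (\<lambda>p. f p + f' p)" "jet_reg (\<lambda>p. f p * f' p)"
      by (auto simp: jet_reg_def intro!: continuous_intros differentiable_add differentiable_mult)
    assume p: "p \<in> jets U"
    show "jet_pd c (\<lambda>p. f p + f' p) p = jet_pd c f p + jet_pd c f' p"
      by (rule jet_pdI) (intro DERIV_add D f p)
    have "jet_pd c (\<lambda>p. f p * f' p) p
        = jet_pd c f p * f' (jet_shift c 0 p) + jet_pd c f' p * f (jet_shift c 0 p)"
      by (rule jet_pdI) (intro DERIV_mult D f p)
    then show "jet_pd c (\<lambda>p. f p * f' p) p = jet_pd c f p * f' p + f p * jet_pd c f' p"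
      by simp
  qed (auto simp: jet_reg_def jet_pd_def)
  show "derivations.smooth jet_reg jet_pd = smooth_jet_fun U"
    by (intro ext) (simp add: derivations.smooth_foldr[OF d] smooth_jet_fun_def jet_reg_def)
qed

lemma smooth_jet_isCont: "smooth_jet_fun U f \<Longrightarrow> p \<in> jets U \<Longrightarrow> isCont f p"
  using jet_fun.smooth_reg[of f] open_jets by (auto simp: jet_reg_def continuous_on_eq_continuous_at)

text \<open>
  Only separate differentiability in each coordinate is available; the mean value theorem in the
  direction \<open>c\<close> and continuity of the partial derivative compensate for the motion of \<open>q\<close>.
\<close>

lemma jet_shift_increment_DERIV:
  assumes f: "smooth_jet_fun U f" and p: "p \<in> jets U"
    and q: "\<And>c. ((\<lambda>t. jet_coord c (q t)) \<longlongrightarrow> jet_coord c p) (at t0)"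
    and h: "(h has_real_derivative a) (at t0)" "h t0 = 0"
  shows "((\<lambda>t. f (jet_shift c (h t) (q t)) - f (q t)) has_real_derivative jet_pd c f p * a) (at t0)"
proof -
  have h0: "(h \<longlongrightarrow> 0) (at t0)"
    using DERIV_isCont[OF h(1)] h(2) by (simp add: isCont_def)
  have q0: "((\<lambda>t. snd (q t) 0) \<longlongrightarrow> snd p 0) (at t0)"
    using q[of "Some (0, i)" for i] by (intro vec_tendstoI) simp
  define E where "E t \<longleftrightarrow> (\<forall>s. \<bar>s\<bar> \<le> \<bar>h t\<bar> \<longrightarrow> jet_shift c s (q t) \<in> jets U)" for t
  have E: "\<forall>\<^sub>F t in at t0. E t"
    unfolding E_def by (rule eventually_shift_jets[OF p q0 h0])
  have "\<exists>\<theta>. \<bar>\<theta>\<bar> \<le> \<bar>h t\<bar> \<and> (E t \<longrightarrow>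
      f (jet_shift c (h t) (q t)) - f (q t) = h t * jet_pd c f (jet_shift c \<theta> (q t)))" for t
  proof (cases "E t")
    case True
    then show ?thesis
      using mean_value_shift[of "h t" "\<lambda>s. f (jet_shift c s (q t))" "\<lambda>s. jet_pd c f (jet_shift c s (q t))"]
        jet_reg_DERIV[OF jet_fun.smooth_reg[OF f]] by (auto simp: E_def)
  qed auto
  then obtain \<theta> where \<theta>: "\<And>t. \<bar>\<theta> t\<bar> \<le> \<bar>h t\<bar>" "\<And>t. E t \<Longrightarrow>
      f (jet_shift c (h t) (q t)) - f (q t) = h t * jet_pd c f (jet_shift c (\<theta> t) (q t))"
    by metis
  have \<theta>0: "(\<theta> \<longlongrightarrow> 0) (at t0)"
    using h0 by (rule Lim_null_comparison[rotated, OF tendsto_rabs_zero]) (simp add: \<theta>(1))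
  have "((\<lambda>t. jet_shift c (\<theta> t) (q t)) \<longlongrightarrow> p) (at t0)"
  proof (rule tendsto_jetI)
    fix c'
    have "((\<lambda>t. if c' = c then \<theta> t else 0) \<longlongrightarrow> 0) (at t0)"
      using \<theta>0 by (cases "c' = c") auto
    from tendsto_add[OF q[of c'] this]
    show "((\<lambda>t. jet_coord c' (jet_shift c (\<theta> t) (q t))) \<longlongrightarrow> jet_coord c' p) (at t0)"
      by (simp add: jet_coord_shift)
  qed
  from isCont_tendsto_compose[OF smooth_jet_isCont[OF jet_fun.smooth_d[OF f] p] this]
  have G: "((\<lambda>t. jet_pd c f (jet_shift c (\<theta> t) (q t))) \<longlongrightarrow> jet_pd c f p) (at t0)" .
  have "((\<lambda>t. (h t - h t0) / (t - t0)) \<longlongrightarrow> a) (at t0)"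
    using h(1) by (simp add: has_field_derivative_iff)
  from tendsto_mult[OF G this]
  have "((\<lambda>t. jet_pd c f (jet_shift c (\<theta> t) (q t)) * (h t / (t - t0))) \<longlongrightarrow> jet_pd c f p * a) (at t0)"
    by (simp add: h(2))
  then show ?thesis
    unfolding has_field_derivative_iff
  proof (rule Lim_transform_eventually)
    show "\<forall>\<^sub>F t in at t0. jet_pd c f (jet_shift c (\<theta> t) (q t)) * (h t / (t - t0))
        = (f (jet_shift c (h t) (q t)) - f (q t) - (f (jet_shift c (h t0) (q t0)) - f (q t0))) / (t - t0)"
      using E by eventually_elim (simp add: \<theta>(2) h(2))
  qed
qed

lemma jet_shifts_DERIV:
  assumes f: "smooth_jet_fun U f" and p: "p \<in> jets U"
    and h: "\<And>c. (h c has_real_derivative a c) (at t0)" "\<And>c. h c t0 = 0"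
    and "distinct cs"
  shows "((\<lambda>t. f (foldr (\<lambda>c. jet_shift c (h c t)) cs p)) has_real_derivative
      (\<Sum>c\<in>set cs. jet_pd c f p * a c)) (at t0)"
  using \<open>distinct cs\<close>
proof (induction cs)
  case (Cons c cs)
  define q where "q t = foldr (\<lambda>c. jet_shift c (h c t)) cs p" for t
  have coord: "jet_coord c' (foldr (\<lambda>c. jet_shift c (h c t)) ds p)
      = jet_coord c' p + (if c' \<in> set ds then h c' t else 0)" if "distinct ds" for c' t ds
    using that by (induction ds) (auto simp: jet_coord_shift)
  have "((\<lambda>t. jet_coord c' (q t)) \<longlongrightarrow> jet_coord c' p) (at t0)" for c'
  proof -
    have "(h c' \<longlongrightarrow> 0) (at t0)"
      using DERIV_isCont[OF h(1)[of c']] h(2)[of c'] by (simp add: isCont_def)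
    then have "((\<lambda>t. jet_coord c' p + (if c' \<in> set cs then h c' t else 0)) \<longlongrightarrow> jet_coord c' p + 0) (at t0)"
      by (intro tendsto_intros) (cases "c' \<in> set cs", auto)
    then show ?thesis using Cons.prems by (simp add: q_def coord)
  qed
  from DERIV_add[OF jet_shift_increment_DERIV[OF f p this h[of c]] Cons.IH] Cons.prems
  show ?case by (simp add: q_def)
qed simp

text \<open>
  A function of finite order sees only finitely many coordinates of the path, so the path can be replaced
  by shifts along these coordinates, performed one after the other.
\<close>

lemma jet_chain_rule:
  assumes f: "smooth_jet_fun U f" "order_le m f" and p: "p t0 \<in> jets U"
    and a: "\<And>c. ((\<lambda>t. jet_coord c (p t)) has_real_derivative a c) (at t0)"
  shows "((\<lambda>t. f (p t)) has_real_derivative (\<Sum>c\<in>jet_coords m. jet_pd c f (p t0) * a c)) (at t0)"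
proof -
  obtain cs :: "(nat \<times> 'n) option list" where cs: "set cs = jet_coords m" "distinct cs"
    using finite_distinct_list[OF finite_jet_coords] by blast
  define h where "h c t = jet_coord c (p t) - jet_coord c (p t0)" for c t
  have coord: "jet_coord c' (foldr (\<lambda>c. jet_shift c (h c t)) ds (p t0))
      = jet_coord c' (p t0) + (if c' \<in> set ds then h c' t else 0)" if "distinct ds" for c' t ds
    using that by (induction ds) (auto simp: jet_coord_shift)
  have "f (p t) = f (foldr (\<lambda>c. jet_shift c (h c t)) cs (p t0))" for t
    using f(2) by (rule order_le_cong) (simp add: coord cs, simp add: h_def)
  moreover have "((\<lambda>t. f (foldr (\<lambda>c. jet_shift c (h c t)) cs (p t0))) has_real_derivative
      (\<Sum>c\<in>set cs. jet_pd c f (p t0) * a c)) (at t0)"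
    by (rule jet_shifts_DERIV[OF f(1) p _ _ cs(2)])
      (auto simp: h_def intro!: derivative_eq_intros a)
  ultimately show ?thesis by (simp add: cs(1))
qed

lemma jet_pd_commute:
  assumes f: "smooth_jet_fun U f" and p: "p \<in> jets U"
  shows "jet_pd c (jet_pd c' f) p = jet_pd c' (jet_pd c f) p"
proof -
  define w where "w s t = jet_shift c s (jet_shift c' t p)" for s t
  have w': "w s t = jet_shift c' t (jet_shift c s p)" for s t
    unfolding w_def by (rule jet_shift_commute)
  obtain e' where e': "e' > 0" "ball (snd p 0) e' \<subseteq> U"
    using p open_U by (auto simp: jets_iff elim: openE)
  define e where "e = e' / 2"
  have wU: "w s t \<in> jets U" if "\<bar>s\<bar> < e" "\<bar>t\<bar> < e" for s t
  proof -
    have "dist (snd (w s t) 0) (snd p 0)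
        \<le> dist (snd (w s t) 0) (snd (jet_shift c' t p) 0) + dist (snd (jet_shift c' t p) 0) (snd p 0)"
      by (rule dist_triangle)
    also have "\<dots> \<le> \<bar>s\<bar> + \<bar>t\<bar>"
      unfolding dist_norm w_def by (intro add_mono norm_jet_shift_le)
    finally show ?thesis using that e' by (auto simp: e_def jets_iff dist_commute)
  qed
  have D1: "((\<lambda>s. h (w s t)) has_real_derivative jet_pd c h (w s t)) (at s)"
    if "smooth_jet_fun U h" "\<bar>s\<bar> < e" "\<bar>t\<bar> < e" for h s t
    using jet_reg_DERIV[OF jet_fun.smooth_reg[OF that(1)]] wU[OF that(2,3)] unfolding w_def by blast
  have D2: "((\<lambda>t. h (w s t)) has_real_derivative jet_pd c' h (w s t)) (at t)"
    if "smooth_jet_fun U h" "\<bar>s\<bar> < e" "\<bar>t\<bar> < e" for h s t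
    using jet_reg_DERIV[OF jet_fun.smooth_reg[OF that(1)]] wU[OF that(2,3)] unfolding w' by blast
  have C: "isCont (\<lambda>z. h (w (fst z) (snd z))) (0, 0)" if "smooth_jet_fun U h" for h
  proof -
    have "isCont (\<lambda>z. w (fst z) (snd z)) (0, 0)"
    proof (rule isCont_jetI)
      fix c''
      have "isCont (\<lambda>z::real\<times>real. jet_coord c'' p + (if c'' = c' then snd z else 0) + (if c''
          = c then fst z else 0)) (0, 0)"
        by (cases "c'' = c"; cases "c'' = c'") (auto intro!: continuous_intros)
      then show "isCont (\<lambda>z. jet_coord c'' (w (fst z) (snd z))) (0, 0)"
        by (simp add: w_def jet_coord_shift)
    qed
    moreover have "isCont h (w (fst (0, 0)) (snd (0, 0)))"
      using smooth_jet_isCont[OF that p] by (simp add: w_def)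
    ultimately show ?thesis by (rule isCont_o2)
  qed
  have "jet_pd c' (jet_pd c f) (w 0 0) = jet_pd c (jet_pd c' f) (w 0 0)"
    using e'(1) f
    by (intro mixed_derivatives_eq[where e=e and \<phi>="\<lambda>s t. f (w s t)" and
      \<phi>s="\<lambda>s t. jet_pd c f (w s t)" and \<phi>t="\<lambda>s t. jet_pd c' f (w s t)"] D1 D2 C jet_fun.smooth_d)
      (auto simp: e_def)
  then show ?thesis by (simp add: w_def)
qed

end


section \<open>Local functionals and their variations\<close>

text \<open>
  The velocity of a coordinate along the prolongation of a field.
\<close>

fun jet_next :: "(nat \<times> 'n::finite) option \<Rightarrow> 'n jet \<Rightarrow> real" where
  "jet_next None p = 1"
| "jet_next (Some (k, i)) p = snd p (Suc k) $ i"

text \<open>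
  The velocity of a coordinate under a variation of the field, which leaves \<open>x\<close> fixed.
\<close>

fun loop_coord :: "(nat \<times> 'n::finite) option \<Rightarrow> (real \<Rightarrow> real^'n) \<Rightarrow> real \<Rightarrow> real" where
  "loop_coord None v x = 0"
| "loop_coord (Some (k, i)) v x = (xderiv ^^ k) v x $ i"

lemma sloop_loop_coord: "v \<in> smooth_loops \<Longrightarrow> sloop (loop_coord c v)"
proof (cases c)
  case (Some ki)
  assume "v \<in> smooth_loops"
  from sloop_nth[OF smooth_loops_funpow_xderiv[OF this]] Some
  show ?thesis by (cases ki) (simp add: fun_eq_iff[symmetric] cong: if_cong, metis (no_types, lifting)
      ext loop_coord.simps(2))
next
  case None
  then have "loop_coord c v = (\<lambda>_. 0)" by (simp add: fun_eq_iff)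
  then show ?thesis by (simp add: sloop_const)
qed

lemma jet_coord_prolong_DERIV:
  assumes "u \<in> smooth_loops"
  shows "((\<lambda>x. jet_coord c (prolong u x)) has_real_derivative jet_next c (prolong u x)) (at x)"
proof (cases c)
  case (Some ki)
  then show ?thesis
    using smooth_loops_DERIV[OF smooth_loops_funpow_xderiv[OF assms, of "fst ki"], of "snd ki" x]
    by (cases ki) (simp add: prolong_def)
qed (simp add: prolong_def)

lemma jet_coord_prolong_variation:
  assumes "u \<in> smooth_loops" "v \<in> smooth_loops"
  shows "jet_coord c (prolong (\<lambda>x. u x + t *\<^sub>R v x) x) = jet_coord c (prolong u x) + t * loop_coord c v x"
  by (cases c; auto simp: prolong_def smooth_loops_combine(2)[OF assms])

lemma continuous_on_jet_coord_prolong: "u \<in> smooth_loops \<Longrightarrow> continuous_on A (\<lambda>x. jet_coord c (prolong u x))"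
  by (intro continuous_at_imp_continuous_on ballI DERIV_isCont[OF jet_coord_prolong_DERIV])

text \<open>
  The derivative along prolonged fields, see \<open>prolong_DERIV\<close>; the bound \<open>m\<close> on the order keeps the sum
  finite.
\<close>

definition total_deriv :: "nat \<Rightarrow> ('n::finite jet \<Rightarrow> real) \<Rightarrow> 'n jet \<Rightarrow> real" where
  "total_deriv m f p = (\<Sum>c\<in>jet_coords m. jet_pd c f p * jet_next c p)"

primrec total_deriv_iter :: "nat \<Rightarrow> nat \<Rightarrow> ('n::finite jet \<Rightarrow> real) \<Rightarrow> 'n jet \<Rightarrow> real" where
  "total_deriv_iter m 0 f = f"
| "total_deriv_iter m (Suc k) f = total_deriv (m + k) (total_deriv_iter m k f)"

text \<open>
  The derivative of \<open>u \<mapsto> f (prolong u x)\<close> in the direction \<open>v\<close>.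
\<close>

definition linearization :: "nat \<Rightarrow> ('n::finite jet \<Rightarrow> real) \<Rightarrow> (real \<Rightarrow> real^'n) \<Rightarrow> (real \<Rightarrow> real^'n) \<Rightarrow> real
    \<Rightarrow> real" where
  "linearization m f u v x = (\<Sum>c\<in>jet_coords m. jet_pd c f (prolong u x) * loop_coord c v x)"

definition euler_op :: "nat \<Rightarrow> ('n::finite jet \<Rightarrow> real) \<Rightarrow> 'n \<Rightarrow> 'n jet \<Rightarrow> real" where
  "euler_op m f i p = (\<Sum>k\<le>m. (-1) ^ k * total_deriv_iter m k (jet_pd (Some (k, i)) f) p)"

context phase_space
begin

definition density_le :: "nat \<Rightarrow> ('n jet \<Rightarrow> real) \<Rightarrow> bool" where
  "density_le m f \<longleftrightarrow> smooth_jet_fun U f \<and> order_le m f \<and> (\<forall>p. f (jet_shift None 1 p) = f p)"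

lemma density_iff_density_le: "density U f \<longleftrightarrow> (\<exists>m. density_le m f)"
  by (auto simp: density_def density_le_def order_le_def)

lemma density_le_periodic: "density_le m f \<Longrightarrow> f (jet_shift None 1 p) = f p"
  unfolding density_le_def by blast

lemma density_le_const: "density_le m (\<lambda>p. a)"
  by (simp add: density_le_def jet_fun.smooth_const order_le_def)

lemma density_le_add: "density_le m f \<Longrightarrow> density_le m f' \<Longrightarrow> density_le m (\<lambda>p. f p + f' p)"
  unfolding density_le_def order_le_def by (simp add: jet_fun.smooth_add) metis

lemma density_le_mult: "density_le m f \<Longrightarrow> density_le m f' \<Longrightarrow> density_le m (\<lambda>p. f p * f' p)"
  unfolding density_le_def order_le_def by (simp add: jet_fun.smooth_mult) metis

lemma density_le_sum: "(\<And>i. i \<in> I \<Longrightarrow> density_le m (f i)) \<Longrightarrow> density_le m (\<lambda>p. \<Sum>i\<in>I. f i p)"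
  by (induction I rule: infinite_finite_induct) (auto simp: density_le_const intro!: density_le_add)

lemma density_le_mono: "density_le m f \<Longrightarrow> m \<le> m' \<Longrightarrow> density_le m' f"
  unfolding density_le_def order_le_def by auto

lemma density_le_jet_pd: "density_le m f \<Longrightarrow> density_le m (jet_pd c f)"
  unfolding density_le_def
proof (intro conjI allI)
  assume f: "smooth_jet_fun U f \<and> order_le m f \<and> (\<forall>p. f (jet_shift None 1 p) = f p)"
  then show "smooth_jet_fun U (jet_pd c f)" "order_le m (jet_pd c f)"
    by (simp_all add: jet_fun.smooth_d order_le_jet_pd del: split_paired_All)
  from f have "f (jet_shift c t (jet_shift None 1 p)) = f (jet_shift c t p)" for t p
    unfolding jet_shift_commute[of c] by blast
  then show "jet_pd c f (jet_shift None 1 p) = jet_pd c f p" for p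
    by (simp add: jet_pd_def)
qed

lemma smooth_jet_coord: "smooth_jet_fun U (jet_coord c)"
proof -
  have pd: "jet_pd c' (jet_coord c) p = (if c = c' then 1 else 0)" for p :: "'n jet" and c'
    by (rule jet_pdI) (auto simp: jet_coord_shift intro!: derivative_eq_intros)
  have diff: "(\<lambda>t. jet_coord c (jet_shift c' t p)) differentiable at 0" for p c'
    unfolding jet_coord_shift by (cases "c = c'") auto
  show ?thesis
    unfolding jet_fun.smooth_iff[of "jet_coord c"] jet_reg_def
    using diff continuous_on_jet_coord
    by (auto simp: pd[abs_def] intro: jet_fun.smooth_cong[OF _ jet_fun.smooth_const])
qed

lemma density_le_coord: "k \<le> m \<Longrightarrow> density_le m (\<lambda>p. snd p k $ i)"
proof -
  have "jet_coord (Some (k, i)) = (\<lambda>p :: 'n jet. snd p k $ i)" by (simp add: fun_eq_iff)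
  with smooth_jet_coord[of "Some (k, i)"] have "smooth_jet_fun U (\<lambda>p. snd p k $ i)" by simp
  moreover assume "k \<le> m"
  ultimately show ?thesis by (auto simp: density_le_def order_le_def)
qed

lemma density_le_next: "c \<in> jet_coords m \<Longrightarrow> density_le (Suc m) (jet_next c)"
proof (cases c)
  case None
  then have "jet_next c = (\<lambda>_. 1)" by (simp add: fun_eq_iff)
  then show ?thesis by (simp add: density_le_const)
next
  case (Some ki)
  assume "c \<in> jet_coords m"
  with Some have "Suc (fst ki) \<le> Suc m" by (cases ki) (auto simp: jet_coords_def)
  moreover have "jet_next c = (\<lambda>p. snd p (Suc (fst ki)) $ snd ki)"
    using Some by (cases ki) (simp add: fun_eq_iff)
  ultimately show ?thesis by (simp only: density_le_coord)
qed

text \<open>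
  The total derivative involves one more \<open>x\<close>-derivative of the field, so the order goes up by one.
\<close>

lemma density_le_total_deriv: "density_le m f \<Longrightarrow> density_le (Suc m) (total_deriv m f)"
  unfolding total_deriv_def[abs_def]
  by (intro density_le_sum density_le_mult density_le_next) (auto intro: density_le_mono density_le_jet_pd)

lemma density_le_total_deriv_iter: "density_le m f \<Longrightarrow> density_le (m + k) (total_deriv_iter m k f)"
  by (induction k) (auto dest: density_le_total_deriv)

lemma density_le_euler_op: "density_le m f \<Longrightarrow> density_le (2 * m) (euler_op m f i)"
  unfolding euler_op_def[abs_def]
  by (intro density_le_sum density_le_mult density_le_const)
    (auto intro!: density_le_mono[OF density_le_total_deriv_iter] density_le_jet_pd)

text \<open>
  A function of \<open>u\<close> alone has its own partial derivatives in the coordinates of order zero, and they are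
  again functions of \<open>u\<close> alone.
\<close>

lemma density_le_phase_fun:
  assumes "smooth_fun U h"
  shows "density_le m (\<lambda>p. h (snd p 0))"
proof -
  have "jet_fun.regs n (\<lambda>p. h (snd p 0))" if "smooth_fun U h" for n h
    using that
  proof (induction n arbitrary: h)
    case (Suc n)
    have D: "((\<lambda>t. h (snd (jet_shift c t p) 0)) has_real_derivative
        (case c of Some (0, i) \<Rightarrow> pd i h (snd p 0) | _ \<Rightarrow> 0)) (at 0)" if "p \<in> jets U" for c p
    proof (cases "\<exists>i. c = Some (0, i)")
      case True
      then obtain i where i: "c = Some (0, i)" by blast
      have "((\<lambda>t. h (snd p 0 + t *\<^sub>R axis i 1)) has_real_derivative pd i h (snd p 0)) (at 0)"
        using pd_has_derivative(1)[OF has_derivative_pd[OF smooth_differentiable[OF Suc.prems]]] that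
        by (simp add: sum_mult_axis jets_iff)
      then show ?thesis using i by (cases p) simp
    next
      case False
      then show ?thesis by (cases c; cases p) (auto split: nat.splits)
    qed
    have "jet_fun.regs n (jet_pd c (\<lambda>p. h (snd p 0)))" for c
    proof (rule jet_fun.regs_cong)
      show "(case c of Some (0, i) \<Rightarrow> pd i h (snd p 0) | _ \<Rightarrow> 0) = jet_pd c (\<lambda>p. h (snd p 0)) p"
        if "p \<in> jets U" for p
        using jet_pdI[where f="\<lambda>p. h (snd p 0)", OF D[OF that, of c]] by simp
      show "jet_fun.regs n (\<lambda>p. case c of Some (0, i) \<Rightarrow> pd i h (snd p 0) | _ \<Rightarrow> 0)"
      proof (cases "\<exists>i. c = Some (0, i)")
        case True
        then obtain i where i: "c = Some (0, i)" by blast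
        show ?thesis using Suc.IH[OF phase_fun.smooth_d[OF Suc.prems, of i]] by (simp add: i)
      next
        case False
        then have "(\<lambda>p. case c of Some (0, i) \<Rightarrow> pd i h (snd p 0) | _ \<Rightarrow> 0) = (\<lambda>p :: 'n jet. 0)"
          by (auto split: option.splits nat.splits)
        then show ?thesis by (simp only: jet_fun.regs_const)
      qed
    qed
    moreover have "continuous_on (jets U) (\<lambda>p. h (snd p 0))"
      by (rule continuous_on_compose2[OF smooth_continuous_on[OF Suc.prems] continuous_on_snd_0])
        (auto simp: jets_iff)
    moreover have "(\<lambda>t. h (snd (jet_shift c t p) 0)) differentiable at 0" if "p \<in> jets U" for c p
      using D[of p c] that unfolding real_differentiable_def by blast
    ultimately show ?case
      unfolding jet_fun.regs.simps using jet_reg_def by blast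
  qed simp
  with assms show ?thesis
    by (simp add: density_le_def jet_fun.smooth_def order_le_def split_paired_all)
qed

lemma density_le_sloop:
  assumes "sloop h"
  shows "density_le m (\<lambda>p. h (fst p))"
proof -
  have "jet_fun.regs n (\<lambda>p. h (fst p))" if "sloop h" for n h
    using that
  proof (induction n arbitrary: h)
    case (Suc n)
    have D: "((\<lambda>t. h (fst (jet_shift c t p))) has_real_derivative
        (if c = None then deriv h (fst p) else 0)) (at 0)" for c p
    proof (cases "c = None")
      case True
      have "((\<lambda>t. h (fst p + t)) has_real_derivative deriv h (fst p)) (at 0)"
        using sloop_DERIV[OF Suc.prems, of "fst p + 0"] DERIV_shift[of h _ 0 "fst p"]
        by (simp add: add.commute)
      then show ?thesis using True by (cases p) simp
    qed (cases c; cases p; auto)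
    have "jet_fun.regs n (jet_pd c (\<lambda>p. h (fst p)))" for c
    proof (rule jet_fun.regs_cong)
      show "(if c = None then deriv h (fst p) else 0) = jet_pd c (\<lambda>p. h (fst p)) p" for p
        using jet_pdI[where f="\<lambda>p. h (fst p)", OF D[of c p]] by simp
      show "jet_fun.regs n (\<lambda>p. if c = None then deriv h (fst p) else 0)"
        using Suc.IH[OF sloop_deriv[OF Suc.prems]] by (cases c) (auto simp: jet_fun.regs_const)
    qed
    moreover have "continuous_on (jets U) (\<lambda>p. h (fst p))"
      by (rule continuous_on_compose2[OF sloop_continuous_on[OF Suc.prems, of UNIV]])
        (auto intro: continuous_intros)
    moreover have "(\<lambda>t. h (fst (jet_shift c t p))) differentiable at 0" if "p \<in> jets U" for c p
      using D[of c p] unfolding real_differentiable_def by blast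
    ultimately show ?case
      unfolding jet_fun.regs.simps using jet_reg_def by blast
  qed simp
  with assms show ?thesis
    by (simp add: density_le_def jet_fun.smooth_def order_le_def sloop_def split_paired_all)
qed


subsection \<open>Evaluation along a field\<close>

lemma fields_smooth: "u \<in> fields U \<Longrightarrow> u \<in> smooth_loops"
  and fields_in: "u \<in> fields U \<Longrightarrow> u x \<in> U"
  by (auto simp: fields_def)

lemma prolong_jets: "u \<in> fields U \<Longrightarrow> prolong u x \<in> jets U"
  by (simp add: prolong_def jets_def fields_in)

lemma prolong_DERIV:
  assumes "density_le m f" "u \<in> fields U"
  shows "((\<lambda>x. f (prolong u x)) has_real_derivative total_deriv m f (prolong u x)) (at x)"
  unfolding total_deriv_def
  by (rule jet_chain_rule)
    (use assms in \<open>auto simp: density_le_def fields_smooth prolong_jets intro: jet_coord_prolong_DERIV\<close>)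

text \<open>
  Differentiation along a field is the total derivative, which stays in the class of densities.
\<close>

lemma sloop_prolong:
  assumes "density_le m f" "u \<in> fields U"
  shows "sloop (\<lambda>x. f (prolong u x))"
proof -
  have "loop.regs n (\<lambda>x. f (prolong u x))" if "density_le m f" for n m f
    using that
  proof (induction n arbitrary: m f)
    case (Suc n)
    have "deriv (\<lambda>x. f (prolong u x)) = (\<lambda>x. total_deriv m f (prolong u x))"
      by (intro ext DERIV_imp_deriv prolong_DERIV Suc.prems assms)
    moreover have "(\<lambda>x. f (prolong u x)) differentiable_on UNIV"
      using prolong_DERIV[OF Suc.prems assms(2)]
      by (auto simp: differentiable_on_def real_differentiable_def)
    ultimately show ?case using Suc.IH[OF density_le_total_deriv[OF Suc.prems]] by simp
  qed simp
  moreover have "prolong u (x + 1) = jet_shift None 1 (prolong u x)" for x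
    using smooth_loops_funpow_xderiv[OF fields_smooth[OF assms(2)]]
    by (simp add: prolong_def smooth_loops_def)
  ultimately show ?thesis
    unfolding sloop_def loop.smooth_def using assms(1) density_le_periodic[OF assms(1)] by metis
qed

lemma funpow_deriv_prolong:
  assumes "density_le m f" "u \<in> fields U"
  shows "(deriv ^^ k) (\<lambda>x. f (prolong u x)) = (\<lambda>x. total_deriv_iter m k f (prolong u x))"
proof (induction k)
  case (Suc k)
  then show ?case
    using prolong_DERIV[OF density_le_total_deriv_iter[OF assms(1)] assms(2)]
    by (auto intro!: ext DERIV_imp_deriv)
qed simp

lemma sloop_linearization:
  assumes "density_le m f" "u \<in> fields U" "v \<in> smooth_loops"
  shows "sloop (linearization m f u v)"
  unfolding linearization_def[abs_def]
  by (intro sloop_intros sloop_prolong[OF density_le_jet_pd[OF assms(1)] assms(2)] sloop_loop_coord assms)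


subsection \<open>Variations\<close>

text \<open>
  The image of a period is a compact subset of the open set \<open>U\<close>.
\<close>

lemma variation_in_fields:
  assumes u: "u \<in> fields U" and v: "v \<in> smooth_loops"
  obtains e where "e > 0" "\<And>t. \<bar>t\<bar> < e \<Longrightarrow> (\<lambda>x. u x + t *\<^sub>R v x) \<in> fields U"
proof -
  have per: "w x = w (frac x)" if "w \<in> smooth_loops" for w :: "real \<Rightarrow> real^'n" and x
  proof -
    have w: "w (y + 1) = w y" for y using that by (simp add: smooth_loops_def)
    have "w (y + real n) = w y" for y n
    proof (induction n)
      case (Suc n)
      show ?case using w[of "y + real n"] Suc by (simp add: add_ac)
    qed simp
    from this[of "frac x" "nat \<lfloor>x\<rfloor>"] this[of x "nat (- \<lfloor>x\<rfloor>)"] show ?thesis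
      by (cases "\<lfloor>x\<rfloor> \<ge> 0") (auto simp: frac_def)
  qed
  have frac: "frac x \<in> {0..1}" for x :: real by (simp add: less_imp_le[OF frac_lt_1])
  have "compact (u ` {0..1})"
    by (intro compact_continuous_image smooth_loops_continuous_on fields_smooth[OF u] compact_Icc)
  moreover have "u ` {0..1} \<subseteq> U" using fields_in[OF u] by auto
  ultimately obtain \<delta> where \<delta>: "\<delta> > 0" "(\<Union>y\<in>u ` {0..1}. ball y \<delta>) \<subseteq> U"
    using compact_subset_open_imp_ball_epsilon_subset[OF _ open_U] by metis
  have "compact (v ` {0..1})"
    by (intro compact_continuous_image smooth_loops_continuous_on v compact_Icc)
  then obtain B where B: "B > 0" "\<And>x. x \<in> {0..1} \<Longrightarrow> norm (v x) \<le> B"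
    using compact_imp_bounded[of "v ` {0..1}"] by (auto simp: bounded_pos)
  show thesis
  proof (rule that[of "\<delta> / B"])
    show "\<delta> / B > 0" using \<delta> B by simp
    fix t :: real assume t: "\<bar>t\<bar> < \<delta> / B"
    have "u x + t *\<^sub>R v x \<in> U" for x
    proof -
      have "norm (t *\<^sub>R v (frac x)) \<le> \<bar>t\<bar> * B"
        using B(2)[OF frac[of x]] by (simp add: mult_left_mono)
      also have "\<dots> < \<delta>" using t B by (simp add: pos_less_divide_eq)
      finally have "u (frac x) + t *\<^sub>R v (frac x) \<in> ball (u (frac x)) \<delta>" by (simp add: dist_norm)
      moreover have "u (frac x) \<in> u ` {0..1}" using frac by blast
      ultimately have "u (frac x) + t *\<^sub>R v (frac x) \<in> U" using \<delta>(2) by blast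
      then show ?thesis by (simp flip: per[OF v] per[OF fields_smooth[OF u]])
    qed
    then show "(\<lambda>x. u x + t *\<^sub>R v x) \<in> fields U"
      using smooth_loops_combine(1)[OF fields_smooth[OF u] v] by (auto simp: fields_def)
  qed
qed

lemma linearization_DERIV:
  assumes "density_le m f" and u: "u \<in> smooth_loops" and v: "v \<in> smooth_loops"
    and "(\<lambda>x. u x + t *\<^sub>R v x) \<in> fields U"
  shows "((\<lambda>t. f (prolong (\<lambda>x. u x + t *\<^sub>R v x) x)) has_real_derivative
    linearization m f (\<lambda>x. u x + t *\<^sub>R v x) v x) (at t)"
  unfolding linearization_def
proof (rule jet_chain_rule)
  show "((\<lambda>t. jet_coord c (prolong (\<lambda>x. u x + t *\<^sub>R v x) x))
      has_real_derivative loop_coord c v x) (at t)" for c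
    unfolding jet_coord_prolong_variation[OF u v] by (auto intro!: derivative_eq_intros)
qed (use assms in \<open>auto simp: density_le_def intro: prolong_jets\<close>)

lemma continuous_on_variation:
  assumes f: "density_le m f" and u: "u \<in> smooth_loops" and v: "v \<in> smooth_loops"
    and A: "\<And>t x. (t, x) \<in> A \<Longrightarrow> (\<lambda>x. u x + t *\<^sub>R v x) \<in> fields U"
  shows "continuous_on A (\<lambda>z. f (prolong (\<lambda>x. u x + fst z *\<^sub>R v x) (snd z)))"
proof (rule continuous_on_compose2[where f="\<lambda>z. prolong (\<lambda>x. u x + fst z *\<^sub>R v x) (snd z)"])
  show "continuous_on (jets U) f"
    using f jet_fun.smooth_reg by (auto simp: density_le_def jet_reg_def)
  have "continuous_on A (\<lambda>z. jet_coord c (prolong u (snd z)) + fst z * loop_coord c v (snd z))" for c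
    by (intro continuous_intros
      continuous_on_compose2[OF continuous_on_jet_coord_prolong[OF u, of UNIV] continuous_on_snd[OF
          continuous_on_id]]
      continuous_on_compose2[OF sloop_continuous_on[OF sloop_loop_coord[OF v], of UNIV]
          continuous_on_snd[OF continuous_on_id]])
      auto
  then show "continuous_on A (\<lambda>z. prolong (\<lambda>x. u x + fst z *\<^sub>R v x) (snd z))"
    by (intro continuous_on_jetI) (simp add: jet_coord_prolong_variation[OF u v])
  show "(\<lambda>z. prolong (\<lambda>x. u x + fst z *\<^sub>R v x) (snd z)) ` A \<subseteq> jets U"
  proof (rule image_subsetI)
    fix z assume "z \<in> A"
    then show "prolong (\<lambda>x. u x + fst z *\<^sub>R v x) (snd z) \<in> jets U"
      using prolong_jets[OF A[of "fst z" "snd z"]] by simp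
  qed
qed

lemma continuous_on_variation_linearization:
  assumes f: "density_le m f" and u: "u \<in> smooth_loops" and v: "v \<in> smooth_loops"
    and A: "\<And>t x. (t, x) \<in> A \<Longrightarrow> (\<lambda>x. u x + t *\<^sub>R v x) \<in> fields U"
  shows "continuous_on A (\<lambda>z. linearization m f (\<lambda>x. u x + fst z *\<^sub>R v x) v (snd z))"
  unfolding linearization_def
  by (intro continuous_on_sum continuous_on_mult continuous_on_variation[OF density_le_jet_pd[OF f] u v A]
    continuous_on_compose2[OF sloop_continuous_on[OF sloop_loop_coord[OF v], of UNIV]
        continuous_on_snd[OF continuous_on_id]])
    auto

lemma integral_variation_DERIV:
  assumes u: "u \<in> fields U" and v: "v \<in> smooth_loops"
    and f: "\<And>a. a \<in> A \<Longrightarrow> density_le (m a) (f a)" and y: "\<And>a. a \<in> A \<Longrightarrow> sloop (y a)"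
  shows "((\<lambda>t. integral {0..1} (\<lambda>x. \<Sum>a\<in>A. f a (prolong (\<lambda>x. u x + t *\<^sub>R v x) x) * y a x))
    has_real_derivative integral {0..1} (\<lambda>x. \<Sum>a\<in>A. linearization (m a) (f a) u v x * y a x)) (at 0)"
proof -
  obtain e where e: "e > 0" "\<And>t. \<bar>t\<bar> < e \<Longrightarrow> (\<lambda>x. u x + t *\<^sub>R v x) \<in> fields U"
    using variation_in_fields[OF u v] by metis
  note us = fields_smooth[OF u]
  have "((\<lambda>t. integral (cbox 0 1) (\<lambda>x. \<Sum>a\<in>A. f a (prolong (\<lambda>x. u x + t *\<^sub>R v x) x) * y a x))
    has_real_derivative integral (cbox 0 1) (\<lambda>x. \<Sum>a\<in>A. linearization (m a) (f a) (\<lambda>x. u x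
        + 0 *\<^sub>R v x) v x * y a x))
    (at 0 within {- e<..<e})"
  proof (rule leibniz_rule_field_derivative)
    fix t x assume "t \<in> {- e<..<e}"
    then have t: "(\<lambda>x. u x + t *\<^sub>R v x) \<in> fields U" using e(2) by auto
    show "((\<lambda>t. \<Sum>a\<in>A. f a (prolong (\<lambda>x. u x + t *\<^sub>R v x) x) * y a x) has_real_derivative
      (\<Sum>a\<in>A. linearization (m a) (f a) (\<lambda>x. u x + t *\<^sub>R v x) v x * y a x)) (at t within {- e<..<e})"
      by (rule DERIV_sum, rule DERIV_cmult_right, rule has_field_derivative_at_within,
        rule linearization_DERIV[OF f us v t])
    show "(\<lambda>x. \<Sum>a\<in>A. f a (prolong (\<lambda>x. u x + t *\<^sub>R v x) x) * y a x) integrable_on cbox 0 1"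
      unfolding box_real
      by (intro sloop_integrable sloop_sum sloop_mult sloop_prolong[OF f t] y)
  next
    have "continuous_on ({- e<..<e} \<times> cbox 0 1)
      (\<lambda>z. \<Sum>a\<in>A. linearization (m a) (f a) (\<lambda>x. u x + fst z *\<^sub>R v x) v (snd z) * y a (snd z))"
      by (intro continuous_on_sum continuous_on_mult continuous_on_variation_linearization[OF f us v]
        continuous_on_compose2[OF sloop_continuous_on[OF y, of _ UNIV] continuous_on_snd[OF
            continuous_on_id]])
        (auto simp: e(2))
    then show "continuous_on ({- e<..<e} \<times> cbox 0 1)
      (\<lambda>(t, x). \<Sum>a\<in>A. linearization (m a) (f a) (\<lambda>x. u x + t *\<^sub>R v x) v x * y a x)"
      by (simp add: case_prod_beta')
  qed (use e(1) in auto)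
  then show ?thesis
    using e(1) by (simp add: at_within_open[of 0 "{- e<..<e}"])
qed

text \<open>
  Variation of the field commutes with differentiation in \<open>x\<close>: both orders give mixed derivatives of
  \<open>f (prolong (u + s v) (x + t))\<close> in \<open>s\<close> and \<open>t\<close>.
\<close>

lemma linearization_total_deriv:
  assumes f: "density_le m f" and u: "u \<in> fields U" and v: "v \<in> smooth_loops"
  shows "deriv (linearization m f u v) x = linearization (Suc m) (total_deriv m f) u v x"
proof -
  obtain e where e: "e > 0" "\<And>t. \<bar>t\<bar> < e \<Longrightarrow> (\<lambda>x. u x + t *\<^sub>R v x) \<in> fields U"
    using variation_in_fields[OF u v] by metis
  note us = fields_smooth[OF u]
  define w where "w s = (\<lambda>x. u x + s *\<^sub>R v x)" for s
  have w: "w s \<in> fields U" if "\<bar>s\<bar> < e" for s using e(2)[OF that] by (simp add: w_def)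
  have "continuous_on (ball 0 e \<times> UNIV) (\<lambda>z. linearization (Suc m) (total_deriv m f) (w (fst z)) v (x
      + snd z))"
    unfolding w_def
    by (rule continuous_on_compose2[OF continuous_on_variation_linearization[OF
        density_le_total_deriv[OF f] us v,
          of "ball 0 e \<times> UNIV"], where f="\<lambda>z. (fst z, x + snd z)", simplified])
      (use e(2) in \<open>auto intro!: continuous_intros\<close>)
  then have C2: "isCont (\<lambda>z. linearization (Suc m) (total_deriv m f) (w (fst z)) v (x + snd z)) (0, 0)"
    using e(1) by (subst (asm) continuous_on_eq_continuous_at) (auto intro: open_Times)
  define h where "h w x = (\<Sum>c\<in>jet_coords m. total_deriv m (jet_pd c f) (prolong w x) * loop_coord c v x
    + jet_pd c f (prolong w x) * deriv (loop_coord c v) x)" for w x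
  have h: "((\<lambda>x. linearization m f w v x) has_real_derivative h w x) (at x)" if "w \<in> fields U" for w x
    unfolding linearization_def h_def
    by (rule DERIV_sum)
      (auto intro!: derivative_eq_intros prolong_DERIV[OF density_le_jet_pd[OF f] that]
        sloop_DERIV[OF sloop_loop_coord[OF v]])
  have "continuous_on (ball 0 e \<times> UNIV) (\<lambda>z. h (w (fst z)) (snd z))"
    unfolding h_def w_def
    by (intro continuous_on_sum continuous_on_mult continuous_on_add
      continuous_on_variation[OF density_le_total_deriv[OF density_le_jet_pd[OF f]] us v]
      continuous_on_variation[OF density_le_jet_pd[OF f] us v]
      continuous_on_compose2[OF sloop_continuous_on[OF sloop_loop_coord[OF v], of UNIV]
          continuous_on_snd[OF continuous_on_id]]
      continuous_on_compose2[OF sloop_continuous_on[OF sloop_deriv[OF sloop_loop_coord[OF v]], of UNIV]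
          continuous_on_snd[OF continuous_on_id]])
      (auto simp: e(2))
  moreover have "continuous_on (ball 0 e \<times> UNIV) (\<lambda>z. (fst z, x + snd z))"
    by (intro continuous_intros)
  moreover have "(\<lambda>z. (fst z, x + snd z)) ` (ball 0 e \<times> UNIV) \<subseteq> ball 0 e \<times> UNIV" by auto
  ultimately have "continuous_on (ball 0 e \<times> UNIV) (\<lambda>z. h (w (fst (fst z, x + snd z))) (snd (fst z, x
      + snd z)))"
    by (rule continuous_on_compose2)
  then have "continuous_on (ball 0 e \<times> UNIV) (\<lambda>z. h (w (fst z)) (x + snd z))" by simp
  then have C1: "isCont (\<lambda>z. h (w (fst z)) (x + snd z)) (0, 0)"
    using e(1) by (subst (asm) continuous_on_eq_continuous_at) (auto intro: open_Times)
  have sh: "((\<lambda>t. F (x + t)) has_real_derivative D) (at t)" if "(F has_real_derivative D) (at (x + t))"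
      for F D t
    using that DERIV_shift[of F D t x] by (simp add: add.commute)
  have "h (w 0) (x + 0) = linearization (Suc m) (total_deriv m f) (w 0) v (x + 0)"
  proof (rule mixed_derivatives_eq[OF e(1), where \<phi>="\<lambda>s t. f (prolong (w s) (x + t))" and
      \<phi>s="\<lambda>s t. linearization m f (w s) v (x + t)" and \<phi>t="\<lambda>s t. total_deriv m f (prolong (w s) (x + t))" and
      \<phi>st="\<lambda>s t. h (w s) (x + t)" and \<phi>ts="\<lambda>s t. linearization (Suc m) (total_deriv m f) (w s) v (x + t)"])
    fix s t :: real assume s: "\<bar>s\<bar> < e"
    show "((\<lambda>s. f (prolong (w s) (x + t))) has_real_derivative linearization m f (w s) v (x + t)) (at s)"
      unfolding w_def by (rule linearization_DERIV[OF f us v e(2)[OF s]])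
    show "((\<lambda>s. total_deriv m f (prolong (w s) (x + t))) has_real_derivative
        linearization (Suc m) (total_deriv m f) (w s) v (x + t)) (at s)"
      unfolding w_def by (rule linearization_DERIV[OF density_le_total_deriv[OF f] us v e(2)[OF s]])
    show "((\<lambda>t. f (prolong (w s) (x + t))) has_real_derivative total_deriv m f (prolong (w s) (x
        + t))) (at t)"
      by (rule sh, rule prolong_DERIV[OF f w[OF s]])
    show "((\<lambda>t. linearization m f (w s) v (x + t)) has_real_derivative h (w s) (x + t)) (at t)"
      by (rule sh, rule h[OF w[OF s]])
  qed (rule C1 C2)+
  moreover have "deriv (linearization m f u v) x = h u x"
    using h[OF u] by (auto intro: DERIV_imp_deriv)
  ultimately show ?thesis by (simp add: w_def)
qed


subsection \<open>The Euler operator\<close>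

lemma integral_linearization_euler:
  assumes f: "density_le m f" and u: "u \<in> fields U" and v: "v \<in> smooth_loops"
  shows "integral {0..1} (linearization m f u v) = integral {0..1} (\<lambda>x. \<Sum>i\<in>UNIV. euler_op m f i (prolong
      u x) * v x $ i)"
proof -
  let ?p = "\<lambda>k i x. jet_pd (Some (k, i)) f (prolong u x)"
  have p: "sloop (?p k i)" for k i by (rule sloop_prolong[OF density_le_jet_pd[OF f] u])
  have vi: "sloop (\<lambda>x. v x $ i)" for i by (rule sloop_nth[OF v])
  have "integral {0..1} (linearization m f u v)
      = integral {0..1} (\<lambda>x. \<Sum>k\<le>m. \<Sum>i\<in>UNIV. ?p k i x * (deriv ^^ k) (\<lambda>x. v x $ i) x)"
    by (simp add: linearization_def[abs_def] sum_jet_coords funpow_xderiv_nth[OF v])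
  also have "\<dots> = (\<Sum>k\<le>m. \<Sum>i\<in>UNIV. integral {0..1} (\<lambda>x. ?p k i x * (deriv ^^ k) (\<lambda>x. v x $ i) x))"
    by (subst integral_sum; simp add: integral_sum sloop_integrable sloop_intros p vi)
  also have "\<dots> = (\<Sum>k\<le>m. \<Sum>i\<in>UNIV. integral {0..1} (\<lambda>x. (-1) ^ k * (deriv ^^ k) (?p k i) x * v x $ i))"
    by (simp only: sloop_by_parts_funpow[OF p vi])
  also have "\<dots> = integral {0..1} (\<lambda>x. \<Sum>k\<le>m. \<Sum>i\<in>UNIV. (-1) ^ k * (deriv ^^ k) (?p k i) x * v x $ i)"
    by (subst integral_sum; simp add: integral_sum sloop_integrable sloop_intros p vi)
  also have "\<dots> = integral {0..1} (\<lambda>x. \<Sum>i\<in>UNIV. euler_op m f i (prolong u x) * v x $ i)"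
    by (subst sum.swap) (simp add: euler_op_def sum_distrib_right funpow_deriv_prolong[OF
        density_le_jet_pd[OF f] u])
  finally show ?thesis .
qed

lemma euler_op_variational_derivative:
  assumes f: "density_le m f" and F: "\<And>u. u \<in> fields U \<Longrightarrow> F u = integral {0..1} (\<lambda>x. f (prolong u x))"
    and u: "u \<in> fields U"
  shows "has_variational_derivative F u (\<lambda>x. \<chi> i. euler_op m f i (prolong u x))"
  unfolding has_variational_derivative_def
proof (intro conjI ballI)
  show "(\<lambda>x. \<chi> i. euler_op m f i (prolong u x)) \<in> smooth_loops"
    by (auto simp: smooth_loops_iff intro!: sloop_prolong[OF density_le_euler_op[OF f] u])
  fix v :: "real \<Rightarrow> real^'n" assume v: "v \<in> smooth_loops"
  obtain e where e: "e > 0" "\<And>t. \<bar>t\<bar> < e \<Longrightarrow> (\<lambda>x. u x + t *\<^sub>R v x) \<in> fields U"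
    using variation_in_fields[OF u v] by metis
  \<comment> \<open>A sum with a single term and the constant loop 1 as weight.\<close>
  have D: "((\<lambda>t. integral {0..1} (\<lambda>x. f (prolong (\<lambda>x. u x + t *\<^sub>R v x) x)))
      has_real_derivative integral {0..1} (linearization m f u v)) (at 0)"
    using integral_variation_DERIV[OF u v, of "{()}" "\<lambda>_. m" "\<lambda>_. f" "\<lambda>_ _. 1"] f
    by (simp add: sloop_const)
  have "((\<lambda>t. F (\<lambda>x. u x + t *\<^sub>R v x)) has_real_derivative integral {0..1} (linearization m f u v)) (at 0)"
    by (rule has_field_derivative_transform_within[OF D e(1)]) (use F e(2) in \<open>auto simp: dist_real_def\<close>)
  then show "((\<lambda>t. F (\<lambda>x. u x + t *\<^sub>R v x)) has_real_derivative
      integral {0..1} (\<lambda>x. \<Sum>i\<in>UNIV. (\<chi> i. euler_op m f i (prolong u x)) $ i * v x $ i)) (at 0)"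
    by (simp add: integral_linearization_euler[OF f u v])
qed

text \<open>
  Moving the Euler operator back onto the test loop expresses the second variation by the second partial
  derivatives of the density, and these commute.
\<close>

lemma hessian_symmetric:
  assumes f: "density_le m f" and u: "u \<in> fields U" and v: "v \<in> smooth_loops" and q: "q \<in> smooth_loops"
  shows "integral {0..1} (\<lambda>x. \<Sum>i\<in>UNIV. linearization (2 * m) (euler_op m f i) u v x * q x $ i)
       = integral {0..1} (\<lambda>x. \<Sum>i\<in>UNIV. linearization (2 * m) (euler_op m f i) u q x * v x $ i)"
proof -
  have second: "integral {0..1} (\<lambda>x. \<Sum>i\<in>UNIV. linearization (2 * m) (euler_op m f i) u v x * q x $ i)
      = integral {0..1} (\<lambda>x. \<Sum>c\<in>jet_coords m. linearization m (jet_pd c f) u v x * loop_coord c q x)"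
    if v: "v \<in> smooth_loops" and q: "q \<in> smooth_loops" for v q
  proof -
    obtain e where e: "e > 0" "\<And>t. \<bar>t\<bar> < e \<Longrightarrow> (\<lambda>x. u x + t *\<^sub>R v x) \<in> fields U"
      using variation_in_fields[OF u v] by metis
    have D: "((\<lambda>t. integral {0..1} (\<lambda>x. \<Sum>c\<in>jet_coords m. jet_pd c f (prolong (\<lambda>x. u x
        + t *\<^sub>R v x) x) * loop_coord c q x))
      has_real_derivative integral {0..1} (\<lambda>x. \<Sum>c\<in>jet_coords m. linearization m (jet_pd c f) u v x *
          loop_coord c q x)) (at 0)"
      by (rule integral_variation_DERIV[OF u v density_le_jet_pd[OF f] sloop_loop_coord[OF q]])
    have "((\<lambda>t. integral {0..1} (\<lambda>x. \<Sum>i\<in>UNIV. euler_op m f i (prolong (\<lambda>x. u x + t *\<^sub>R v x) x) * q x $ i))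
      has_real_derivative integral {0..1} (\<lambda>x. \<Sum>c\<in>jet_coords m. linearization m (jet_pd c f) u v x *
          loop_coord c q x)) (at 0)"
    proof (rule has_field_derivative_transform_within[OF D e(1)])
      fix t :: real assume "dist t 0 < e"
      then have t: "(\<lambda>x. u x + t *\<^sub>R v x) \<in> fields U" using e(2) by (simp add: dist_real_def)
      show "integral {0..1} (\<lambda>x. \<Sum>c\<in>jet_coords m. jet_pd c f (prolong (\<lambda>x. u x
          + t *\<^sub>R v x) x) * loop_coord c q x)
        = integral {0..1} (\<lambda>x. \<Sum>i\<in>UNIV. euler_op m f i (prolong (\<lambda>x. u x + t *\<^sub>R v x) x) * q x $ i)"
        using integral_linearization_euler[OF f t q] by (simp add: linearization_def[abs_def])
    qed simp
    moreover have "((\<lambda>t. integral {0..1} (\<lambda>x. \<Sum>i\<in>UNIV. euler_op m f i (prolong (\<lambda>x. u x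
        + t *\<^sub>R v x) x) * q x $ i))
      has_real_derivative integral {0..1} (\<lambda>x. \<Sum>i\<in>UNIV. linearization (2 * m) (euler_op m f i) u v x * q
          x $ i)) (at 0)"
      by (rule integral_variation_DERIV[OF u v density_le_euler_op[OF f] sloop_nth[OF q]])
    ultimately show ?thesis by (rule DERIV_unique[rotated])
  qed
  have "(\<Sum>c\<in>jet_coords m. linearization m (jet_pd c f) u v x * loop_coord c q x)
      = (\<Sum>c\<in>jet_coords m. linearization m (jet_pd c f) u q x * loop_coord c v x)" for x
  proof -
    have "(\<Sum>c\<in>jet_coords m. linearization m (jet_pd c f) u v x * loop_coord c q x)
      = (\<Sum>c\<in>jet_coords m. \<Sum>c'\<in>jet_coords m. jet_pd c (jet_pd c' f) (prolong u x) * loop_coord c' v x *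
          loop_coord c q x)"
      using f prolong_jets[OF u] by (simp add: linearization_def sum_distrib_right density_le_def
          jet_pd_commute)
    also have "\<dots> = (\<Sum>c'\<in>jet_coords m. \<Sum>c\<in>jet_coords m. jet_pd c (jet_pd c' f) (prolong u x) * loop_coord
        c' v x * loop_coord c q x)"
      by (rule sum.swap)
    finally show ?thesis by (simp add: linearization_def sum_distrib_left sum_distrib_right mult_ac)
  qed
  then show ?thesis by (simp add: second[OF v q] second[OF q v])
qed

end

lemma has_variational_derivative_unique:
  assumes "has_variational_derivative F u w" "has_variational_derivative F u w'"
  shows "w = w'"
proof
  fix x
  have w: "w \<in> smooth_loops" "w' \<in> smooth_loops"
    using assms by (auto simp: has_variational_derivative_def)
  have d: "(\<lambda>x. w x - w' x) \<in> smooth_loops"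
    using smooth_loops_combine(1)[OF w, of "-1"] by simp
  have "integral {0..1} (\<lambda>x. \<Sum>i\<in>UNIV. (w x - w' x) $ i * v x $ i) = 0" if v: "v \<in> smooth_loops" for v
  proof -
    have "integral {0..1} (\<lambda>x. \<Sum>i\<in>UNIV. w x $ i * v x $ i)
        = integral {0..1} (\<lambda>x. \<Sum>i\<in>UNIV. w' x $ i * v x $ i)"
      using assms v unfolding has_variational_derivative_def by (blast intro: DERIV_unique)
    moreover have "integral {0..1} (\<lambda>x. \<Sum>i\<in>UNIV. (w x - w' x) $ i * v x $ i)
        = integral {0..1} (\<lambda>x. \<Sum>i\<in>UNIV. w x $ i * v x $ i)
            - integral {0..1} (\<lambda>x. \<Sum>i\<in>UNIV. w' x $ i * v x $ i)"
      by (subst integral_diff[symmetric])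
        (auto simp: algebra_simps sum_subtractf intro!: sloop_integrable sloop_intros sloop_nth w v)
    ultimately show ?thesis by simp
  qed
  from loop_integral_inner_eq_0[OF d this, of x] show "w x = w' x" by simp
qed

lemma variational_derivative_eqI:
  "has_variational_derivative F u w \<Longrightarrow> variational_derivative F u = w"
  unfolding variational_derivative_def using has_variational_derivative_unique by blast


section \<open>The Jacobi identity for operators of hydrodynamic type\<close>

definition loop_inner :: "(real \<Rightarrow> real^'n) \<Rightarrow> (real \<Rightarrow> real^'n) \<Rightarrow> real" where
  "loop_inner p q = integral {0..1} (\<lambda>x. \<Sum>i\<in>UNIV. p x $ i * q x $ i)"

lemma hydro_bracket_eq:
  "hydro_bracket g b F G u =
    loop_inner (variational_derivative F u) (hydro_op g b u (variational_derivative G u))"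
  by (simp add: hydro_bracket_def loop_inner_def)

lemma loop_inner_commute: "loop_inner p q = loop_inner q p"
  by (simp add: loop_inner_def mult.commute)

lemma loop_inner_diff_right:
  assumes "p \<in> smooth_loops" "q \<in> smooth_loops" "q' \<in> smooth_loops"
  shows "loop_inner p (\<lambda>x. q x - q' x) = loop_inner p q - loop_inner p q'"
  unfolding loop_inner_def
  by (subst integral_diff[symmetric])
    (auto simp: algebra_simps sum_subtractf intro!: sloop_integrable sloop_intros sloop_nth assms)

lemma loop_inner_add_right:
  assumes "p \<in> smooth_loops" "q \<in> smooth_loops" "q' \<in> smooth_loops"
  shows "loop_inner p (\<lambda>x. q x + q' x) = loop_inner p q + loop_inner p q'"
  unfolding loop_inner_def
  by (subst integral_add[symmetric])
    (auto simp: algebra_simps sum.distrib intro!: sloop_integrable sloop_intros sloop_nth assms)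

lemma smooth_loops_diff: "p \<in> smooth_loops \<Longrightarrow> q \<in> smooth_loops \<Longrightarrow> (\<lambda>x. p x - q x) \<in> smooth_loops"
  using smooth_loops_combine(1)[of p q "-1"] by simp

lemma loop_inner_uminus_right: "loop_inner p (\<lambda>x. - q x) = - loop_inner p q"
  by (simp add: loop_inner_def sum_negf)

lemma has_variational_derivativeD:
  assumes "has_variational_derivative F u w" "v \<in> smooth_loops"
  shows "((\<lambda>t. F (\<lambda>x. u x + t *\<^sub>R v x)) has_real_derivative loop_inner w v) (at 0)"
  using assms by (simp add: has_variational_derivative_def loop_inner_def)

text \<open>
  The derivative of \<open>hydro_op g b u \<psi>\<close> in the field \<open>u\<close>, in the direction \<open>v\<close>, for fixed \<open>\<psi>\<close>.
\<close>

definition hydro_op_var ::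
    "(real^'n \<Rightarrow> real^'n^'n) \<Rightarrow> ('n \<Rightarrow> 'n \<Rightarrow> 'n \<Rightarrow> real^'n \<Rightarrow> real) \<Rightarrow>
     (real \<Rightarrow> real^'n) \<Rightarrow> (real \<Rightarrow> real^'n) \<Rightarrow> (real \<Rightarrow> real^'n) \<Rightarrow> real \<Rightarrow> real^'n" where
  "hydro_op_var g b u v \<psi> x = (\<chi> i. \<Sum>j\<in>UNIV.
      (\<Sum>k\<in>UNIV. pd k (\<lambda>u. g u $ i $ j) (u x) * v x $ k) * xderiv \<psi> x $ j
      + (\<Sum>k\<in>UNIV. (\<Sum>m\<in>UNIV. pd m (b i j k) (u x) * v x $ m) * xderiv u x $ k
                   + b i j k (u x) * xderiv v x $ k) * \<psi> x $ j)"

definition curl :: "('n \<Rightarrow> 'n \<Rightarrow> 'n \<Rightarrow> real^'n \<Rightarrow> real) \<Rightarrow> 'n \<Rightarrow> 'n \<Rightarrow> 'n \<Rightarrow> 'n \<Rightarrow> real^'n \<Rightarrow> real" where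
  "curl b i j k s u = pd k (b i j s) u - pd s (b i j k) u"

text \<open>
  The covector field that represents the linear functional \<open>v \<mapsto> \<integral> \<phi> \<sqdot> hydro_op_var g b u v \<psi>\<close>.
\<close>

definition hydro_covector ::
    "('n \<Rightarrow> 'n \<Rightarrow> 'n \<Rightarrow> real^'n \<Rightarrow> real) \<Rightarrow> (real \<Rightarrow> real^'n) \<Rightarrow>
     (real \<Rightarrow> real^'n) \<Rightarrow> (real \<Rightarrow> real^'n) \<Rightarrow> real \<Rightarrow> real^'n" where
  "hydro_covector b u \<phi> \<psi> x = (\<chi> k. \<Sum>i\<in>UNIV. \<Sum>j\<in>UNIV.
      b j i k (u x) * \<phi> x $ i * xderiv \<psi> x $ j - b i j k (u x) * xderiv \<phi> x $ i * \<psi> x $ j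
      + (\<Sum>s\<in>UNIV. curl b i j k s (u x) * xderiv u x $ s) * \<phi> x $ i * \<psi> x $ j)"

text \<open>
  The Jacobi identity for three functionals with gradients \<open>\<phi>\<close>, \<open>\<psi>\<close>, \<open>\<theta>\<close> is the vanishing of the integral of
  \<open>\<theta>\<close> against this expression.
\<close>

definition jacobiator ::
    "(real^'n \<Rightarrow> real^'n^'n) \<Rightarrow> ('n \<Rightarrow> 'n \<Rightarrow> 'n \<Rightarrow> real^'n \<Rightarrow> real) \<Rightarrow>
     (real \<Rightarrow> real^'n) \<Rightarrow> (real \<Rightarrow> real^'n) \<Rightarrow> (real \<Rightarrow> real^'n) \<Rightarrow> real \<Rightarrow> real^'n" where
  "jacobiator g b u \<phi> \<psi> x =
     hydro_op_var g b u (hydro_op g b u \<psi>) \<phi> x - hydro_op_var g b u (hydro_op g b u \<phi>) \<psi> x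
     - hydro_op g b u (hydro_covector b u \<phi> \<psi>) x"

context phase_space
begin

lemma sloop_phase_fun: "smooth_fun U h \<Longrightarrow> u \<in> fields U \<Longrightarrow> sloop (\<lambda>x. h (u x))"
  using sloop_prolong[OF density_le_phase_fun, of h u] by (simp add: prolong_def)

lemma phase_fun_DERIV:
  assumes "smooth_fun U h" "u \<in> fields U"
  shows "((\<lambda>x. h (u x)) has_real_derivative (\<Sum>k\<in>UNIV. pd k h (u x) * xderiv u x $ k)) (at x)"
  by (rule chain_rule_pd)
    (use assms in \<open>auto intro: smooth_differentiable fields_in smooth_loops_has_vector_derivative
        fields_smooth\<close>)

text \<open>
  The last conjunct is the symmetry of the Hessian, whose action on \<open>v\<close> is the linearization of the
  gradient.
\<close>

definition gradient :: "((real \<Rightarrow> real^'n) \<Rightarrow> real) \<Rightarrow> nat \<Rightarrow> ('n \<Rightarrow> 'n jet \<Rightarrow> real) \<Rightarrow> bool" where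
  "gradient F m e \<longleftrightarrow> (\<forall>i. density_le m (e i)) \<and>
    (\<forall>u\<in>fields U. has_variational_derivative F u (\<lambda>x. \<chi> i. e i (prolong u x)) \<and>
      (\<forall>v\<in>smooth_loops. \<forall>q\<in>smooth_loops.
         loop_inner (\<lambda>x. \<chi> i. linearization m (e i) u v x) q
             = loop_inner (\<lambda>x. \<chi> i. linearization m (e i) u q x) v))"

lemma local_functional_gradient:
  assumes "local_functional U F"
  obtains m e where "gradient F m e"
proof -
  obtain f m where f: "density_le m f" "\<And>u. u \<in> fields U \<Longrightarrow> F u = integral {0..1} (\<lambda>x. f (prolong u x))"
    using assms by (auto simp: local_functional_def density_iff_density_le)
  have "gradient F (2 * m) (euler_op m f)"
    unfolding gradient_def loop_inner_def
  proof (intro conjI allI ballI)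
    show "density_le (2 * m) (euler_op m f i)" for i by (rule density_le_euler_op[OF f(1)])
    fix u assume u: "u \<in> fields U"
    show "has_variational_derivative F u (\<lambda>x. \<chi> i. euler_op m f i (prolong u x))"
      by (rule euler_op_variational_derivative[OF f u])
    show "integral {0..1} (\<lambda>x. \<Sum>i\<in>UNIV. (\<chi> i. linearization (2 * m) (euler_op m f i) u v x) $ i * q x $ i)
        = integral {0..1} (\<lambda>x. \<Sum>i\<in>UNIV. (\<chi> i. linearization (2 * m) (euler_op m f i) u q x) $ i * v x $ i)"
      if "v \<in> smooth_loops" "q \<in> smooth_loops" for v q
      using hessian_symmetric[OF f(1) u that] by simp
  qed
  with that show thesis .
qed

lemma gradient_variational_derivative:
  "gradient F m e \<Longrightarrow> u \<in> fields U \<Longrightarrow> variational_derivative F u = (\<lambda>x. \<chi> i. e i (prolong u x))"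
  by (auto simp: gradient_def intro: variational_derivative_eqI)

lemma has_variational_derivative_local:
  assumes "local_functional U F" "u \<in> fields U"
  shows "has_variational_derivative F u (variational_derivative F u)"
proof -
  obtain m e where e: "gradient F m e" by (rule local_functional_gradient[OF assms(1)])
  then have "has_variational_derivative F u (\<lambda>x. \<chi> i. e i (prolong u x))"
    using assms(2) by (simp add: gradient_def)
  then show ?thesis by (simp add: gradient_variational_derivative[OF e assms(2)])
qed

lemma variational_derivative_smooth:
  "local_functional U F \<Longrightarrow> u \<in> fields U \<Longrightarrow> variational_derivative F u \<in> smooth_loops"
  using has_variational_derivative_local by (auto simp: has_variational_derivative_def)

text \<open>
  Through these functionals every smooth loop occurs as a gradient.
\<close>

lemma linear_functional:
  assumes \<phi>: "\<phi> \<in> smooth_loops"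
  shows "local_functional U (loop_inner \<phi>)"
    and "u \<in> fields U \<Longrightarrow> variational_derivative (loop_inner \<phi>) u = \<phi>"
proof -
  have "density_le 0 (\<lambda>p. \<Sum>i\<in>UNIV. \<phi> (fst p) $ i * snd p 0 $ i)"
    by (intro density_le_sum density_le_mult density_le_coord density_le_sloop sloop_nth \<phi>) simp
  then show "local_functional U (loop_inner \<phi>)"
    unfolding local_functional_def density_iff_density_le
    by (intro exI[of _ "\<lambda>p. \<Sum>i\<in>UNIV. \<phi> (fst p) $ i * snd p 0 $ i"])
      (auto simp: loop_inner_def prolong_def)
  assume u: "u \<in> fields U"
  show "variational_derivative (loop_inner \<phi>) u = \<phi>"
  proof (rule variational_derivative_eqI, unfold has_variational_derivative_def, intro conjI ballI \<phi>)
    fix v :: "real \<Rightarrow> real^'n" assume v: "v \<in> smooth_loops"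
    have "loop_inner \<phi> (\<lambda>x. u x + t *\<^sub>R v x) = loop_inner \<phi> u + t * loop_inner \<phi> v" for t
    proof -
      have "(\<lambda>x. t *\<^sub>R v x) \<in> smooth_loops"
        using v by (auto simp: smooth_loops_iff intro!: sloop_intros)
      moreover have "loop_inner \<phi> (\<lambda>x. t *\<^sub>R v x) = t * loop_inner \<phi> v"
        unfolding loop_inner_def by (simp add: mult.left_commute[of _ t] flip: sum_distrib_left)
      ultimately show ?thesis using loop_inner_add_right[OF \<phi> fields_smooth[OF u]] by simp
    qed
    then show "((\<lambda>t. loop_inner \<phi> (\<lambda>x. u x + t *\<^sub>R v x)) has_real_derivative
        integral {0..1} (\<lambda>x. \<Sum>i\<in>UNIV. \<phi> x $ i * v x $ i)) (at 0)"
      by (auto intro!: derivative_eq_intros simp: loop_inner_def)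
  qed
qed

end

text \<open>
  The last two assumptions make the operator skew-adjoint. The coefficients are not tied to Christoffel
  symbols, because the members of a pencil of metrics can degenerate.
\<close>

locale hydro_operator = phase_space U for U :: "(real^'n) set" +
  fixes g :: "real^'n \<Rightarrow> real^'n^'n" and b :: "'n \<Rightarrow> 'n \<Rightarrow> 'n \<Rightarrow> real^'n \<Rightarrow> real"
  assumes smooth_g: "smooth_fun U (\<lambda>u. g u $ i $ j)"
    and smooth_b: "smooth_fun U (b i j k)"
    and sym_g: "u \<in> U \<Longrightarrow> g u $ i $ j = g u $ j $ i"
    and pd_g: "u \<in> U \<Longrightarrow> pd k (\<lambda>u. g u $ i $ j) u = b i j k u + b j i k u"
begin

lemma sloop_g: "u \<in> fields U \<Longrightarrow> sloop (\<lambda>x. g (u x) $ i $ j)"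
  by (rule sloop_phase_fun[OF smooth_g])

lemma sloop_b: "u \<in> fields U \<Longrightarrow> sloop (\<lambda>x. b i j k (u x))"
  by (rule sloop_phase_fun[OF smooth_b])

lemma sloop_pd_g: "u \<in> fields U \<Longrightarrow> sloop (\<lambda>x. pd k (\<lambda>u. g u $ i $ j) (u x))"
  by (rule sloop_phase_fun[OF phase_fun.smooth_d[OF smooth_g]])

lemma sloop_pd_b: "u \<in> fields U \<Longrightarrow> sloop (\<lambda>x. pd m (b i j k) (u x))"
  by (rule sloop_phase_fun[OF phase_fun.smooth_d[OF smooth_b]])

lemma g_DERIV:
  assumes "u \<in> fields U"
  shows "((\<lambda>x. g (u x) $ i $ j) has_real_derivative
    (\<Sum>k\<in>UNIV. b i j k (u x) * xderiv u x $ k) + (\<Sum>k\<in>UNIV. b j i k (u x) * xderiv u x $ k)) (at x)"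
  using phase_fun_DERIV[OF smooth_g assms, of i j x] assms
  by (simp add: pd_g fields_in distrib_right sum.distrib)

lemma smooth_hydro_op:
  "u \<in> fields U \<Longrightarrow> \<psi> \<in> smooth_loops \<Longrightarrow> hydro_op g b u \<psi> \<in> smooth_loops"
  by (auto simp: smooth_loops_iff[of "hydro_op g b u \<psi>"] hydro_op_def
    intro!: sloop_add sloop_mult sloop_sum sloop_g sloop_b sloop_nth[of \<psi>] sloop_nth[of "xderiv \<psi>"]
      sloop_nth[of "xderiv u"] smooth_loops_xderiv fields_smooth[of u])

lemma smooth_hydro_op_var:
  "u \<in> fields U \<Longrightarrow> v \<in> smooth_loops \<Longrightarrow> \<psi> \<in> smooth_loops \<Longrightarrow> hydro_op_var g b u v \<psi> \<in> smooth_loops"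
  by (auto simp: smooth_loops_iff[of "hydro_op_var g b u v \<psi>"] hydro_op_var_def
    intro!: sloop_add sloop_mult sloop_sum sloop_pd_g sloop_pd_b sloop_b sloop_nth[of \<psi>]
      sloop_nth[of "xderiv \<psi>"] sloop_nth[of v] sloop_nth[of "xderiv v"] sloop_nth[of "xderiv u"]
      smooth_loops_xderiv fields_smooth[of u])

lemma smooth_hydro_covector:
  "u \<in> fields U \<Longrightarrow> \<phi> \<in> smooth_loops \<Longrightarrow> \<psi> \<in> smooth_loops \<Longrightarrow> hydro_covector b u \<phi> \<psi> \<in> smooth_loops"
  by (auto simp: smooth_loops_iff[of "hydro_covector b u \<phi> \<psi>"] hydro_covector_def curl_def
    intro!: sloop_add sloop_diff sloop_mult sloop_sum sloop_pd_b sloop_b sloop_nth[of \<phi>]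
      sloop_nth[of "xderiv \<phi>"] sloop_nth[of \<psi>] sloop_nth[of "xderiv \<psi>"] sloop_nth[of "xderiv u"]
      smooth_loops_xderiv fields_smooth[of u])

lemma smooth_jacobiator:
  "u \<in> fields U \<Longrightarrow> \<phi> \<in> smooth_loops \<Longrightarrow> \<psi> \<in> smooth_loops \<Longrightarrow> jacobiator g b u \<phi> \<psi> \<in> smooth_loops"
  unfolding jacobiator_def[abs_def]
  by (intro smooth_loops_diff smooth_hydro_op_var smooth_hydro_op smooth_hydro_covector)

text \<open>
  The sum of the two integrands is the \<open>x\<close>-derivative of \<open>\<phi> \<sqdot> g \<psi>\<close>.
\<close>

lemma hydro_op_skew:
  assumes u: "u \<in> fields U" and \<phi>: "\<phi> \<in> smooth_loops" and \<psi>: "\<psi> \<in> smooth_loops"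
  shows "loop_inner \<phi> (hydro_op g b u \<psi>) = - loop_inner \<psi> (hydro_op g b u \<phi>)"
proof -
  define \<beta> where "\<beta> i j x = (\<Sum>k\<in>UNIV. b i j k (u x) * xderiv u x $ k)" for i j x
  let ?h = "\<lambda>x. (\<Sum>i\<in>UNIV. \<phi> x $ i * hydro_op g b u \<psi> x $ i) + (\<Sum>i\<in>UNIV. \<psi> x $ i * hydro_op g b u \<phi> x $ i)"
  have "integral {0..1} ?h = 0"
  proof (rule sloop_integral_0)
    show "sloop (\<lambda>x. \<Sum>i\<in>UNIV. \<Sum>j\<in>UNIV. \<phi> x $ i * g (u x) $ i $ j * \<psi> x $ j)"
      by (intro sloop_intros sloop_g u sloop_nth \<phi> \<psi>)
    fix x
    have D: "((\<lambda>x. \<Sum>i\<in>UNIV. \<Sum>j\<in>UNIV. \<phi> x $ i * g (u x) $ i $ j * \<psi> x $ j) has_real_derivative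
       (\<Sum>i\<in>UNIV. \<Sum>j\<in>UNIV. (xderiv \<phi> x $ i * g (u x) $ i $ j + (\<beta> i j x + \<beta> j i x) * \<phi> x $ i) * \<psi> x $ j
          + xderiv \<psi> x $ j * (\<phi> x $ i * g (u x) $ i $ j))) (at x)"
      unfolding \<beta>_def by (intro DERIV_sum DERIV_mult g_DERIV u smooth_loops_DERIV \<phi> \<psi>)
    have 2: "(\<Sum>i\<in>UNIV. \<psi> x $ i * hydro_op g b u \<phi> x $ i)
        = (\<Sum>i\<in>UNIV. \<Sum>j\<in>UNIV. \<psi> x $ j * (g (u x) $ j $ i * xderiv \<phi> x $ i + \<beta> j i x * \<phi> x $ i))"
      by (simp add: hydro_op_def \<beta>_def sum_distrib_left) (rule sum.swap)
    have 1: "(\<Sum>i\<in>UNIV. \<phi> x $ i * hydro_op g b u \<psi> x $ i)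
        = (\<Sum>i\<in>UNIV. \<Sum>j\<in>UNIV. \<phi> x $ i * (g (u x) $ i $ j * xderiv \<psi> x $ j + \<beta> i j x * \<psi> x $ j))"
      by (simp add: hydro_op_def \<beta>_def sum_distrib_left)
    have "?h x = (\<Sum>i\<in>UNIV. \<Sum>j\<in>UNIV. (xderiv \<phi> x $ i * g (u x) $ i $ j + (\<beta> i j x
        + \<beta> j i x) * \<phi> x $ i) * \<psi> x $ j
          + xderiv \<psi> x $ j * (\<phi> x $ i * g (u x) $ i $ j))"
      unfolding 1 2 sum.distrib[symmetric]
      by (intro sum.cong refl, subst sym_g[OF fields_in[OF u]]) (simp add: algebra_simps)
    with D show "((\<lambda>x. \<Sum>i\<in>UNIV. \<Sum>j\<in>UNIV. \<phi> x $ i * g (u x) $ i $ j * \<psi> x $ j)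
        has_real_derivative ?h x) (at x)" by simp
  qed
  then have "loop_inner \<phi> (hydro_op g b u \<psi>) + loop_inner \<psi> (hydro_op g b u \<phi>) = 0"
    unfolding loop_inner_def
    by (subst integral_add[symmetric])
      (auto intro!: sloop_integrable sloop_intros sloop_nth smooth_hydro_op u \<phi> \<psi>)
  then show ?thesis by simp
qed

text \<open>
  The symmetric part of \<open>b\<close> in the upper indices is a gradient.
\<close>

lemma curl_antisym: "u \<in> U \<Longrightarrow> curl b j i k s u = - curl b i j k s u"
proof -
  assume u: "u \<in> U"
  have e: "pd m (b j i k) u = pd m (pd k (\<lambda>u. g u $ i $ j)) u - pd m (b i j k) u" for m k
  proof -
    have "pd m (b j i k) u = pd m (\<lambda>v. pd k (\<lambda>u. g u $ i $ j) v - b i j k v) u"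
      by (rule pd_cong) (auto simp: pd_g u)
    also have "\<dots> = pd m (pd k (\<lambda>u. g u $ i $ j)) u - pd m (b i j k) u"
      by (rule phase_fun.d_diff) (auto intro: phase_fun.smooth_reg phase_fun.smooth_d smooth_g smooth_b u)
    finally show ?thesis .
  qed
  show ?thesis
    unfolding curl_def e using pd_commute[OF smooth_g u, of k s i j] by simp
qed

lemma hydro_covector_antisym: "hydro_covector b u \<psi> \<phi> x = - hydro_covector b u \<phi> \<psi> x" if u: "u \<in> fields U"
proof -
  have c': "(\<Sum>s\<in>UNIV. curl b j i k s (u x) * xderiv u x $ s) =
      - (\<Sum>s\<in>UNIV. curl b i j k s (u x) * xderiv u x $ s)" for i j k
    unfolding sum_negf[symmetric] by (intro sum.cong refl) (simp add: curl_antisym[OF fields_in[OF u],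
        where j=j and i=i])
  have "(\<Sum>i\<in>UNIV. \<Sum>j\<in>UNIV. b j i k (u x) * \<psi> x $ i * xderiv \<phi> x $ j - b i j k (u x) * xderiv \<psi> x $ i * \<phi> x $ j
      + (\<Sum>s\<in>UNIV. curl b i j k s (u x) * xderiv u x $ s) * \<psi> x $ i * \<phi> x $ j)
    = - (\<Sum>i\<in>UNIV. \<Sum>j\<in>UNIV. b j i k (u x) * \<phi> x $ i * xderiv \<psi> x $ j - b i j k (u x) * xderiv \<phi> x $ i * \<psi> x $ j
      + (\<Sum>s\<in>UNIV. curl b i j k s (u x) * xderiv u x $ s) * \<phi> x $ i * \<psi> x $ j)" for k
    unfolding sum_negf[symmetric]
  proof (subst (2) sum.swap, intro sum.cong refl)
    fix i j
    show "b j i k (u x) * \<psi> x $ i * xderiv \<phi> x $ j - b i j k (u x) * xderiv \<psi> x $ i * \<phi> x $ j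
      + (\<Sum>s\<in>UNIV. curl b i j k s (u x) * xderiv u x $ s) * \<psi> x $ i * \<phi> x $ j
    = - (b i j k (u x) * \<phi> x $ j * xderiv \<psi> x $ i - b j i k (u x) * xderiv \<phi> x $ j * \<psi> x $ i
      + (\<Sum>s\<in>UNIV. curl b j i k s (u x) * xderiv u x $ s) * \<phi> x $ j * \<psi> x $ i)"
      unfolding c'[of j i] by (simp add: algebra_simps)
  qed
  then show ?thesis
    unfolding hydro_covector_def vec_eq_iff by simp
qed

text \<open>
  The two integrands differ by the \<open>x\<close>-derivative of \<open>\<Sum> b^{ij}_k \<phi>\<^sub>i \<psi>\<^sub>j v^k\<close>.
\<close>

lemma hydro_op_var_covector:
  assumes u: "u \<in> fields U" and v: "v \<in> smooth_loops" and \<phi>: "\<phi> \<in> smooth_loops" and \<psi>: "\<psi> \<in> smooth_loops"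
  shows "loop_inner \<phi> (hydro_op_var g b u v \<psi>) = loop_inner v (hydro_covector b u \<phi> \<psi>)"
proof -
  let ?h = "\<lambda>x. (\<Sum>i\<in>UNIV. \<phi> x $ i * hydro_op_var g b u v \<psi> x $ i)
      - (\<Sum>k\<in>UNIV. v x $ k * hydro_covector b u \<phi> \<psi> x $ k)"
  have "integral {0..1} ?h = 0"
  proof (rule sloop_integral_0)
    show "sloop (\<lambda>x. \<Sum>i\<in>UNIV. \<Sum>j\<in>UNIV. \<Sum>k\<in>UNIV. b i j k (u x) * \<phi> x $ i * \<psi> x $ j * v x $ k)"
      by (intro sloop_intros sloop_b u sloop_nth v \<phi> \<psi>)
    fix x
    let ?db = "\<lambda>i j k m. pd m (b i j k) (u x)"
    have D: "((\<lambda>x. \<Sum>i\<in>UNIV. \<Sum>j\<in>UNIV. \<Sum>k\<in>UNIV. b i j k (u x) * \<phi> x $ i * \<psi> x $ j * v x $ k) has_real_derivative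
       (\<Sum>i\<in>UNIV. \<Sum>j\<in>UNIV. \<Sum>k\<in>UNIV. (((\<Sum>m\<in>UNIV. ?db i j k m * xderiv u x $ m) * \<phi> x $ i
           + xderiv \<phi> x $ i * b i j k (u x)) * \<psi> x $ j
          + xderiv \<psi> x $ j * (b i j k (u x) * \<phi> x $ i)) * v x $ k
              + xderiv v x $ k * (b i j k (u x) * \<phi> x $ i * \<psi> x $ j))) (at x)"
      by (intro DERIV_sum DERIV_mult phase_fun_DERIV smooth_b u smooth_loops_DERIV v \<phi> \<psi>)
    have 1: "(\<Sum>i\<in>UNIV. \<phi> x $ i * hydro_op_var g b u v \<psi> x $ i)
      = (\<Sum>i\<in>UNIV. \<Sum>j\<in>UNIV. \<Sum>k\<in>UNIV. \<phi> x $ i * ((b i j k (u x) + b j i k (u x)) * v x $ k * xderiv \<psi> x $ j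
          + ((\<Sum>m\<in>UNIV. ?db i j m k * xderiv u x $ m) * v x $ k + b i j k (u x) * xderiv v x $ k) * \<psi> x $ j))"
    proof -
      have "(\<Sum>k\<in>UNIV. (\<Sum>m\<in>UNIV. ?db i j k m * v x $ m) * xderiv u x $ k)
          = (\<Sum>k\<in>UNIV. (\<Sum>m\<in>UNIV. ?db i j m k * xderiv u x $ m) * v x $ k)" for i j
        unfolding sum_distrib_right by (subst sum.swap) (simp add: mult_ac)
      then show ?thesis
        by (simp add: hydro_op_var_def pd_g[OF fields_in[OF u]] sum_distrib_left sum_distrib_right
            sum.distrib algebra_simps)
    qed
    have 2: "(\<Sum>k\<in>UNIV. v x $ k * hydro_covector b u \<phi> \<psi> x $ k)
      = (\<Sum>i\<in>UNIV. \<Sum>j\<in>UNIV. \<Sum>k\<in>UNIV. v x $ k * (b j i k (u x) * \<phi> x $ i * xderiv \<psi> x $ j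
          - b i j k (u x) * xderiv \<phi> x $ i * \<psi> x $ j
      + ((\<Sum>m\<in>UNIV. ?db i j m k * xderiv u x $ m) - (\<Sum>m\<in>UNIV. ?db i j k m * xderiv u x $ m)) * \<phi> x $ i *
          \<psi> x $ j))"
      unfolding hydro_covector_def curl_def vec_lambda_beta sum_distrib_left left_diff_distrib sum_subtractf
      by (subst sum.swap, rule sum.cong[OF refl], rule sum.swap)
    have "?h x = (\<Sum>i\<in>UNIV. \<Sum>j\<in>UNIV. \<Sum>k\<in>UNIV. (((\<Sum>m\<in>UNIV. ?db i j k m * xderiv u x $ m) * \<phi> x $ i
        + xderiv \<phi> x $ i * b i j k (u x)) * \<psi> x $ j
          + xderiv \<psi> x $ j * (b i j k (u x) * \<phi> x $ i)) * v x $ k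
              + xderiv v x $ k * (b i j k (u x) * \<phi> x $ i * \<psi> x $ j))"
      unfolding 1 2 sum_subtractf[symmetric] by (intro sum.cong refl) (simp add: algebra_simps sum_subtractf)
    with D show "((\<lambda>x. \<Sum>i\<in>UNIV. \<Sum>j\<in>UNIV. \<Sum>k\<in>UNIV. b i j k (u x) * \<phi> x $ i * \<psi> x $ j * v x $ k)
        has_real_derivative ?h x) (at x)" by simp
  qed
  then have "loop_inner \<phi> (hydro_op_var g b u v \<psi>) - loop_inner v (hydro_covector b u \<phi> \<psi>) = 0"
    unfolding loop_inner_def
    by (subst integral_diff[symmetric])
      (auto intro!: sloop_integrable sloop_intros sloop_nth smooth_hydro_op_var smooth_hydro_covector u v \<phi> \<psi>)
  then show ?thesis by simp
qed

lemma hydro_op_var_skew: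
  assumes "u \<in> fields U" "v \<in> smooth_loops" "\<phi> \<in> smooth_loops" "\<psi> \<in> smooth_loops"
  shows "loop_inner \<phi> (hydro_op_var g b u v \<psi>) = - loop_inner \<psi> (hydro_op_var g b u v \<phi>)"
proof -
  have "hydro_covector b u \<phi> \<psi> = (\<lambda>x. - hydro_covector b u \<psi> \<phi> x)"
    using hydro_covector_antisym[OF assms(1)] by blast
  then show ?thesis
    by (simp only: hydro_op_var_covector[OF assms] hydro_op_var_covector[OF assms(1,2,4,3)]
      loop_inner_uminus_right)
qed


lemma gradient_loop: "gradient F m e \<Longrightarrow> u \<in> fields U \<Longrightarrow> (\<lambda>x. \<chi> i. e i (prolong u x)) \<in> smooth_loops"
  by (auto simp: gradient_def has_variational_derivative_def)

lemma hessian_loop: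
  "gradient F m e \<Longrightarrow> u \<in> fields U \<Longrightarrow> v \<in> smooth_loops \<Longrightarrow> (\<lambda>x. \<chi> i. linearization m (e i) u v x) \<in> smooth_loops"
  by (auto simp: smooth_loops_iff[of "\<lambda>x. \<chi> i. linearization m (e i) u v x"] gradient_def intro!:
      sloop_linearization)

text \<open>
  The bracket of two local functionals has this density, so it is local again and has a variational
  derivative.
\<close>

definition bracket_density ::
  "('n \<Rightarrow> 'n jet \<Rightarrow> real) \<Rightarrow> nat \<Rightarrow> ('n \<Rightarrow> 'n jet \<Rightarrow> real) \<Rightarrow> 'n jet \<Rightarrow> real" where
  "bracket_density e m e' p = (\<Sum>i\<in>UNIV. e i p * (\<Sum>j\<in>UNIV.
     g (snd p 0) $ i $ j * total_deriv m (e' j) p + (\<Sum>k\<in>UNIV. b i j k (snd p 0) * snd p 1 $ k) * e' j p))"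

lemma density_le_bracket_density:
  assumes "\<And>i. density_le m (e i)" "\<And>i. density_le m' (e' i)"
  shows "density_le (Suc (m + m')) (bracket_density e m' e')"
  unfolding bracket_density_def[abs_def]
  by (intro density_le_sum density_le_mult density_le_add density_le_phase_fun smooth_g smooth_b
      density_le_coord
      density_le_mono[OF density_le_total_deriv[OF assms(2)]] density_le_mono[OF assms(1)]
          density_le_mono[OF assms(2)]) auto

lemma xderiv_gradient_loop:
  assumes "\<And>i. density_le m (e i)" "u \<in> fields U"
  shows "xderiv (\<lambda>x. \<chi> i. e i (prolong u x)) x $ i = total_deriv m (e i) (prolong u x)"
proof -
  have "(\<lambda>x. \<chi> i. e i (prolong u x)) \<in> smooth_loops"
    by (auto simp: smooth_loops_iff intro!: sloop_prolong assms)
  from smooth_loops_DERIV[OF this, of i x] prolong_DERIV[OF assms, of i x]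
  show ?thesis by (simp add: DERIV_unique)
qed

lemma xderiv_linearization_loop:
  assumes "\<And>i. density_le m (e i)" "u \<in> fields U" "v \<in> smooth_loops"
  shows "xderiv (\<lambda>x. \<chi> i. linearization m (e i) u v x) x $ i
      = linearization (Suc m) (total_deriv m (e i)) u v x"
proof -
  have "(\<lambda>x. \<chi> i. linearization m (e i) u v x) \<in> smooth_loops"
    by (auto simp: smooth_loops_iff intro!: sloop_linearization assms)
  from DERIV_imp_deriv[OF smooth_loops_DERIV[OF this, of i x]]
  show ?thesis by (simp add: linearization_total_deriv[OF assms])
qed

lemma prolong_snd: "snd (prolong u x) 0 = u x" "snd (prolong u x) 1 = xderiv u x"
    "snd (prolong u x) (Suc 0) = xderiv u x"
  by (simp_all add: prolong_def)

lemma bracket_density_prolong: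
  assumes "\<And>i. density_le m (e i)" "\<And>i. density_le m' (e' i)" and u: "u \<in> fields U"
  shows "bracket_density e m' e' (prolong u x) =
    (\<Sum>i\<in>UNIV. e i (prolong u x) * hydro_op g b u (\<lambda>x. \<chi> i. e' i (prolong u x)) x $ i)"
  by (simp add: bracket_density_def hydro_op_def xderiv_gradient_loop[OF assms(2) u] prolong_snd)

text \<open>
  The product rule for the integrand \<open>\<phi> \<sqdot> A \<psi>\<close>, in which \<open>\<phi>\<close>, \<open>A\<close> and \<open>\<psi>\<close> all depend on the field.
\<close>

lemma linearization_bracket_density:
  assumes e: "\<And>i. density_le m (e i)" and e': "\<And>i. density_le m' (e' i)"
    and u: "u \<in> fields U" and v: "v \<in> smooth_loops"
  shows "linearization (Suc (m + m')) (bracket_density e m' e') u v x =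
    (\<Sum>i\<in>UNIV. linearization m (e i) u v x * hydro_op g b u (\<lambda>x. \<chi> i. e' i (prolong u x)) x $ i
      + e i (prolong u x) * (hydro_op_var g b u v (\<lambda>x. \<chi> i. e' i (prolong u x)) x $ i
         + hydro_op g b u (\<lambda>x. \<chi> i. linearization m' (e' i) u v x) x $ i))"
proof -
  let ?w = "\<lambda>t x. u x + t *\<^sub>R v x"
  note us = fields_smooth[OF u]
  have w0: "?w 0 \<in> fields U" using u by simp
  have D: "((\<lambda>t. f (prolong (?w t) x)) has_real_derivative linearization m f u v x) (at 0)"
      if "density_le m f" for f m
    using linearization_DERIV[OF that us v w0] by simp
  have H: "((\<lambda>t. h (?w t x)) has_real_derivative (\<Sum>k\<in>UNIV. pd k h (u x) * v x $ k)) (at 0)"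
      if "smooth_fun U h" for h
  proof -
    have "((\<lambda>t. ?w t x) has_vector_derivative v x) (at 0)"
      using has_vector_derivative_add[OF has_vector_derivative_const
        has_vector_derivative_scaleR[OF DERIV_ident has_vector_derivative_const], of "u x" "v x"] by simp
    with chain_rule_pd[of h "\<lambda>t. ?w t x" 0 "v x"] smooth_differentiable[OF that fields_in[OF u], of x]
    show ?thesis by simp
  qed
  have X: "((\<lambda>t. snd (prolong (?w t) x) 1 $ k) has_real_derivative xderiv v x $ k) (at 0)" for k
    using smooth_loops_combine(2)[OF us v, of 1]
    by (auto simp: prolong_def intro!: derivative_eq_intros)
  have "((\<lambda>t. bracket_density e m' e' (prolong (?w t) x)) has_real_derivative
     (\<Sum>i\<in>UNIV. linearization m (e i) u v x * (\<Sum>j\<in>UNIV.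
         g (?w 0 x) $ i $ j * total_deriv m' (e' j) (prolong (?w 0) x)
         + (\<Sum>k\<in>UNIV. b i j k (?w 0 x) * snd (prolong (?w 0) x) 1 $ k) * e' j (prolong (?w 0) x))
       + (\<Sum>j\<in>UNIV. ((\<Sum>k\<in>UNIV. pd k (\<lambda>u. g u $ i $ j) (u x) * v x $ k) * total_deriv m' (e' j) (prolong
           (?w 0) x)
           + linearization (Suc m') (total_deriv m' (e' j)) u v x * g (?w 0 x) $ i $ j)
         + ((\<Sum>k\<in>UNIV. (\<Sum>m\<in>UNIV. pd m (b i j k) (u x) * v x $ m) * snd (prolong (?w 0) x) 1 $ k
              + xderiv v x $ k * b i j k (?w 0 x)) * e' j (prolong (?w 0) x)
           + linearization m' (e' j) u v x * (\<Sum>k\<in>UNIV. b i j k (?w 0 x) * snd (prolong (?w 0) x) 1 $ k)))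
       * e i (prolong (?w 0) x))) (at 0)"
    unfolding bracket_density_def prolong_snd(1)
    by (intro DERIV_sum DERIV_mult DERIV_add D H X e e' density_le_total_deriv smooth_g smooth_b)
  from DERIV_unique[OF D[OF density_le_bracket_density[OF e e']] this]
  show ?thesis
    by (simp add: hydro_op_def hydro_op_var_def xderiv_gradient_loop[OF e' u]
        xderiv_linearization_loop[OF e' u v] prolong_snd sum.distrib algebra_simps)
qed

end


context hydro_operator
begin

lemma hydro_bracket_density:
  assumes F: "gradient F m e" and G: "gradient G m' e'" and u: "u \<in> fields U"
  shows "hydro_bracket g b F G u = integral {0..1} (\<lambda>x. bracket_density e m' e' (prolong u x))"
proof -
  have "density_le m (e i)" "density_le m' (e' i)" for i using F G by (auto simp: gradient_def)
  from bracket_density_prolong[OF this u] show ?thesis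
    by (simp add: hydro_bracket_eq loop_inner_def gradient_variational_derivative[OF F u]
        gradient_variational_derivative[OF G u])
qed

lemma local_functional_bracket:
  assumes "local_functional U F" "local_functional U G"
  shows "local_functional U (hydro_bracket g b F G)"
proof -
  obtain m e where F: "gradient F m e" by (rule local_functional_gradient[OF assms(1)])
  obtain m' e' where G: "gradient G m' e'" by (rule local_functional_gradient[OF assms(2)])
  have "density_le m (e i)" "density_le m' (e' i)" for i using F G by (auto simp: gradient_def)
  note dh = density_le_bracket_density[OF this]
  show ?thesis
    unfolding local_functional_def density_iff_density_le
    by (intro exI conjI ballI, rule dh, rule hydro_bracket_density[OF F G])
qed

lemma bracket_variation:
  assumes F: "gradient F m e" and G: "gradient G m' e'"
    and u: "u \<in> fields U" and v: "v \<in> smooth_loops"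
  defines "\<phi> \<equiv> (\<lambda>x. \<chi> i. e i (prolong u x))" and "\<psi> \<equiv> (\<lambda>x. \<chi> i. e' i (prolong u x))"
  shows "((\<lambda>t. hydro_bracket g b F G (\<lambda>x. u x + t *\<^sub>R v x)) has_real_derivative
      loop_inner (\<lambda>x. \<chi> i. linearization m (e i) u v x) (hydro_op g b u \<psi>)
      + loop_inner \<phi> (hydro_op_var g b u v \<psi>)
      + loop_inner \<phi> (hydro_op g b u (\<lambda>x. \<chi> i. linearization m' (e' i) u v x))) (at 0)"
proof -
  have e: "density_le m (e i)" and e': "density_le m' (e' i)" for i using F G by (auto simp: gradient_def)
  note dh = density_le_bracket_density[OF e e']
  have \<phi>: "\<phi> \<in> smooth_loops" and \<psi>: "\<psi> \<in> smooth_loops"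
    using gradient_loop[OF F u] gradient_loop[OF G u] by (auto simp: \<phi>_def \<psi>_def)
  note h1 = hessian_loop[OF F u v] and h2 = hessian_loop[OF G u v]
  obtain \<epsilon> where \<epsilon>: "\<epsilon> > 0" "\<And>t. \<bar>t\<bar> < \<epsilon> \<Longrightarrow> (\<lambda>x. u x + t *\<^sub>R v x) \<in> fields U"
    using variation_in_fields[OF u v] by metis
  let ?h = "bracket_density e m' e'"
  have "((\<lambda>t. integral {0..1} (\<lambda>x. ?h (prolong (\<lambda>x. u x + t *\<^sub>R v x) x)))
      has_real_derivative integral {0..1} (linearization (Suc (m + m')) ?h u v)) (at 0)"
    using integral_variation_DERIV[OF u v, of "{()}" "\<lambda>_. Suc (m + m')" "\<lambda>_. ?h" "\<lambda>_ _. 1"] dh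
    by (simp add: sloop_const)
  then have "((\<lambda>t. hydro_bracket g b F G (\<lambda>x. u x + t *\<^sub>R v x))
      has_real_derivative integral {0..1} (linearization (Suc (m + m')) ?h u v)) (at 0)"
    by (rule has_field_derivative_transform_within[OF _ \<epsilon>(1)])
      (auto simp: hydro_bracket_density[OF F G] \<epsilon>(2) dist_real_def)
  moreover have "linearization (Suc (m + m')) ?h u v = (\<lambda>x.
      (\<Sum>i\<in>UNIV. (\<chi> i. linearization m (e i) u v x) $ i * hydro_op g b u \<psi> x $ i)
      + (\<Sum>i\<in>UNIV. \<phi> x $ i * hydro_op_var g b u v \<psi> x $ i)
      + (\<Sum>i\<in>UNIV. \<phi> x $ i * hydro_op g b u (\<lambda>x. \<chi> i. linearization m' (e' i) u v x) x $ i))"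
    by (simp add: linearization_bracket_density[OF e e' u v] \<phi>_def \<psi>_def sum.distrib distrib_left fun_eq_iff)
  moreover have "integral {0..1} (\<lambda>x.
      (\<Sum>i\<in>UNIV. (\<chi> i. linearization m (e i) u v x) $ i * hydro_op g b u \<psi> x $ i)
      + (\<Sum>i\<in>UNIV. \<phi> x $ i * hydro_op_var g b u v \<psi> x $ i)
      + (\<Sum>i\<in>UNIV. \<phi> x $ i * hydro_op g b u (\<lambda>x. \<chi> i. linearization m' (e' i) u v x) x $ i))
    = loop_inner (\<lambda>x. \<chi> i. linearization m (e i) u v x) (hydro_op g b u \<psi>)
      + loop_inner \<phi> (hydro_op_var g b u v \<psi>)
      + loop_inner \<phi> (hydro_op g b u (\<lambda>x. \<chi> i. linearization m' (e' i) u v x))"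
  proof -
    have *: "(\<lambda>x. \<Sum>i\<in>UNIV. p x $ i * q x $ i) integrable_on {0..1}"
      if "p \<in> smooth_loops" "q \<in> smooth_loops" for p q :: "real \<Rightarrow> real^'n"
      by (intro sloop_integrable sloop_sum sloop_mult sloop_nth that)
    note i = *[OF h1 smooth_hydro_op[OF u \<psi>]] *[OF \<phi> smooth_hydro_op_var[OF u v \<psi>]]
      *[OF \<phi> smooth_hydro_op[OF u h2]]
    show ?thesis
      unfolding loop_inner_def
      by (simp only: integral_add[OF integrable_add[OF i(1,2)] i(3)] integral_add[OF i(1,2)])
  qed
  ultimately show ?thesis by simp
qed

text \<open>
  Bracketing with \<open>H\<close> is differentiation in the direction \<open>A \<delta>H\<close>; skewness of \<open>A\<close> moves the Hessian of \<open>G\<close>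
  to the left.
\<close>

lemma double_bracket:
  assumes F: "gradient F m e" and G: "gradient G m' e'"
    and FGH: "local_functional U F" "local_functional U G" "local_functional U H" and u: "u \<in> fields U"
  defines "\<phi> \<equiv> variational_derivative F u" and "\<psi> \<equiv> variational_derivative G u"
    and "\<theta> \<equiv> variational_derivative H u"
  shows "hydro_bracket g b (hydro_bracket g b F G) H u =
      loop_inner (\<lambda>x. \<chi> i. linearization m (e i) u (hydro_op g b u \<theta>) x) (hydro_op g b u \<psi>)
      - loop_inner (\<lambda>x. \<chi> i. linearization m' (e' i) u (hydro_op g b u \<theta>) x) (hydro_op g b u \<phi>)
      + loop_inner \<phi> (hydro_op_var g b u (hydro_op g b u \<theta>) \<psi>)"
proof -
  have v: "hydro_op g b u \<theta> \<in> smooth_loops"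
    unfolding \<theta>_def by (intro smooth_hydro_op u variational_derivative_smooth FGH)
  have \<phi>: "\<phi> \<in> smooth_loops"
    unfolding \<phi>_def by (intro u variational_derivative_smooth FGH)
  note 1 = bracket_variation[OF F G u v, folded gradient_variational_derivative[OF F u]
    gradient_variational_derivative[OF G u], folded \<phi>_def \<psi>_def]
  note 2 = has_variational_derivativeD[OF
    has_variational_derivative_local[OF local_functional_bracket[OF FGH(1,2)] u] v]
  show ?thesis
    using DERIV_unique[OF 1 2] hydro_op_skew[OF u \<phi> hessian_loop[OF G u v]]
    by (simp add: hydro_bracket_eq \<theta>_def)
qed

text \<open>
  By symmetry each Hessian occurs twice in the cyclic sum, with opposite signs. The three remaining terms
  are brought into the form of an integral against the gradient of \<open>H\<close>.
\<close>

lemma jacobi_sum: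
  assumes FGH: "local_functional U F" "local_functional U G" "local_functional U H" and u: "u \<in> fields U"
  shows "hydro_bracket g b (hydro_bracket g b F G) H u
         + hydro_bracket g b (hydro_bracket g b G H) F u
         + hydro_bracket g b (hydro_bracket g b H F) G u
       = loop_inner (variational_derivative H u)
           (jacobiator g b u (variational_derivative F u) (variational_derivative G u))"
proof -
  obtain m1 e1 where F: "gradient F m1 e1" by (rule local_functional_gradient[OF FGH(1)])
  obtain m2 e2 where G: "gradient G m2 e2" by (rule local_functional_gradient[OF FGH(2)])
  obtain m3 e3 where H: "gradient H m3 e3" by (rule local_functional_gradient[OF FGH(3)])
  define \<phi> where "\<phi> = variational_derivative F u"
  define \<psi> where "\<psi> = variational_derivative G u"
  define \<theta> where "\<theta> = variational_derivative H u"
  have sm: "\<phi> \<in> smooth_loops" "\<psi> \<in> smooth_loops" "\<theta> \<in> smooth_loops"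
    unfolding \<phi>_def \<psi>_def \<theta>_def by (intro variational_derivative_smooth FGH u)+
  note v = sm[THEN smooth_hydro_op[OF u]]
  have sym: "loop_inner (\<lambda>x. \<chi> i. linearization m (e i) u v x) q
      = loop_inner (\<lambda>x. \<chi> i. linearization m (e i) u q x) v"
    if "gradient K m e" "v \<in> smooth_loops" "q \<in> smooth_loops" for K m e v q
    using that u by (simp add: gradient_def)
  let ?A = "hydro_op g b u"
  have "hydro_bracket g b (hydro_bracket g b F G) H u
         + hydro_bracket g b (hydro_bracket g b G H) F u
         + hydro_bracket g b (hydro_bracket g b H F) G u
      = loop_inner \<phi> (hydro_op_var g b u (?A \<theta>) \<psi>) + loop_inner \<psi> (hydro_op_var g b u (?A \<phi>) \<theta>)
         + loop_inner \<theta> (hydro_op_var g b u (?A \<psi>) \<phi>)"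
    unfolding double_bracket[OF F G FGH u] double_bracket[OF G H FGH(2,3,1) u]
      double_bracket[OF H F FGH(3,1,2) u] \<phi>_def[symmetric] \<psi>_def[symmetric] \<theta>_def[symmetric]
    using sym[OF F v(3) v(2)] sym[OF G v(1) v(3)] sym[OF H v(2) v(1)] by simp
  also have "loop_inner \<phi> (hydro_op_var g b u (?A \<theta>) \<psi>)
      = - loop_inner \<theta> (?A (hydro_covector b u \<phi> \<psi>))"
    unfolding hydro_op_var_covector[OF u v(3) sm(1,2)]
      hydro_op_skew[OF u sm(3) smooth_hydro_covector[OF u sm(1,2)]]
    by (simp add: loop_inner_commute)
  also have "loop_inner \<psi> (hydro_op_var g b u (?A \<phi>) \<theta>) = - loop_inner \<theta> (hydro_op_var g b u (?A \<phi>) \<psi>)"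
    by (rule hydro_op_var_skew[OF u v(1) sm(2,3)])
  finally show ?thesis
    unfolding jacobiator_def[abs_def] \<phi>_def[symmetric] \<psi>_def[symmetric] \<theta>_def[symmetric]
    by (simp add: loop_inner_diff_right smooth_loops_diff smooth_hydro_op_var smooth_hydro_op
        smooth_hydro_covector u sm v)
qed

text \<open>
  A loop that is orthogonal to all smooth loops vanishes, so the linear functionals detect the jacobiator.
\<close>

lemma hamiltonian_iff_jacobiator:
  "hamiltonian U g b \<longleftrightarrow>
    (\<forall>u\<in>fields U. \<forall>\<phi>\<in>smooth_loops. \<forall>\<psi>\<in>smooth_loops. \<forall>x. jacobiator g b u \<phi> \<psi> x = 0)"
proof
  assume ham: "hamiltonian U g b"
  show "\<forall>u\<in>fields U. \<forall>\<phi>\<in>smooth_loops. \<forall>\<psi>\<in>smooth_loops. \<forall>x. jacobiator g b u \<phi> \<psi> x = 0"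
  proof (intro ballI allI)
    fix u \<phi> \<psi> :: "real \<Rightarrow> real^'n" and x
    assume u: "u \<in> fields U" and \<phi>: "\<phi> \<in> smooth_loops" and \<psi>: "\<psi> \<in> smooth_loops"
    note J = smooth_jacobiator[OF u \<phi> \<psi>]
    show "jacobiator g b u \<phi> \<psi> x = 0"
    proof (rule loop_integral_inner_eq_0[OF J])
      fix v :: "real \<Rightarrow> real^'n" assume v: "v \<in> smooth_loops"
      have "loop_inner v (jacobiator g b u \<phi> \<psi>) = 0"
        using jacobi_sum[OF linear_functional(1)[OF \<phi>] linear_functional(1)[OF \<psi>]
            linear_functional(1)[OF v] u]
          ham u linear_functional(1)[OF \<phi>] linear_functional(1)[OF \<psi>] linear_functional(1)[OF v]
        unfolding hamiltonian_def linear_functional(2)[OF \<phi> u] linear_functional(2)[OF \<psi> u]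
            linear_functional(2)[OF v u]
        by simp
      then show "integral {0..1} (\<lambda>x. \<Sum>i\<in>UNIV. jacobiator g b u \<phi> \<psi> x $ i * v x $ i) = 0"
        by (simp add: loop_inner_def mult.commute)
    qed
  qed
next
  assume J: "\<forall>u\<in>fields U. \<forall>\<phi>\<in>smooth_loops. \<forall>\<psi>\<in>smooth_loops. \<forall>x. jacobiator g b u \<phi> \<psi> x = 0"
  have "loop_inner w (jacobiator g b u \<phi> \<psi>) = 0"
    if "u \<in> fields U" "\<phi> \<in> smooth_loops" "\<psi> \<in> smooth_loops" for u w \<phi> \<psi>
    using J that by (simp add: loop_inner_def)
  then show "hamiltonian U g b"
    unfolding hamiltonian_def
    by (auto simp: jacobi_sum variational_derivative_smooth)
      (auto simp: hydro_bracket_eq variational_derivative_smooth intro: hydro_op_skew)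
qed

end


section \<open>Pointwise form of the Jacobi identity\<close>

text \<open>
  The algebra behind the vanishing of the jacobiator, at a fixed point of the circle. Here \<open>\<beta>\<close> and \<open>C\<close> stand
  for \<open>b\<close> and its curl contracted with \<open>u_x\<close>, the functions \<open>f\<close>, \<open>f'\<close>, \<open>h\<close>, \<open>h'\<close> for the two covectors and
  their \<open>x\<close>-derivatives, \<open>A\<close> and \<open>B\<close> for the images of \<open>h\<close> and \<open>f\<close> under the operator. In both identities the
  products \<open>f' h'\<close>, \<open>f' h\<close>, \<open>f h'\<close> and \<open>f h\<close> are compared separately.
\<close>

lemma jacobiator_coefficients_cancel:
  fixes g \<beta> :: "'n::finite \<Rightarrow> 'n \<Rightarrow> real" and b C :: "'n \<Rightarrow> 'n \<Rightarrow> 'n \<Rightarrow> real"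
    and f f' h h' A B W :: "'n \<Rightarrow> real"
  assumes sym: "\<And>i j. g i j = g j i"
    and P3: "\<And>i j k. (\<Sum>s\<in>UNIV. g i s * b j k s) = (\<Sum>s\<in>UNIV. g j s * b i k s)"
    and P4: "\<And>l i j. (\<Sum>k\<in>UNIV. g l k * C i j k) = (\<Sum>k\<in>UNIV. b l i k * \<beta> k j) - (\<Sum>k\<in>UNIV. b l j k * \<beta> k i)"
    and P5: "\<And>i j l. (\<Sum>k\<in>UNIV. \<beta> k l * C i j k) + (\<Sum>k\<in>UNIV. \<beta> k j * C l i k) + (\<Sum>k\<in>UNIV. \<beta> k i * C j l k) = 0"
    and antisym: "\<And>i j k. C j i k = - C i j k"
    and A: "\<And>k. A k = (\<Sum>j\<in>UNIV. g k j * h' j + \<beta> k j * h j)"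
    and B: "\<And>k. B k = (\<Sum>j\<in>UNIV. g k j * f' j + \<beta> k j * f j)"
    and W: "\<And>k. W k = (\<Sum>i\<in>UNIV. \<Sum>j\<in>UNIV. b j i k * f i * h' j - b i j k * f' i * h j + C i j k * f i * h j)"
  shows "(\<Sum>k\<in>UNIV. g l k * W k) = (\<Sum>i\<in>UNIV. f i * (\<Sum>k\<in>UNIV. b l i k * A k))
      - (\<Sum>i\<in>UNIV. h i * (\<Sum>k\<in>UNIV. b l i k * B k))" (is ?one)
    and "(\<Sum>i\<in>UNIV. \<Sum>k\<in>UNIV. A k * (b i l k * f' i + C l i k * f i))
       - (\<Sum>j\<in>UNIV. \<Sum>k\<in>UNIV. B k * (b j l k * h' j + C l j k * h j))
       + (\<Sum>k\<in>UNIV. \<beta> k l * W k) = 0" (is ?two)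
proof -
  have W': "(\<Sum>k\<in>UNIV. c k * W k) = (\<Sum>i\<in>UNIV. \<Sum>j\<in>UNIV.
      (\<Sum>k\<in>UNIV. c k * b j i k) * f i * h' j - (\<Sum>k\<in>UNIV. c k * b i j k) * f' i * h j
          + (\<Sum>k\<in>UNIV. c k * C i j k) * f i * h j)" for c
  proof -
    have "(\<Sum>k\<in>UNIV. c k * W k) = (\<Sum>i\<in>UNIV. \<Sum>j\<in>UNIV. \<Sum>k\<in>UNIV.
        c k * (b j i k * f i * h' j - b i j k * f' i * h j + C i j k * f i * h j))"
      unfolding W sum_distrib_left by (subst sum.swap, rule sum.cong[OF refl], rule sum.swap)
    also have "\<dots> = (\<Sum>i\<in>UNIV. \<Sum>j\<in>UNIV.
      (\<Sum>k\<in>UNIV. c k * b j i k) * f i * h' j - (\<Sum>k\<in>UNIV. c k * b i j k) * f' i * h j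
          + (\<Sum>k\<in>UNIV. c k * C i j k) * f i * h j)"
      by (intro sum.cong refl)
        (simp add: sum_distrib_left sum_distrib_right sum.distrib sum_subtractf algebra_simps)
    finally show ?thesis .
  qed
  have A': "(\<Sum>k\<in>UNIV. c k * A k) = (\<Sum>j\<in>UNIV. (\<Sum>k\<in>UNIV. c k * g k j) * h' j
      + (\<Sum>k\<in>UNIV. c k * \<beta> k j) * h j)" for c
    unfolding A sum_distrib_left
    by (subst sum.swap) (simp add: sum_distrib_left sum_distrib_right sum.distrib algebra_simps)
  have B': "(\<Sum>k\<in>UNIV. c k * B k) = (\<Sum>j\<in>UNIV. (\<Sum>k\<in>UNIV. c k * g k j) * f' j
      + (\<Sum>k\<in>UNIV. c k * \<beta> k j) * f j)" for c
    unfolding B sum_distrib_left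
    by (subst sum.swap) (simp add: sum_distrib_left sum_distrib_right sum.distrib algebra_simps)
  have P3': "(\<Sum>k\<in>UNIV. b i l k * g k j) = (\<Sum>k\<in>UNIV. b j l k * g k i)" for i j l
    using P3[of i j l] by (simp add: sym[of _ i] sym[of _ j] mult.commute)
  have P3'': "(\<Sum>k\<in>UNIV. g l k * b j i k) = (\<Sum>k\<in>UNIV. b l i k * g k j)" for i j l
    using P3[of l j i] by (simp add: sym[of _ j] mult.commute)
  have B'': "(\<Sum>i\<in>UNIV. h i * (\<Sum>k\<in>UNIV. b l i k * B k))
      = (\<Sum>i\<in>UNIV. \<Sum>j\<in>UNIV. h j * ((\<Sum>k\<in>UNIV. b l j k * g k i) * f' i + (\<Sum>k\<in>UNIV. b l j k * \<beta> k i) * f i))"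
    unfolding B' sum_distrib_left by (rule sum.swap)
  show ?one
    unfolding W' A' B'' sum_distrib_left[of "f _"] sum_subtractf[symmetric]
    by (intro sum.cong refl) (simp add: P3'' P4 algebra_simps)
  have T1: "(\<Sum>i\<in>UNIV. \<Sum>k\<in>UNIV. A k * (b i l k * f' i + C l i k * f i)) =
      (\<Sum>i\<in>UNIV. \<Sum>j\<in>UNIV. (\<Sum>k\<in>UNIV. b i l k * g k j) * f' i * h' j + (\<Sum>k\<in>UNIV. b i l k * \<beta> k j) * f' i * h j
        + (\<Sum>k\<in>UNIV. C l i k * g k j) * f i * h' j + (\<Sum>k\<in>UNIV. C l i k * \<beta> k j) * f i * h j)"
  proof (rule sum.cong[OF refl])
    fix i
    have "(\<Sum>k\<in>UNIV. A k * (b i l k * f' i + C l i k * f i)) = (\<Sum>k\<in>UNIV. b i l k * A k) * f' i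
        + (\<Sum>k\<in>UNIV. C l i k * A k) * f i"
      by (simp add: sum_distrib_left sum_distrib_right sum.distrib algebra_simps)
    also have "\<dots> =
      (\<Sum>j\<in>UNIV. (\<Sum>k\<in>UNIV. b i l k * g k j) * f' i * h' j + (\<Sum>k\<in>UNIV. b i l k * \<beta> k j) * f' i * h j
        + (\<Sum>k\<in>UNIV. C l i k * g k j) * f i * h' j + (\<Sum>k\<in>UNIV. C l i k * \<beta> k j) * f i * h j)"
      unfolding A' sum_distrib_right sum.distrib[symmetric]
      by (intro sum.cong refl) (simp add: sum_distrib_left sum_distrib_right sum.distrib algebra_simps)
    finally show "(\<Sum>k\<in>UNIV. A k * (b i l k * f' i + C l i k * f i)) =
      (\<Sum>j\<in>UNIV. (\<Sum>k\<in>UNIV. b i l k * g k j) * f' i * h' j + (\<Sum>k\<in>UNIV. b i l k * \<beta> k j) * f' i * h j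
        + (\<Sum>k\<in>UNIV. C l i k * g k j) * f i * h' j + (\<Sum>k\<in>UNIV. C l i k * \<beta> k j) * f i * h j)" .
  qed
  have T2: "(\<Sum>j\<in>UNIV. \<Sum>k\<in>UNIV. B k * (b j l k * h' j + C l j k * h j)) =
      (\<Sum>i\<in>UNIV. \<Sum>j\<in>UNIV. (\<Sum>k\<in>UNIV. b j l k * g k i) * f' i * h' j + (\<Sum>k\<in>UNIV. b j l k * \<beta> k i) * f i * h' j
        + (\<Sum>k\<in>UNIV. C l j k * g k i) * f' i * h j + (\<Sum>k\<in>UNIV. C l j k * \<beta> k i) * f i * h j)"
  proof (subst (2) sum.swap, rule sum.cong[OF refl])
    fix j
    have "(\<Sum>k\<in>UNIV. B k * (b j l k * h' j + C l j k * h j)) = (\<Sum>k\<in>UNIV. b j l k * B k) * h' j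
        + (\<Sum>k\<in>UNIV. C l j k * B k) * h j"
      by (simp add: sum_distrib_left sum_distrib_right sum.distrib algebra_simps)
    also have "\<dots> =
      (\<Sum>i\<in>UNIV. (\<Sum>k\<in>UNIV. b j l k * g k i) * f' i * h' j + (\<Sum>k\<in>UNIV. b j l k * \<beta> k i) * f i * h' j
        + (\<Sum>k\<in>UNIV. C l j k * g k i) * f' i * h j + (\<Sum>k\<in>UNIV. C l j k * \<beta> k i) * f i * h j)"
      unfolding B' sum_distrib_right sum.distrib[symmetric]
      by (intro sum.cong refl) (simp add: sum_distrib_left sum_distrib_right sum.distrib algebra_simps)
    finally show "(\<Sum>k\<in>UNIV. B k * (b j l k * h' j + C l j k * h j)) =
      (\<Sum>i\<in>UNIV. (\<Sum>k\<in>UNIV. b j l k * g k i) * f' i * h' j + (\<Sum>k\<in>UNIV. b j l k * \<beta> k i) * f i * h' j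
        + (\<Sum>k\<in>UNIV. C l j k * g k i) * f' i * h j + (\<Sum>k\<in>UNIV. C l j k * \<beta> k i) * f i * h j)" .
  qed
  have C1: "(\<Sum>k\<in>UNIV. C l i k * g k j) = (\<Sum>k\<in>UNIV. b j l k * \<beta> k i) - (\<Sum>k\<in>UNIV. b j i k * \<beta> k l)" for i j l
    using P4[of j l i] by (simp add: sym[of _ j] mult.commute)
  have C2: "(\<Sum>k\<in>UNIV. \<beta> k l * C i j k) = (\<Sum>k\<in>UNIV. C l j k * \<beta> k i) - (\<Sum>k\<in>UNIV. C l i k * \<beta> k j)" for i j
    using P5[of l i j] by (simp add: antisym[of l j] sum_negf algebra_simps)
  have comm: "(\<Sum>k\<in>UNIV. \<beta> k l * b i j k) = (\<Sum>k\<in>UNIV. b i j k * \<beta> k l)" for i j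
    by (simp add: mult.commute)
  show ?two
    unfolding W' T1 T2 sum_subtractf[symmetric] sum.distrib[symmetric]
  proof (intro sum.neutral ballI)
    fix i j
    show "(\<Sum>k\<in>UNIV. b i l k * g k j) * f' i * h' j + (\<Sum>k\<in>UNIV. b i l k * \<beta> k j) * f' i * h j
        + (\<Sum>k\<in>UNIV. C l i k * g k j) * f i * h' j + (\<Sum>k\<in>UNIV. C l i k * \<beta> k j) * f i * h j
        - ((\<Sum>k\<in>UNIV. b j l k * g k i) * f' i * h' j + (\<Sum>k\<in>UNIV. b j l k * \<beta> k i) * f i * h' j
        + (\<Sum>k\<in>UNIV. C l j k * g k i) * f' i * h j + (\<Sum>k\<in>UNIV. C l j k * \<beta> k i) * f i * h j)
        + ((\<Sum>k\<in>UNIV. \<beta> k l * b j i k) * f i * h' j - (\<Sum>k\<in>UNIV. \<beta> k l * b i j k) * f' i * h j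
        + (\<Sum>k\<in>UNIV. \<beta> k l * C i j k) * f i * h j) = 0"
      unfolding P3'[of i l j] C1 C2 comm by (simp only: ring_distribs)
  qed
qed


text \<open>
  In matrix notation: \<open>b\<^sup>k g\<close> is symmetric, and \<open>g B^{ij} = b\<^sup>i b\<^sup>j - b\<^sup>j b\<^sup>i\<close> for the curl \<open>B\<close> of \<open>b\<close>.
\<close>

definition hydro_quadratic_conditions ::
    "(real^'n \<Rightarrow> real^'n^'n) \<Rightarrow> ('n \<Rightarrow> 'n \<Rightarrow> 'n \<Rightarrow> real^'n \<Rightarrow> real) \<Rightarrow> real^'n \<Rightarrow> bool" where
  "hydro_quadratic_conditions g b u \<longleftrightarrow>
     (\<forall>i j k. (\<Sum>s\<in>UNIV. g u $ i $ s * b j k s u) = (\<Sum>s\<in>UNIV. g u $ j $ s * b i k s u)) \<and>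
     (\<forall>l i j s. (\<Sum>k\<in>UNIV. g u $ l $ k * curl b i j k s u)
        = (\<Sum>k\<in>UNIV. b l i k u * b k j s u) - (\<Sum>k\<in>UNIV. b l j k u * b k i s u))"

text \<open>
  The coefficient of the products of two undifferentiated covectors; \<open>y\<close> is the value of \<open>u_x\<close>.
\<close>

definition hydro_cyclic_condition ::
    "('n::finite \<Rightarrow> 'n \<Rightarrow> 'n \<Rightarrow> real^'n \<Rightarrow> real) \<Rightarrow> real^'n \<Rightarrow> bool" where
  "hydro_cyclic_condition b u \<longleftrightarrow> (\<forall>i j l y.
     (\<Sum>k\<in>UNIV. (\<Sum>s\<in>UNIV. b k l s u * y $ s) * (\<Sum>s\<in>UNIV. curl b i j k s u * y $ s))
     + (\<Sum>k\<in>UNIV. (\<Sum>s\<in>UNIV. b k j s u * y $ s) * (\<Sum>s\<in>UNIV. curl b l i k s u * y $ s))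
     + (\<Sum>k\<in>UNIV. (\<Sum>s\<in>UNIV. b k i s u * y $ s) * (\<Sum>s\<in>UNIV. curl b j l k s u * y $ s)) = 0)"

lemma sloop_cos: "sloop (\<lambda>x. cos (2 * pi * x))"
proof -
  have D: "((\<lambda>x. a * cos (2 * pi * x) + c * sin (2 * pi * x)) has_real_derivative
      (2 * pi * c) * cos (2 * pi * x) + (- 2 * pi * a) * sin (2 * pi * x)) (at x)" for a c x
    by (auto intro!: derivative_eq_intros)
  have "loop.regs n (\<lambda>x. a * cos (2 * pi * x) + c * sin (2 * pi * x))" for n a c
  proof (induction n arbitrary: a c)
    case (Suc n)
    have "deriv (\<lambda>x. a * cos (2 * pi * x) + c * sin (2 * pi * x))
        = (\<lambda>x. (2 * pi * c) * cos (2 * pi * x) + (- 2 * pi * a) * sin (2 * pi * x))"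
      using D by (intro ext DERIV_imp_deriv)
    moreover have "(\<lambda>x. a * cos (2 * pi * x) + c * sin (2 * pi * x)) differentiable_on UNIV"
      using D[of a c] by (auto simp: differentiable_on_def real_differentiable_def)
    ultimately show ?case using Suc[of "2 * pi * c" "- 2 * pi * a"] by simp
  qed simp
  from this[of _ 1 0] show ?thesis by (simp add: sloop_def loop.smooth_def distrib_left)
qed

context hydro_operator
begin

lemma b_DERIV:
  "u \<in> fields U \<Longrightarrow> ((\<lambda>x. b i j k (u x)) has_real_derivative
    (\<Sum>m\<in>UNIV. pd m (b i j k) (u x) * xderiv u x $ m)) (at x)"
  by (rule phase_fun_DERIV[OF smooth_b])

text \<open>
  The covector \<open>W\<close> of \<open>\<phi>\<close> and \<open>\<psi>\<close> satisfies \<open>g W = \<phi>\<^sub>i b\<^sup>i A\<psi> - \<psi>\<^sub>i b\<^sup>i A\<phi>\<close> along the whole loop. Differentiating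
  this identity instead of \<open>W\<close> expresses \<open>g W'\<close> without second derivatives of \<open>b\<close>, and the derivatives of \<open>A\<phi>\<close>
  and \<open>A\<psi>\<close> cancel against those in the other two terms.
\<close>

lemma jacobiator_eq_0:
  assumes cond: "\<And>u. u \<in> U \<Longrightarrow> hydro_quadratic_conditions g b u" "\<And>u. u \<in> U \<Longrightarrow> hydro_cyclic_condition b u"
    and u: "u \<in> fields U" and \<phi>: "\<phi> \<in> smooth_loops" and \<psi>: "\<psi> \<in> smooth_loops"
  shows "jacobiator g b u \<phi> \<psi> x = 0"
proof -
  note us = fields_smooth[OF u] and uU = fields_in[OF u]
  define \<beta> where "\<beta> x i j = (\<Sum>s\<in>UNIV. b i j s (u x) * xderiv u x $ s)" for x i j
  define C where "C x i j k = (\<Sum>s\<in>UNIV. curl b i j k s (u x) * xderiv u x $ s)" for x i j k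
  let ?A = "hydro_op g b u \<psi>" and ?B = "hydro_op g b u \<phi>" and ?W = "hydro_covector b u \<phi> \<psi>"
  have A: "?A x $ k = (\<Sum>j\<in>UNIV. g (u x) $ k $ j * xderiv \<psi> x $ j + \<beta> x k j * \<psi> x $ j)" for x k
    by (simp add: hydro_op_def \<beta>_def)
  have B: "?B x $ k = (\<Sum>j\<in>UNIV. g (u x) $ k $ j * xderiv \<phi> x $ j + \<beta> x k j * \<phi> x $ j)" for x k
    by (simp add: hydro_op_def \<beta>_def)
  have W: "?W x $ k = (\<Sum>i\<in>UNIV. \<Sum>j\<in>UNIV. b j i k (u x) * \<phi> x $ i * xderiv \<psi> x $ j
      - b i j k (u x) * xderiv \<phi> x $ i * \<psi> x $ j + C x i j k * \<phi> x $ i * \<psi> x $ j)" for x k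
    by (simp add: hydro_covector_def C_def)
  have P3: "(\<Sum>s\<in>UNIV. g (u x) $ i $ s * b j k s (u x)) = (\<Sum>s\<in>UNIV. g (u x) $ j $ s * b i k s (u x))"
      for x i j k
    using cond(1)[OF uU] by (simp add: hydro_quadratic_conditions_def)
  have P4: "(\<Sum>k\<in>UNIV. g (u x) $ l $ k * C x i j k)
      = (\<Sum>k\<in>UNIV. b l i k (u x) * \<beta> x k j) - (\<Sum>k\<in>UNIV. b l j k (u x) * \<beta> x k i)" for x l i j
  proof -
    have "(\<Sum>k\<in>UNIV. g (u x) $ l $ k * C x i j k)
        = (\<Sum>s\<in>UNIV. (\<Sum>k\<in>UNIV. g (u x) $ l $ k * curl b i j k s (u x)) * xderiv u x $ s)"
      unfolding C_def sum_distrib_left sum_distrib_right by (subst sum.swap) (simp add: mult_ac)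
    also have "\<dots> = (\<Sum>s\<in>UNIV. (\<Sum>k\<in>UNIV. b l i k (u x) * b k j s (u x)) * xderiv u x $ s)
        - (\<Sum>s\<in>UNIV. (\<Sum>k\<in>UNIV. b l j k (u x) * b k i s (u x)) * xderiv u x $ s)"
      using cond(1)[OF uU, of x] unfolding hydro_quadratic_conditions_def
      by (simp add: left_diff_distrib sum_subtractf)
    moreover have "(\<Sum>s\<in>UNIV. (\<Sum>k\<in>UNIV. b l i k (u x) * b k j s (u x)) * xderiv u x $ s)
        = (\<Sum>k\<in>UNIV. b l i k (u x) * \<beta> x k j)" for i j
      unfolding \<beta>_def sum_distrib_left sum_distrib_right by (subst sum.swap) (simp add: mult_ac)
    ultimately show ?thesis by simp
  qed
  have P5: "(\<Sum>k\<in>UNIV. \<beta> x k l * C x i j k) + (\<Sum>k\<in>UNIV. \<beta> x k j * C x l i k)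
      + (\<Sum>k\<in>UNIV. \<beta> x k i * C x j l k) = 0" for x i j l
    using cond(2)[OF uU, of x] by (simp add: hydro_cyclic_condition_def \<beta>_def C_def)
  have antisym: "C x j i k = - C x i j k" for x i j k
    by (simp add: C_def curl_antisym[OF uU, where j=j and i=i] sum_negf)
  have one: "(\<Sum>k\<in>UNIV. g (u x) $ l $ k * ?W x $ k) =
        (\<Sum>i\<in>UNIV. \<phi> x $ i * (\<Sum>k\<in>UNIV. b l i k (u x) * ?A x $ k))
        - (\<Sum>i\<in>UNIV. \<psi> x $ i * (\<Sum>k\<in>UNIV. b l i k (u x) * ?B x $ k))" for x l
    by (rule jacobiator_coefficients_cancel(1)[where g="\<lambda>i j. g (u x) $ i $ j" and b="\<lambda>i j k. b i j k (u x)"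
      and \<beta>="\<beta> x" and C="C x" and f="\<lambda>i. \<phi> x $ i" and f'="\<lambda>i. xderiv \<phi> x $ i" and h="\<lambda>i. \<psi> x $ i"
      and h'="\<lambda>i. xderiv \<psi> x $ i" and A="\<lambda>k. ?A x $ k" and B="\<lambda>k. ?B x $ k" and W="\<lambda>k. ?W x $ k"];
        rule sym_g[OF uU] P3 P4 P5 antisym A B W)
  have two: "(\<Sum>i\<in>UNIV. \<Sum>k\<in>UNIV. ?A x $ k * (b i l k (u x) * xderiv \<phi> x $ i + C x l i k * \<phi> x $ i))
       - (\<Sum>j\<in>UNIV. \<Sum>k\<in>UNIV. ?B x $ k * (b j l k (u x) * xderiv \<psi> x $ j + C x l j k * \<psi> x $ j))
       + (\<Sum>k\<in>UNIV. \<beta> x k l * ?W x $ k) = 0" for l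
    by (rule jacobiator_coefficients_cancel(2)[where g="\<lambda>i j. g (u x) $ i $ j" and b="\<lambda>i j k. b i j k (u x)"
      and \<beta>="\<beta> x" and C="C x" and f="\<lambda>i. \<phi> x $ i" and f'="\<lambda>i. xderiv \<phi> x $ i" and h="\<lambda>i. \<psi> x $ i"
      and h'="\<lambda>i. xderiv \<psi> x $ i" and A="\<lambda>k. ?A x $ k" and B="\<lambda>k. ?B x $ k" and W="\<lambda>k. ?W x $ k"];
        rule sym_g[OF uU] P3 P4 P5 antisym A B W)
  have smA: "?A \<in> smooth_loops" and smB: "?B \<in> smooth_loops" and smW: "?W \<in> smooth_loops"
    by (intro smooth_hydro_op smooth_hydro_covector u \<phi> \<psi>)+
  have var: "hydro_op_var g b u v \<eta> x $ l =
      (\<Sum>i\<in>UNIV. xderiv \<eta> x $ i * (\<Sum>k\<in>UNIV. b l i k (u x) * v x $ k)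
        + (\<Sum>k\<in>UNIV. (\<Sum>m\<in>UNIV. pd m (b l i k) (u x) * xderiv u x $ m) * v x $ k
            + xderiv v x $ k * b l i k (u x)) * \<eta> x $ i)
      + (\<Sum>i\<in>UNIV. \<Sum>k\<in>UNIV. v x $ k * (b i l k (u x) * xderiv \<eta> x $ i + C x l i k * \<eta> x $ i))" for v \<eta> l
  proof -
    have C': "(\<Sum>m\<in>UNIV. pd k (b l i m) (u x) * xderiv u x $ m) = C x l i k
        + (\<Sum>m\<in>UNIV. pd m (b l i k) (u x) * xderiv u x $ m)" for i k
      by (simp add: C_def curl_def left_diff_distrib sum_subtractf)
    have "(\<Sum>k\<in>UNIV. (\<Sum>m\<in>UNIV. pd m (b l i k) (u x) * v x $ m) * xderiv u x $ k)
        = (\<Sum>k\<in>UNIV. v x $ k * (\<Sum>m\<in>UNIV. pd k (b l i m) (u x) * xderiv u x $ m))" for i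
      unfolding sum_distrib_left sum_distrib_right by (subst sum.swap) (simp add: mult_ac)
    then have "(\<Sum>k\<in>UNIV. (\<Sum>m\<in>UNIV. pd m (b l i k) (u x) * v x $ m) * xderiv u x $ k)
        = (\<Sum>k\<in>UNIV. v x $ k * C x l i k)
          + (\<Sum>k\<in>UNIV. (\<Sum>m\<in>UNIV. pd m (b l i k) (u x) * xderiv u x $ m) * v x $ k)" for i
      unfolding C' by (simp add: distrib_left sum.distrib mult.commute)
    then show ?thesis
      unfolding hydro_op_var_def vec_lambda_beta pd_g[OF uU] sum.distrib[symmetric]
      by (intro sum.cong refl) (simp add: sum.distrib sum_subtractf sum_distrib_right[of _ _ "\<eta> x $ _"]
          sum_distrib_right[of _ _ "xderiv \<eta> x $ _"] sum_distrib_left[of "xderiv \<eta> x $ _"]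
          sum_distrib_left[of "\<eta> x $ _"] algebra_simps)
  qed
  show ?thesis
  proof (rule vec_eq_iff[THEN iffD2], rule allI)
    fix l
    have "((\<lambda>x. \<Sum>k\<in>UNIV. g (u x) $ l $ k * ?W x $ k) has_real_derivative
        (\<Sum>k\<in>UNIV. (\<beta> x l k + \<beta> x k l) * ?W x $ k + xderiv ?W x $ k * g (u x) $ l $ k)) (at x)"
      unfolding \<beta>_def by (intro DERIV_sum DERIV_mult g_DERIV u smooth_loops_DERIV smW)
    moreover have "((\<lambda>x. \<Sum>k\<in>UNIV. g (u x) $ l $ k * ?W x $ k) has_real_derivative
        (\<Sum>i\<in>UNIV. xderiv \<phi> x $ i * (\<Sum>k\<in>UNIV. b l i k (u x) * ?A x $ k)
          + (\<Sum>k\<in>UNIV. (\<Sum>m\<in>UNIV. pd m (b l i k) (u x) * xderiv u x $ m) * ?A x $ k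
              + xderiv ?A x $ k * b l i k (u x)) * \<phi> x $ i)
        - (\<Sum>i\<in>UNIV. xderiv \<psi> x $ i * (\<Sum>k\<in>UNIV. b l i k (u x) * ?B x $ k)
          + (\<Sum>k\<in>UNIV. (\<Sum>m\<in>UNIV. pd m (b l i k) (u x) * xderiv u x $ m) * ?B x $ k
              + xderiv ?B x $ k * b l i k (u x)) * \<psi> x $ i)) (at x)"
      unfolding one
      by (intro DERIV_diff DERIV_sum DERIV_mult b_DERIV u smooth_loops_DERIV smA smB \<phi> \<psi>)
    ultimately have "(\<Sum>k\<in>UNIV. (\<beta> x l k + \<beta> x k l) * ?W x $ k + xderiv ?W x $ k * g (u x) $ l $ k) =
        (\<Sum>i\<in>UNIV. xderiv \<phi> x $ i * (\<Sum>k\<in>UNIV. b l i k (u x) * ?A x $ k)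
          + (\<Sum>k\<in>UNIV. (\<Sum>m\<in>UNIV. pd m (b l i k) (u x) * xderiv u x $ m) * ?A x $ k
              + xderiv ?A x $ k * b l i k (u x)) * \<phi> x $ i)
        - (\<Sum>i\<in>UNIV. xderiv \<psi> x $ i * (\<Sum>k\<in>UNIV. b l i k (u x) * ?B x $ k)
          + (\<Sum>k\<in>UNIV. (\<Sum>m\<in>UNIV. pd m (b l i k) (u x) * xderiv u x $ m) * ?B x $ k
              + xderiv ?B x $ k * b l i k (u x)) * \<psi> x $ i)"
      by (rule DERIV_unique)
    moreover have "hydro_op g b u ?W x $ l = (\<Sum>k\<in>UNIV. (\<beta> x l k + \<beta> x k l) * ?W x $ k
        + xderiv ?W x $ k * g (u x) $ l $ k)
        - (\<Sum>k\<in>UNIV. \<beta> x k l * ?W x $ k)"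
      by (simp add: hydro_op_def \<beta>_def sum_subtractf[symmetric] algebra_simps)
    moreover note two[of l]
    ultimately show "jacobiator g b u \<phi> \<psi> x $ l = 0 $ l"
      by (simp add: jacobiator_def var)
  qed
qed


lemma rest_point_derivatives:
  assumes u: "u \<in> fields U" and \<phi>: "\<phi> \<in> smooth_loops" and \<psi>: "\<psi> \<in> smooth_loops"
    and rest: "xderiv u x = 0" "xderiv \<phi> x = 0" "xderiv \<psi> x = 0"
  shows "xderiv (hydro_op g b u \<psi>) x $ k = (\<Sum>j\<in>UNIV. g (u x) $ k $ j * xderiv (xderiv \<psi>) x $ j
      + (\<Sum>s\<in>UNIV. b k j s (u x) * xderiv (xderiv u) x $ s) * \<psi> x $ j)"
    and "xderiv (hydro_covector b u \<phi> \<psi>) x $ k = (\<Sum>i\<in>UNIV. \<Sum>j\<in>UNIV.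
      b j i k (u x) * \<phi> x $ i * xderiv (xderiv \<psi>) x $ j - b i j k (u x) * xderiv (xderiv \<phi>) x $ i * \<psi> x $ j
      + (\<Sum>s\<in>UNIV. curl b i j k s (u x) * xderiv (xderiv u) x $ s) * \<phi> x $ i * \<psi> x $ j)"
proof -
  note sm = fields_smooth[OF u] \<phi> \<psi>
  note D = smooth_loops_DERIV[OF sm(1)] smooth_loops_DERIV[OF \<phi>] smooth_loops_DERIV[OF \<psi>]
    smooth_loops_DERIV[OF smooth_loops_xderiv[OF sm(1)]] smooth_loops_DERIV[OF smooth_loops_xderiv[OF \<phi>]]
    smooth_loops_DERIV[OF smooth_loops_xderiv[OF \<psi>]]
  have "((\<lambda>x. hydro_op g b u \<psi> x $ k) has_real_derivative
     (\<Sum>j\<in>UNIV. (((\<Sum>s\<in>UNIV. b k j s (u x) * xderiv u x $ s)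
         + (\<Sum>s\<in>UNIV. b j k s (u x) * xderiv u x $ s)) * xderiv \<psi> x $ j
        + xderiv (xderiv \<psi>) x $ j * g (u x) $ k $ j)
       + ((\<Sum>s\<in>UNIV. (\<Sum>m\<in>UNIV. pd m (b k j s) (u x) * xderiv u x $ m) * xderiv u x $ s
           + xderiv (xderiv u) x $ s * b k j s (u x)) * \<psi> x $ j
        + xderiv \<psi> x $ j * (\<Sum>s\<in>UNIV. b k j s (u x) * xderiv u x $ s)))) (at x)"
    unfolding hydro_op_def vec_lambda_beta
    by (intro DERIV_sum DERIV_add DERIV_mult g_DERIV b_DERIV D u)
  from DERIV_unique[OF smooth_loops_DERIV[OF smooth_hydro_op[OF u \<psi>]] this]
  show "xderiv (hydro_op g b u \<psi>) x $ k = (\<Sum>j\<in>UNIV. g (u x) $ k $ j * xderiv (xderiv \<psi>) x $ j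
      + (\<Sum>s\<in>UNIV. b k j s (u x) * xderiv (xderiv u) x $ s) * \<psi> x $ j)"
    by (simp add: rest mult.commute)
  have curl: "\<exists>D. ((\<lambda>x. curl b i j k s (u x)) has_real_derivative D) (at x)" for i j k s
    unfolding curl_def using phase_fun_DERIV[OF phase_fun.smooth_diff[OF phase_fun.smooth_d[OF smooth_b]
        phase_fun.smooth_d[OF smooth_b]] u]
    by blast
  then obtain C' where C': "((\<lambda>x. curl b i j k s (u x)) has_real_derivative C' i j k s) (at x)" for i j k s
    by metis
  have "((\<lambda>x. hydro_covector b u \<phi> \<psi> x $ k) has_real_derivative
     (\<Sum>i\<in>UNIV. \<Sum>j\<in>UNIV.
       (((\<Sum>m\<in>UNIV. pd m (b j i k) (u x) * xderiv u x $ m) * \<phi> x $ i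
           + xderiv \<phi> x $ i * b j i k (u x)) * xderiv \<psi> x $ j
         + xderiv (xderiv \<psi>) x $ j * (b j i k (u x) * \<phi> x $ i))
       - (((\<Sum>m\<in>UNIV. pd m (b i j k) (u x) * xderiv u x $ m) * xderiv \<phi> x $ i
           + xderiv (xderiv \<phi>) x $ i * b i j k (u x)) * \<psi> x $ j
         + xderiv \<psi> x $ j * (b i j k (u x) * xderiv \<phi> x $ i))
       + ((((\<Sum>s\<in>UNIV. C' i j k s * xderiv u x $ s + xderiv (xderiv u) x $ s * curl b i j k s (u x)) * \<phi> x $ i
            + xderiv \<phi> x $ i * (\<Sum>s\<in>UNIV. curl b i j k s (u x) * xderiv u x $ s)) * \<psi> x $ j)
         + xderiv \<psi> x $ j * ((\<Sum>s\<in>UNIV. curl b i j k s (u x) * xderiv u x $ s) * \<phi> x $ i)))) (at x)"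
    unfolding hydro_covector_def vec_lambda_beta
    by (intro DERIV_sum DERIV_add DERIV_diff DERIV_mult b_DERIV C' D u)
  from DERIV_unique[OF smooth_loops_DERIV[OF smooth_hydro_covector[OF u \<phi> \<psi>]] this]
  show "xderiv (hydro_covector b u \<phi> \<psi>) x $ k = (\<Sum>i\<in>UNIV. \<Sum>j\<in>UNIV.
      b j i k (u x) * \<phi> x $ i * xderiv (xderiv \<psi>) x $ j - b i j k (u x) * xderiv (xderiv \<phi>) x $ i * \<psi> x $ j
      + (\<Sum>s\<in>UNIV. curl b i j k s (u x) * xderiv (xderiv u) x $ s) * \<phi> x $ i * \<psi> x $ j)"
    by (simp add: rest mult_ac)
qed

text \<open>
  At a point where the field and both covectors are stationary, only second derivatives contribute, and
  these can be prescribed freely.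
\<close>

lemma jacobiator_at_rest:
  assumes u: "u \<in> fields U" and \<phi>: "\<phi> \<in> smooth_loops" and \<psi>: "\<psi> \<in> smooth_loops"
    and rest: "xderiv u x = 0" "xderiv \<phi> x = 0" "xderiv \<psi> x = 0"
  shows "jacobiator g b u \<phi> \<psi> x $ l =
      (\<Sum>i\<in>UNIV. (\<Sum>k\<in>UNIV. b l i k (u x) * xderiv (hydro_op g b u \<psi>) x $ k) * \<phi> x $ i)
      - (\<Sum>i\<in>UNIV. (\<Sum>k\<in>UNIV. b l i k (u x) * xderiv (hydro_op g b u \<phi>) x $ k) * \<psi> x $ i)
      - (\<Sum>k\<in>UNIV. g (u x) $ l $ k * xderiv (hydro_covector b u \<phi> \<psi>) x $ k)"
proof -
  have "hydro_op g b u \<psi> x = 0" "hydro_op g b u \<phi> x = 0"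
    by (simp_all add: hydro_op_def rest vec_eq_iff)
  then show ?thesis
    by (simp add: jacobiator_def hydro_op_var_def rest)
      (simp add: hydro_op_def rest)
qed

text \<open>
  Loops \<open>a + (1 - cos (2 \<pi> x)) y\<close> are stationary at \<open>x = 0\<close> with second derivative proportional to \<open>y\<close>. A
  constant field with one varying covector isolates the first condition, a varying field with constant
  covectors the second.
\<close>

lemma jacobiator_zero_imp_quadratic:
  assumes J: "\<And>u \<phi> \<psi> x. u \<in> fields U \<Longrightarrow> \<phi> \<in> smooth_loops \<Longrightarrow> \<psi> \<in> smooth_loops \<Longrightarrow> jacobiator g b u \<phi> \<psi> x = 0"
    and u0: "u0 \<in> U"
  shows "hydro_quadratic_conditions g b u0"
  unfolding hydro_quadratic_conditions_def
proof (intro conjI allI)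
  define w :: "real^'n \<Rightarrow> real^'n \<Rightarrow> real \<Rightarrow> real^'n" where "w a y x = a + (1 - cos (2 * pi * x)) *\<^sub>R y"
      for a y x
  define c where "c = (2 * pi) ^ 2"
  have c: "c \<noteq> 0" by (simp add: c_def)
  have w: "w a y \<in> smooth_loops" for a y
    unfolding w_def smooth_loops_iff by (auto intro!: sloop_intros sloop_cos)
  have w1: "xderiv (w a y) x = (2 * pi * sin (2 * pi * x)) *\<^sub>R y" for a y x
  proof (rule vec_eq_iff[THEN iffD2], rule allI)
    fix i
    have "((\<lambda>x. w a y x $ i) has_real_derivative (2 * pi * sin (2 * pi * x)) * y $ i) (at x)"
      unfolding w_def by (auto intro!: derivative_eq_intros)
    from DERIV_unique[OF smooth_loops_DERIV[OF w] this]
    show "xderiv (w a y) x $ i = ((2 * pi * sin (2 * pi * x)) *\<^sub>R y) $ i" by simp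
  qed
  have w2: "xderiv (xderiv (w a y)) 0 $ i = c * y $ i" for a y i
  proof -
    have "((\<lambda>x. xderiv (w a y) x $ i) has_real_derivative c * y $ i) (at 0)"
      unfolding w1 by (auto intro!: derivative_eq_intros simp: c_def power2_eq_square)
    from DERIV_unique[OF smooth_loops_DERIV[OF smooth_loops_xderiv[OF w]] this] show ?thesis .
  qed
  have w0: "w a y 0 = a" for a y by (simp add: w_def)
  have rest: "xderiv (w a y) 0 = 0" for a y by (simp add: w1)
  have const: "w a 0 \<in> fields U" if "a \<in> U" for a
    using w[of a 0] that by (auto simp: fields_def) (auto simp: w_def)
  note delta = axis_def mult_delta_left mult_delta_right
  show "(\<Sum>s\<in>UNIV. g u0 $ i $ s * b j k s u0) = (\<Sum>s\<in>UNIV. g u0 $ j $ s * b i k s u0)" for i j k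
  proof -
    have "jacobiator g b (w u0 0) (w 0 (axis j 1)) (w (axis k 1) 0) 0 $ i
        = (\<Sum>s\<in>UNIV. g u0 $ i $ s * (b j k s u0 * c)) - (\<Sum>s\<in>UNIV. b i k s u0 * (g u0 $ s $ j * c))"
      unfolding jacobiator_at_rest[OF const[OF u0] w w rest rest rest]
        rest_point_derivatives[OF const[OF u0] w w rest rest rest] w0 w2
      by (simp add: delta sum_negf)
    then have "c * ((\<Sum>s\<in>UNIV. g u0 $ i $ s * b j k s u0) - (\<Sum>s\<in>UNIV. g u0 $ s $ j * b i k s u0)) = 0"
      using J[OF const[OF u0] w w, of 0 "axis j 1" "axis k 1" 0 0]
      by (simp add: right_diff_distrib sum_distrib_left mult_ac)
    then show ?thesis using c by (simp add: sym_g[OF u0, of _ j])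
  qed
  obtain e where e: "e > 0" "ball u0 e \<subseteq> U"
    using u0 open_U by (auto elim: openE)
  show "(\<Sum>k\<in>UNIV. g u0 $ l $ k * curl b i j k s u0)
        = (\<Sum>k\<in>UNIV. b l i k u0 * b k j s u0) - (\<Sum>k\<in>UNIV. b l j k u0 * b k i s u0)" for l i j s
  proof -
    \<comment> \<open>The factor \<open>1 - cos\<close> is at most 2, so the loop stays within distance \<open>2 e / 3\<close> of \<open>u0\<close>.\<close>
    define y :: "real^'n" where "y = (e / 3) *\<^sub>R axis s 1"
    have "w u0 y x \<in> U" for x
    proof -
      have "norm ((1 - cos (2 * pi * x)) *\<^sub>R y) \<le> 2 * (e / 3)"
        using e(1) cos_ge_minus_one[of "2 * pi * x"] cos_le_one[of "2 * pi * x"]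
        by (auto simp: y_def intro!: mult_right_mono)
      then show ?thesis using e by (intro subsetD[OF e(2)]) (simp add: w_def dist_norm)
    qed
    then have u: "w u0 y \<in> fields U" using w by (auto simp: fields_def)
    have "jacobiator g b (w u0 y) (w (axis i 1) 0) (w (axis j 1) 0) 0 $ l
        = (\<Sum>k\<in>UNIV. b l i k u0 * (b k j s u0 * (c * (e / 3))))
            - (\<Sum>k\<in>UNIV. b l j k u0 * (b k i s u0 * (c * (e / 3))))
        - (\<Sum>k\<in>UNIV. g u0 $ l $ k * (curl b i j k s u0 * (c * (e / 3))))"
      unfolding jacobiator_at_rest[OF u w w rest rest rest]
        rest_point_derivatives[OF u w w rest rest rest] w0 w2
      by (simp add: delta y_def)
    then have "c * (e / 3) * ((\<Sum>k\<in>UNIV. b l i k u0 * b k j s u0) - (\<Sum>k\<in>UNIV. b l j k u0 * b k i s u0)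
        - (\<Sum>k\<in>UNIV. g u0 $ l $ k * curl b i j k s u0)) = 0"
      using J[OF u w w, of "axis i 1" 0 "axis j 1" 0 0]
      by (simp add: right_diff_distrib sum_distrib_left mult_ac)
    then show ?thesis using c e(1) by simp
  qed
qed

theorem hamiltonian_imp_quadratic_conditions:
  "hamiltonian U g b \<Longrightarrow> u \<in> U \<Longrightarrow> hydro_quadratic_conditions g b u"
  unfolding hamiltonian_iff_jacobiator by (rule jacobiator_zero_imp_quadratic) auto

theorem hamiltonianI:
  "(\<And>u. u \<in> U \<Longrightarrow> hydro_quadratic_conditions g b u) \<Longrightarrow> (\<And>u. u \<in> U \<Longrightarrow> hydro_cyclic_condition b u)
    \<Longrightarrow> hamiltonian U g b"
  unfolding hamiltonian_iff_jacobiator using jacobiator_eq_0 by blast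

end


section \<open>Flat metrics and their Christoffel symbols\<close>

subsection \<open>Matrix algebra\<close>

lemma matrix_mult_diff_ldistrib: "(A :: real^'n^'m) ** (B - C) = A ** B - A ** C"
  by (simp add: vec_eq_iff matrix_matrix_mult_def sum_subtractf algebra_simps)

lemma matrix_mult_diff_rdistrib: "((A :: real^'n^'m) - B) ** C = A ** C - B ** C"
  by (simp add: vec_eq_iff matrix_matrix_mult_def sum_subtractf algebra_simps)

lemma matrix_mult_add_rdistrib: "((A :: real^'n^'m) + B) ** C = A ** C + B ** C"
  by (simp add: vec_eq_iff matrix_matrix_mult_def sum.distrib algebra_simps)

lemma matrix_mult_uminus_left: "(- (A :: real^'n^'m)) ** C = - (A ** C)"
  by (simp add: vec_eq_iff matrix_matrix_mult_def sum_negf)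

lemma matrix_mult_uminus_right: "(A :: real^'n^'m) ** (- C) = - (A ** C)"
  by (simp add: vec_eq_iff matrix_matrix_mult_def sum_negf)

lemma transpose_add: "transpose ((A :: real^'n^'m) + B) = transpose A + transpose B"
  by (simp add: vec_eq_iff transpose_def)

lemma transpose_diff: "transpose ((A :: real^'n^'m) - B) = transpose A - transpose B"
  by (simp add: vec_eq_iff transpose_def)

lemma transpose_uminus: "transpose (- (A :: real^'n^'m)) = - transpose A"
  by (simp add: vec_eq_iff transpose_def)

lemmas matrix_ring_simps = matrix_mult_diff_ldistrib matrix_mult_diff_rdistrib matrix_mult_add_rdistrib
  matrix_add_ldistrib matrix_mult_uminus_left matrix_mult_uminus_right matrix_mul_assoc
  transpose_add transpose_diff transpose_uminus matrix_transpose_mul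

lemma transpose_nth: "transpose A $ i $ j = A $ j $ i"
  by (simp add: transpose_def)

lemma symmetric_matrix_nth: "transpose A = A \<Longrightarrow> A $ i $ j = A $ j $ i"
  using transpose_nth[of A j i] by simp

lemma matrix_mult_nth: "(A ** B) $ i $ j = (\<Sum>k\<in>UNIV. A $ i $ k * B $ k $ j)"
  by (simp add: matrix_matrix_mult_def)

lemma matrix_inv_left_right:
  fixes A :: "real^'n^'n"
  assumes "det A \<noteq> 0"
  shows "matrix_inv A ** A = mat 1" "A ** matrix_inv A = mat 1"
proof -
  have "\<exists>B. A ** B = mat 1 \<and> B ** A = mat 1"
    using assms by (simp add: invertible_det_nz[symmetric] invertible_def)
  then have "A ** matrix_inv A = mat 1 \<and> matrix_inv A ** A = mat 1"
    unfolding matrix_inv_def by (rule someI_ex)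
  then show "matrix_inv A ** A = mat 1" "A ** matrix_inv A = mat 1" by auto
qed

lemma matrix_left_cancel:
  fixes A :: "real^'n^'n"
  assumes "det A \<noteq> 0"
  shows "A ** X = A ** Y \<longleftrightarrow> X = Y"
  using matrix_inv_left_right(1)[OF assms] by (metis matrix_mul_assoc matrix_mul_lid)

lemma matrix_right_cancel:
  fixes A :: "real^'n^'n"
  assumes "det A \<noteq> 0"
  shows "X ** A = Y ** A \<longleftrightarrow> X = Y"
  using matrix_inv_left_right(2)[OF assms] by (metis matrix_mul_assoc matrix_mul_rid)

lemma symmetric_matrix_inv:
  fixes A :: "real^'n^'n"
  assumes "det A \<noteq> 0" "transpose A = A"
  shows "transpose (matrix_inv A) = matrix_inv A"
proof -
  have "transpose (matrix_inv A) ** A = mat 1"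
    using arg_cong[OF matrix_inv_left_right(2)[OF assms(1)], of transpose] assms(2)
    by (simp add: matrix_transpose_mul)
  then show ?thesis
    using matrix_inv_left_right(1)[OF assms(1)] matrix_right_cancel[OF assms(1)] by metis
qed

text \<open>
  With \<open>S\<^sub>i = G\<^sup>-\<^sup>1 b\<^sub>i\<close>, which is symmetric by \<open>bG\<close>, one has \<open>B\<^sub>i\<^sub>j = S\<^sub>i b\<^sub>j - S\<^sub>j b\<^sub>i\<close>; the six terms \<open>b\<^sub>l y \<sqdot> S\<^sub>i b\<^sub>j y\<close>
  cancel in pairs.
\<close>

lemma cyclic_from_quadratic:
  fixes G :: "real^'n^'n" and b :: "'n \<Rightarrow> real^'n^'n" and B :: "'n \<Rightarrow> 'n \<Rightarrow> real^'n^'n" and y :: "real^'n"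
  assumes det: "det G \<noteq> 0" and sym: "transpose G = G"
    and bG: "\<And>i. transpose (b i ** G) = b i ** G"
    and GB: "\<And>i j. G ** B i j = b i ** b j - b j ** b i"
  shows "(b l *v y) \<bullet> (B i j *v y) + (b j *v y) \<bullet> (B l i *v y) + (b i *v y) \<bullet> (B j l *v y) = 0"
proof -
  let ?H = "matrix_inv G"
  define S where "S i = ?H ** b i" for i
  have "S i = ?H ** (b i ** G) ** ?H" for i
    by (simp add: S_def matrix_inv_left_right[OF det] flip: matrix_mul_assoc)
  then have S: "transpose (S i) = S i" for i
    by (metis S_def bG matrix_mul_assoc matrix_transpose_mul symmetric_matrix_inv[OF det sym])
  have B: "B i j = S i ** b j - S j ** b i" for i j
  proof -
    have "B i j = ?H ** (G ** B i j)"
      by (simp add: matrix_mul_assoc matrix_inv_left_right[OF det])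
    then show ?thesis by (simp add: GB S_def matrix_ring_simps)
  qed
  have swap: "v \<bullet> (S i *v w) = w \<bullet> (S i *v v)" for i v w
    using dot_lmul_matrix[of v "S i" w] S[of i] by (metis inner_commute transpose_matrix_vector)
  show ?thesis
    unfolding B matrix_vector_mult_diff_rdistrib matrix_vector_mul_assoc[symmetric] inner_diff_right
    using swap[of "b l *v y" i "b j *v y"] swap[of "b l *v y" j "b i *v y"] swap[of "b j *v y" l "b i *v y"]
    by simp
qed

subsection \<open>The Levi-Civita connection\<close>

definition christoffel_mat :: "(real^'n \<Rightarrow> real^'n^'n) \<Rightarrow> 'n \<Rightarrow> real^'n \<Rightarrow> real^'n^'n" where
  "christoffel_mat g j u = (\<chi> s k. christoffel g j s k u)"

locale metric = phase_space U for U :: "(real^'n) set" +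
  fixes g :: "real^'n \<Rightarrow> real^'n^'n"
  assumes nondegenerate: "nondegenerate_metric U g"
begin

lemma smooth_metric: "smooth_fun U (\<lambda>u. g u $ i $ j)"
  and metric_sym: "u \<in> U \<Longrightarrow> transpose (g u) = g u"
  and metric_det: "u \<in> U \<Longrightarrow> det (g u) \<noteq> 0"
  using nondegenerate by (auto simp: nondegenerate_metric_def)

lemma metric_sym_nth: "u \<in> U \<Longrightarrow> g u $ i $ j = g u $ j $ i"
  using symmetric_matrix_nth[OF metric_sym] .

lemma smooth_det:
  assumes "\<And>i j. smooth_fun U (\<lambda>u. A u $ i $ j)"
  shows "smooth_fun U (\<lambda>u. det (A u :: real^'n^'n))"
  unfolding det_def by (intro phase_fun.smooth_sum phase_fun.smooth_mult phase_fun.smooth_const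
      phase_fun.smooth_prod assms)

text \<open>
  By Cramer's rule the entries of the inverse are rational in those of the metric, hence smooth.
\<close>

lemma lower_metric_cramer:
  assumes "u \<in> U"
  shows "lower_metric g i j u = det (\<chi> k m. if m = i then axis j 1 $ k else g u $ k $ m) * inverse (det
      (g u))"
proof -
  have "g u *v (matrix_inv (g u) *v axis j 1) = axis j 1"
    by (simp add: matrix_vector_mul_assoc matrix_inv_left_right[OF metric_det[OF assms]])
  then have "matrix_inv (g u) *v axis j 1 = (\<chi> i. det (\<chi> k m. if m
      = i then axis j 1 $ k else g u $ k $ m) / det (g u))"
    using cramer[OF metric_det[OF assms]] by blast
  moreover have "lower_metric g i j u = (matrix_inv (g u) *v axis j 1) $ i"
    by (simp add: lower_metric_def matrix_vector_mult_basis column_def)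
  ultimately show ?thesis by (simp add: divide_inverse)
qed

lemma smooth_lower_metric: "smooth_fun U (lower_metric g i j)"
proof (rule phase_fun.smooth_cong)
  show "smooth_fun U (\<lambda>u. det (\<chi> k m. if m = i then axis j 1 $ k else g u $ k $ m) * inverse (det (g u)))"
  proof (intro phase_fun.smooth_mult smooth_inverse smooth_det smooth_metric metric_det)
    fix k m
    show "smooth_fun U (\<lambda>u. (\<chi> k m. if m = i then axis j 1 $ k else g u $ k $ m) $ k $ m)"
      by (cases "m = i") (simp_all add: phase_fun.smooth_const smooth_metric)
  qed
qed (simp add: lower_metric_cramer)

lemma lower_metric_sym: "u \<in> U \<Longrightarrow> lower_metric g i j u = lower_metric g j i u"
  unfolding lower_metric_def
  using symmetric_matrix_nth[OF symmetric_matrix_inv[OF metric_det metric_sym]] .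

lemma smooth_christoffel: "smooth_fun U (christoffel g j s k)"
  unfolding christoffel_def[abs_def]
  by (intro phase_fun.smooth_intros smooth_metric smooth_lower_metric)

lemma smooth_hydro_coeff: "smooth_fun U (hydro_coeff g i j k)"
  unfolding hydro_coeff_def[abs_def]
  by (intro phase_fun.smooth_intros smooth_metric smooth_christoffel)

lemma christoffel_sym: "u \<in> U \<Longrightarrow> christoffel g j s k u = christoffel g j k s u"
proof -
  assume u: "u \<in> U"
  have "pd l (lower_metric g a b) u = pd l (lower_metric g b a) u" for l a b
    by (rule pd_cong[OF lower_metric_sym u])
  then show ?thesis
    unfolding christoffel_def by (metis (no_types, lifting) add.commute)
qed

lemma christoffel_mat_sym: "u \<in> U \<Longrightarrow> transpose (christoffel_mat g j u) = christoffel_mat g j u"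
  by (simp add: christoffel_mat_def transpose_def vec_eq_iff christoffel_sym)

lemma hydro_coeff_mat: "hydro_coeff g i j k u = - (g u ** christoffel_mat g j u) $ i $ k"
  by (simp add: hydro_coeff_def christoffel_mat_def matrix_mult_nth)

text \<open>
  The connection is metric: \<open>\<partial>g = - g (\<partial>h) g\<close> for the inverse \<open>h\<close>, and \<open>\<partial>\<^sub>k h\<close> is the symmetrization of the
  Christoffel symbols of the first kind.
\<close>

lemma pd_metric:
  assumes u: "u \<in> U"
  shows "pd k (\<lambda>u. g u $ i $ j) u = hydro_coeff g i j k u + hydro_coeff g j i k u"
proof -
  define dG where "dG = (\<chi> i j. pd k (\<lambda>u. g u $ i $ j) u)"
  define dH where "dH = (\<chi> i j. pd k (lower_metric g i j) u)"
  define K where "K = (\<chi> l s. (pd s (lower_metric g l k) u + pd k (lower_metric g s l) u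
      - pd l (lower_metric g s k) u) / 2)"
  let ?G = "g u" and ?H = "matrix_inv (g u)"
  note GH = matrix_inv_left_right[OF metric_det]
  have "dG ** ?H + ?G ** dH = 0"
  proof -
    have "(dG ** ?H + ?G ** dH) $ i $ j = pd k (\<lambda>u. \<Sum>s\<in>UNIV. g u $ i $ s * lower_metric g s j u) u" for i j
      using u by (simp add: phase_fun.d_sum phase_fun.d_mult phase_fun.reg_mult phase_fun.smooth_reg[OF
          smooth_metric] phase_fun.smooth_reg[OF smooth_lower_metric]
          sum.distrib matrix_mult_nth dG_def dH_def lower_metric_def[of g _ _ u])
    also have "pd k (\<lambda>u. \<Sum>s\<in>UNIV. g u $ i $ s * lower_metric g s j u) u = pd k (\<lambda>u. mat 1 $ i $ j) u" for i j
      by (rule pd_cong[OF _ u]) (simp add: lower_metric_def GH(2) flip: matrix_mult_nth)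
    finally show ?thesis using u by (simp add: vec_eq_iff phase_fun.d_const)
  qed
  from arg_cong[OF this, of "\<lambda>A. A ** ?G"] have "dG = - (?G ** dH ** ?G)"
    by (simp add: matrix_ring_simps eq_neg_iff_add_eq_0) (simp add: GH(1)[OF u] flip: matrix_mul_assoc)
  moreover have "dH = K + transpose K"
  proof -
    have "pd l (lower_metric g a b) u = pd l (lower_metric g b a) u" for l a b
      by (rule pd_cong[OF lower_metric_sym u])
    then show ?thesis by (simp add: vec_eq_iff K_def dH_def transpose_def add_divide_distrib
        diff_divide_distrib)
  qed
  moreover have "hydro_coeff g i j k u = - (?G ** transpose K ** ?G) $ i $ j" for i j
  proof -
    have "christoffel g j s k u = (?G ** K) $ j $ s" for s
      by (simp add: christoffel_def matrix_mult_nth K_def sum_divide_distrib)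
    then have "hydro_coeff g i j k u = - (?G ** transpose (?G ** K)) $ i $ j"
      by (simp add: hydro_coeff_def matrix_mult_nth transpose_def)
    then show ?thesis by (simp add: matrix_transpose_mul metric_sym[OF u] matrix_mul_assoc)
  qed
  moreover have "(?G ** transpose K ** ?G) $ j $ i = (?G ** K ** ?G) $ i $ j"
  proof -
    have "transpose (?G ** transpose K ** ?G) = ?G ** K ** ?G"
      by (simp add: matrix_transpose_mul metric_sym[OF u] matrix_mul_assoc)
    from arg_cong[OF this, of "\<lambda>A. A $ i $ j"] show ?thesis by (simp only: transpose_nth)
  qed
  ultimately have "dG $ i $ j = hydro_coeff g i j k u + hydro_coeff g j i k u"
    by (simp add: matrix_ring_simps)
  then show ?thesis by (simp add: dG_def)
qed

sublocale hydro_operator U g "hydro_coeff g"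
  by unfold_locales (auto simp: smooth_metric smooth_hydro_coeff pd_metric metric_sym_nth)

end

locale flat = phase_space U for U :: "(real^'n) set" +
  fixes g :: "real^'n \<Rightarrow> real^'n^'n"
  assumes flat_metric: "flat_metric U g"
begin

sublocale metric U g
  by unfold_locales (use flat_metric in \<open>simp add: flat_metric_def\<close>)

lemma curl_christoffel:
  assumes u: "u \<in> U"
  shows "pd k (christoffel g j p s) u - pd s (christoffel g j p k) u
    = (\<Sum>m\<in>UNIV. christoffel g j s m u * christoffel g m k p u)
        - (\<Sum>m\<in>UNIV. christoffel g j k m u * christoffel g m s p u)"
proof -
  have "riemann g j p k s u = 0" using flat_metric u by (simp add: flat_metric_def)
  moreover have "pd k (christoffel g j s p) u = pd k (christoffel g j p s) u" for k s
    by (rule pd_cong[OF christoffel_sym u])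
  ultimately show ?thesis by (simp add: riemann_def sum_subtractf)
qed

text \<open>
  Flatness eliminates the derivatives of the Christoffel symbols, and the products that contract an upper with
  a lower index of two symbols cancel against those from the derivative of the metric.
\<close>

lemma curl_hydro_coeff:
  assumes u: "u \<in> U"
  shows "curl (hydro_coeff g) i j k s u =
    (christoffel_mat g i u ** g u ** christoffel_mat g j u
        - christoffel_mat g j u ** g u ** christoffel_mat g i u) $ k $ s"
proof -
  let ?\<Gamma> = "\<lambda>j s k. christoffel g j s k u"
  define N where "N k s = (\<Sum>p\<in>UNIV. g u $ i $ p * (\<Sum>m\<in>UNIV. ?\<Gamma> m p k * ?\<Gamma> j m s))" for k s
  have reg: "christoffel g j s k differentiable_on U" "(\<lambda>u. g u $ i $ j) differentiable_on U" for i j s k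
    by (auto intro: phase_fun.smooth_reg smooth_christoffel smooth_metric)
  have pd_b: "pd k (hydro_coeff g i j s) u
      = - (\<Sum>p\<in>UNIV. pd k (\<lambda>u. g u $ i $ p) u * ?\<Gamma> j p s)
          - (\<Sum>p\<in>UNIV. g u $ i $ p * pd k (christoffel g j p s) u)" for k s
    unfolding hydro_coeff_def[abs_def]
    by (simp add: phase_fun.d_uminus phase_fun.d_sum phase_fun.d_mult phase_fun.reg_sum
        phase_fun.reg_mult reg u sum.distrib)
  have pd_g\<Gamma>: "- (\<Sum>p\<in>UNIV. pd k (\<lambda>u. g u $ i $ p) u * ?\<Gamma> j p s)
      = N k s + (christoffel_mat g i u ** g u ** christoffel_mat g j u) $ k $ s" for k s
  proof -
    have "- (\<Sum>p\<in>UNIV. pd k (\<lambda>u. g u $ i $ p) u * ?\<Gamma> j p s)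
       = (\<Sum>p\<in>UNIV. (\<Sum>q\<in>UNIV. g u $ i $ q * ?\<Gamma> p q k) * ?\<Gamma> j p s)
           + (\<Sum>p\<in>UNIV. (\<Sum>q\<in>UNIV. g u $ p $ q * ?\<Gamma> i q k) * ?\<Gamma> j p s)"
      unfolding pd_metric[OF u] by (simp add: hydro_coeff_def left_diff_distrib sum_subtractf sum_negf)
    moreover have "(\<Sum>p\<in>UNIV. (\<Sum>q\<in>UNIV. g u $ i $ q * ?\<Gamma> p q k) * ?\<Gamma> j p s) = N k s"
      unfolding N_def sum_distrib_left sum_distrib_right by (subst sum.swap) (simp add: mult_ac)
    moreover have "(\<Sum>p\<in>UNIV. (\<Sum>q\<in>UNIV. g u $ p $ q * ?\<Gamma> i q k) * ?\<Gamma> j p s)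
        = (christoffel_mat g i u ** g u ** christoffel_mat g j u) $ k $ s"
    proof -
      have "(\<Sum>q\<in>UNIV. g u $ p $ q * ?\<Gamma> i q k) = (christoffel_mat g i u ** g u) $ k $ p" for p
        unfolding matrix_mult_nth christoffel_mat_def
        by (intro sum.cong refl) (simp add: metric_sym_nth[OF u, of p] christoffel_sym[OF u, of i k])
      then show ?thesis by (simp add: matrix_mult_nth[of "christoffel_mat g i u ** g u"]) (simp add:
          christoffel_mat_def)
    qed
    ultimately show ?thesis by simp
  qed
  have "(\<Sum>p\<in>UNIV. g u $ i $ p * pd k (christoffel g j p s) u)
      - (\<Sum>p\<in>UNIV. g u $ i $ p * pd s (christoffel g j p k) u)
     = (\<Sum>p\<in>UNIV. g u $ i $ p * ((\<Sum>m\<in>UNIV. ?\<Gamma> j s m * ?\<Gamma> m k p) - (\<Sum>m\<in>UNIV. ?\<Gamma> j k m * ?\<Gamma> m s p)))"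
    by (simp add: sum_subtractf[symmetric] right_diff_distrib[symmetric] curl_christoffel[OF u])
  also have "\<dots> = N k s - N s k"
    unfolding N_def sum_subtractf[symmetric] right_diff_distrib[symmetric]
    by (intro sum.cong refl arg_cong[where f="(*) _"] arg_cong2[where f="(-)"])
      (simp_all add: christoffel_sym[OF u, of j s] christoffel_sym[OF u, of j k]
        christoffel_sym[OF u, of _ s] christoffel_sym[OF u, of _ k] mult.commute)
  finally have "(\<Sum>p\<in>UNIV. g u $ i $ p * pd k (christoffel g j p s) u)
      - (\<Sum>p\<in>UNIV. g u $ i $ p * pd s (christoffel g j p k) u) = N k s - N s k" .
  moreover have "(christoffel_mat g i u ** g u ** christoffel_mat g j u) $ s $ k
      = (christoffel_mat g j u ** g u ** christoffel_mat g i u) $ k $ s"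
    using transpose_nth[of "christoffel_mat g j u ** g u ** christoffel_mat g i u" s k]
    by (simp add: matrix_transpose_mul metric_sym[OF u] christoffel_mat_sym[OF u] matrix_mul_assoc)
  ultimately show ?thesis
    unfolding curl_def pd_b pd_g\<Gamma> by simp
qed

lemma metric_quadratic_conditions:
  assumes u: "u \<in> U"
  shows "hydro_quadratic_conditions g (hydro_coeff g) u"
  unfolding hydro_quadratic_conditions_def
proof (intro conjI allI)
  fix i j k
  have "(\<Sum>s\<in>UNIV. g u $ i $ s * hydro_coeff g j k s u) =
      - (g u ** christoffel_mat g k u ** g u) $ j $ i" for i j
    by (simp add: hydro_coeff_mat matrix_mult_nth[of "g u ** christoffel_mat g k u"] sum_negf
        metric_sym_nth[OF u, of i] mult.commute)
  moreover have "transpose (g u ** christoffel_mat g k u ** g u) = g u ** christoffel_mat g k u ** g u"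
    by (simp add: matrix_transpose_mul metric_sym[OF u] christoffel_mat_sym[OF u] matrix_mul_assoc)
  ultimately show "(\<Sum>s\<in>UNIV. g u $ i $ s * hydro_coeff g j k s u)
      = (\<Sum>s\<in>UNIV. g u $ j $ s * hydro_coeff g i k s u)"
    using symmetric_matrix_nth by simp
next
  fix l i j s
  have "(\<Sum>k\<in>UNIV. hydro_coeff g l i k u * hydro_coeff g k j s u)
      = (g u ** christoffel_mat g i u ** (g u ** christoffel_mat g j u)) $ l $ s" for i j
    by (simp add: hydro_coeff_mat matrix_mult_nth[of "g u ** christoffel_mat g i u"])
  moreover have "(\<Sum>k\<in>UNIV. g u $ l $ k * curl (hydro_coeff g) i j k s u)
      = (g u ** (christoffel_mat g i u ** g u ** christoffel_mat g j u
          - christoffel_mat g j u ** g u ** christoffel_mat g i u)) $ l $ s"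
    by (simp add: curl_hydro_coeff[OF u] matrix_mult_nth[of "g u"])
  ultimately show "(\<Sum>k\<in>UNIV. g u $ l $ k * curl (hydro_coeff g) i j k s u)
      = (\<Sum>k\<in>UNIV. hydro_coeff g l i k u * hydro_coeff g k j s u)
          - (\<Sum>k\<in>UNIV. hydro_coeff g l j k u * hydro_coeff g k i s u)"
    by (simp add: matrix_ring_simps)
qed

end

lemma quadratic_imp_cyclic:
  fixes g :: "real^'n \<Rightarrow> real^'n^'n"
  assumes "hydro_quadratic_conditions g b u" "det (g u) \<noteq> 0" "transpose (g u) = g u"
  shows "hydro_cyclic_condition b u"
proof -
  define bm where "bm i = (\<chi> l k. b l i k u)" for i
  define B where "B i j = (\<chi> k s. curl b i j k s u)" for i j
  have sym: "g u $ i $ j = g u $ j $ i" for i j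
    by (rule symmetric_matrix_nth[OF assms(3)])
  have "transpose (bm k ** g u) = bm k ** g u" for k
    using assms(1) unfolding hydro_quadratic_conditions_def
    by (simp add: vec_eq_iff transpose_def matrix_mult_nth bm_def sym[of _ i for i] mult.commute)
  moreover have "g u ** B i j = bm i ** bm j - bm j ** bm i" for i j
    using assms(1) unfolding hydro_quadratic_conditions_def
    by (simp add: vec_eq_iff matrix_mult_nth bm_def B_def)
  ultimately have "(bm l *v y) \<bullet> (B i j *v y) + (bm j *v y) \<bullet> (B l i *v y) + (bm i *v y) \<bullet> (B j l *v y)
      = 0" for i j l y
    by (rule cyclic_from_quadratic[OF assms(2,3)])
  then show ?thesis
    unfolding hydro_cyclic_condition_def
    by (simp add: inner_vec_def matrix_vector_mult_def bm_def B_def)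
qed


section \<open>Pencils of flat metrics\<close>

lemma scaleR_matrix_mult: "(c *\<^sub>R A) ** (B :: real^'k^'n) = c *\<^sub>R (A ** B)"
  by (simp add: vec_eq_iff matrix_mult_nth sum_distrib_left mult_ac)

lemma matrix_mult_scaleR: "(A :: real^'n^'m) ** (c *\<^sub>R B) = c *\<^sub>R (A ** B)"
  by (simp add: vec_eq_iff matrix_mult_nth sum_distrib_left mult_ac)

lemmas matrix_algebra_simps = matrix_ring_simps scaleR_matrix_mult matrix_mult_scaleR transpose_scalar

text \<open>
  The coefficients of \<open>1\<close> and of \<open>c\<^sup>2\<close> are symmetric, so only the mixed terms contribute.
\<close>

lemma pencil_symmetry_defect:
  fixes G Gt \<Gamma> \<Gamma>t :: "real^'n^'n" and c :: real
  assumes sym: "transpose G = G" "transpose Gt = Gt" "transpose \<Gamma> = \<Gamma>" "transpose \<Gamma>t = \<Gamma>t"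
  defines "X \<equiv> - (Gt ** \<Gamma>t + c *\<^sub>R (G ** \<Gamma>)) ** (Gt + c *\<^sub>R G)"
  shows "transpose X - X = c *\<^sub>R (Gt ** (\<Gamma>t - \<Gamma>) ** G - G ** (\<Gamma>t - \<Gamma>) ** Gt)"
  unfolding X_def by (simp add: matrix_algebra_simps sym algebra_simps)

text \<open>
  The coefficients of \<open>1\<close> and of \<open>c\<^sup>2\<close> cancel; the hypotheses turn the mixed terms into the commutator.
\<close>

lemma pencil_curvature_defect:
  fixes G Gt \<Gamma>i \<Gamma>ti \<Gamma>j \<Gamma>tj :: "real^'n^'n" and c :: real
  defines "bi \<equiv> - (Gt ** \<Gamma>ti + c *\<^sub>R (G ** \<Gamma>i))" and "bj \<equiv> - (Gt ** \<Gamma>tj + c *\<^sub>R (G ** \<Gamma>j))"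
  assumes i: "Gt ** (\<Gamma>ti - \<Gamma>i) ** G = G ** (\<Gamma>ti - \<Gamma>i) ** Gt"
    and j: "Gt ** (\<Gamma>tj - \<Gamma>j) ** G = G ** (\<Gamma>tj - \<Gamma>j) ** Gt"
  shows "(Gt + c *\<^sub>R G) ** ((\<Gamma>ti ** Gt ** \<Gamma>tj - \<Gamma>tj ** Gt ** \<Gamma>ti) + c *\<^sub>R (\<Gamma>i ** G ** \<Gamma>j - \<Gamma>j ** G ** \<Gamma>i))
      - (bi ** bj - bj ** bi)
    = c *\<^sub>R (G ** ((\<Gamma>ti - \<Gamma>i) ** Gt ** (\<Gamma>tj - \<Gamma>j) - (\<Gamma>tj - \<Gamma>j) ** Gt ** (\<Gamma>ti - \<Gamma>i)))"
proof -
  have "(Gt + c *\<^sub>R G) ** ((\<Gamma>ti ** Gt ** \<Gamma>tj - \<Gamma>tj ** Gt ** \<Gamma>ti) + c *\<^sub>R (\<Gamma>i ** G ** \<Gamma>j - \<Gamma>j ** G ** \<Gamma>i))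
      - (bi ** bj - bj ** bi)
    = c *\<^sub>R ((G ** (\<Gamma>ti - \<Gamma>i) ** Gt ** \<Gamma>tj - Gt ** (\<Gamma>ti - \<Gamma>i) ** G ** \<Gamma>j)
           - (G ** (\<Gamma>tj - \<Gamma>j) ** Gt ** \<Gamma>ti - Gt ** (\<Gamma>tj - \<Gamma>j) ** G ** \<Gamma>i))"
    unfolding bi_def bj_def by (simp add: matrix_algebra_simps algebra_simps)
  then show ?thesis unfolding i j by (simp add: matrix_algebra_simps)
qed

lemma quadratic_conditions_matrix:
  fixes g :: "real^'n \<Rightarrow> real^'n^'n" and b :: "'n \<Rightarrow> 'n \<Rightarrow> 'n \<Rightarrow> real^'n \<Rightarrow> real"
  assumes "transpose (g u) = g u"
  defines "bm \<equiv> \<lambda>i. \<chi> l k. b l i k u" and "B \<equiv> \<lambda>i j. \<chi> k s. curl b i j k s u"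
  shows "hydro_quadratic_conditions g b u \<longleftrightarrow>
    (\<forall>k. transpose (bm k ** g u) = bm k ** g u) \<and> (\<forall>i j. g u ** B i j = bm i ** bm j - bm j ** bm i)"
proof -
  have sym: "g u $ i $ j = g u $ j $ i" for i j
    by (rule symmetric_matrix_nth[OF assms(1)])
  have "(\<Sum>s\<in>UNIV. g u $ i $ s * b j k s u) = (bm k ** g u) $ j $ i" for i j k
    by (simp add: matrix_mult_nth bm_def sym[of _ i] mult.commute)
  moreover have "(\<Sum>k\<in>UNIV. g u $ l $ k * curl b i j k s u) = (g u ** B i j) $ l $ s" for i j l s
    by (simp add: matrix_mult_nth B_def)
  moreover have "(\<Sum>k\<in>UNIV. b l i k u * b k j s u) = (bm i ** bm j) $ l $ s" for i j l s
    by (simp add: matrix_mult_nth bm_def)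
  ultimately show ?thesis
    unfolding hydro_quadratic_conditions_def vec_eq_iff transpose_nth
    by (auto simp: eq_commute)
qed

locale flat_pair = phase_space U for U :: "(real^'n) set" +
  fixes g gt :: "real^'n \<Rightarrow> real^'n^'n"
  assumes flat_g: "flat_metric U g" and flat_gt: "flat_metric U gt"
begin

sublocale G: flat U g by unfold_locales (rule flat_g)
sublocale T: flat U gt by unfold_locales (rule flat_gt)

abbreviation pencil :: "real \<Rightarrow> real^'n \<Rightarrow> real^'n^'n" where
  "pencil c \<equiv> (\<lambda>u. gt u + c *\<^sub>R g u)"

abbreviation pencil_coeff :: "real \<Rightarrow> 'n \<Rightarrow> 'n \<Rightarrow> 'n \<Rightarrow> real^'n \<Rightarrow> real" where
  "pencil_coeff c \<equiv> (\<lambda>i j k u. hydro_coeff gt i j k u + c * hydro_coeff g i j k u)"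

definition conn_diff :: "'n \<Rightarrow> real^'n \<Rightarrow> real^'n^'n" where
  "conn_diff j u = christoffel_mat gt j u - christoffel_mat g j u"

text \<open>
  The condition equivalent to vanishing of the Nijenhuis tensor.
\<close>

definition conn_symmetric :: "real^'n \<Rightarrow> bool" where
  "conn_symmetric u \<longleftrightarrow> (\<forall>k. gt u ** conn_diff k u ** g u = g u ** conn_diff k u ** gt u)"

definition conn_commute :: "real^'n \<Rightarrow> bool" where
  "conn_commute u \<longleftrightarrow>
    (\<forall>i j. conn_diff i u ** gt u ** conn_diff j u = conn_diff j u ** gt u ** conn_diff i u)"

lemma hydro_operator_pencil: "hydro_operator U (pencil c) (pencil_coeff c)"
proof
  fix i j k
  show "smooth_fun U (\<lambda>u. pencil c u $ i $ j)"
    by (simp add: phase_fun.smooth_intros G.smooth_metric T.smooth_metric)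
  show "smooth_fun U (pencil_coeff c i j k)"
    by (intro phase_fun.smooth_intros G.smooth_hydro_coeff T.smooth_hydro_coeff)
  fix u assume u: "u \<in> U"
  show "pencil c u $ i $ j = pencil c u $ j $ i"
    by (simp add: G.metric_sym_nth[OF u, of i j] T.metric_sym_nth[OF u, of i j])
  show "pd k (\<lambda>u. pencil c u $ i $ j) u = pencil_coeff c i j k u + pencil_coeff c j i k u"
    by (simp add: phase_fun.d_add phase_fun.d_mult phase_fun.d_const phase_fun.reg_mult
        phase_fun.reg_const phase_fun.smooth_reg[OF G.smooth_metric]
        phase_fun.smooth_reg[OF T.smooth_metric] u G.pd_metric T.pd_metric algebra_simps)
qed

lemma curl_pencil:
  assumes u: "u \<in> U"
  shows "curl (pencil_coeff c) i j k s u = curl (hydro_coeff gt) i j k s u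
      + c * curl (hydro_coeff g) i j k s u"
  by (simp add: curl_def phase_fun.d_add phase_fun.d_mult phase_fun.d_const phase_fun.reg_mult
      phase_fun.reg_const u
      phase_fun.smooth_reg[OF G.smooth_hydro_coeff] phase_fun.smooth_reg[OF T.smooth_hydro_coeff]
          algebra_simps)

lemma pencil_quadratic_conditions:
  assumes u: "u \<in> U"
  shows "hydro_quadratic_conditions (pencil c) (pencil_coeff c) u \<longleftrightarrow> c = 0 \<or> conn_symmetric u \<and> conn_commute u"
proof -
  let ?\<Gamma> = "\<lambda>j. christoffel_mat g j u" and ?\<Gamma>t = "\<lambda>j. christoffel_mat gt j u"
  note sym = G.metric_sym[OF u] T.metric_sym[OF u] G.christoffel_mat_sym[OF u] T.christoffel_mat_sym[OF u]
  have b: "(\<chi> l k. pencil_coeff c l i k u) = - (gt u ** ?\<Gamma>t i + c *\<^sub>R (g u ** ?\<Gamma> i))" for i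
    by (simp add: vec_eq_iff G.hydro_coeff_mat T.hydro_coeff_mat)
  have B: "(\<chi> k s. curl (pencil_coeff c) i j k s u) = (?\<Gamma>t i ** gt u ** ?\<Gamma>t j - ?\<Gamma>t j ** gt u ** ?\<Gamma>t i)
      + c *\<^sub>R (?\<Gamma> i ** g u ** ?\<Gamma> j - ?\<Gamma> j ** g u ** ?\<Gamma> i)" for i j
    by (simp add: vec_eq_iff curl_pencil[OF u] G.curl_hydro_coeff[OF u] T.curl_hydro_coeff[OF u])
  have "transpose (pencil c u) = pencil c u"
    by (simp add: transpose_add transpose_scalar sym)
  note iff = quadratic_conditions_matrix[where b="pencil_coeff c" and g="pencil c"
      and u=u, OF this, unfolded b B]
  \<comment> \<open>Both conditions become the vanishing of a defect that is divisible by \<open>c\<close>.\<close>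
  have 1: "transpose X = X \<longleftrightarrow> transpose X - X = 0" for X :: "real^'n^'n" by simp
  have 2: "X = Y \<longleftrightarrow> X - Y = 0" for X Y :: "real^'n^'n" by simp
  show ?thesis
  proof (cases "c = 0 \<or> conn_symmetric u")
    case True
    then show ?thesis
    proof (cases "c = 0")
      case False
      with True have s: "gt u ** (?\<Gamma>t k - ?\<Gamma> k) ** g u = g u ** (?\<Gamma>t k - ?\<Gamma> k) ** gt u" for k
        by (simp add: conn_symmetric_def conn_diff_def)
      have "g u ** X = 0 \<longleftrightarrow> X = 0" for X :: "real^'n^'n"
        using matrix_left_cancel[OF G.metric_det[OF u], of X 0] by simp
      with False True show ?thesis
        unfolding iff 1 pencil_symmetry_defect[OF sym]
        unfolding 2[of "pencil c u ** _"] pencil_curvature_defect[OF s s]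
        by (simp add: s conn_commute_def conn_diff_def)
    next
      case True
      then show ?thesis
        using T.metric_quadratic_conditions[OF u] by simp
    qed
  next
    case False
    then have "\<not> (\<forall>k. c *\<^sub>R (gt u ** (?\<Gamma>t k - ?\<Gamma> k) ** g u - g u ** (?\<Gamma>t k - ?\<Gamma> k) ** gt u) = 0)"
      by (auto simp: conn_symmetric_def conn_diff_def)
    with False show ?thesis
      unfolding iff 1 pencil_symmetry_defect[OF sym] by blast
  qed
qed

text \<open>
  The left-hand side is a quadratic polynomial in \<open>c\<close> whose extreme coefficients vanish, since both metrics
  satisfy the condition. As \<open>gt\<close> is invertible, so is \<open>gt + c g\<close> for some small \<open>c \<noteq> 0\<close>, and there the
  condition holds as well; hence the middle coefficient vanishes.
\<close>

lemma pencil_cyclic_condition: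
  assumes u: "u \<in> U" and "conn_symmetric u" "conn_commute u"
  shows "hydro_cyclic_condition (pencil_coeff c) u"
proof -
  have cont: "isCont (\<lambda>c. det (pencil c u)) 0"
    unfolding det_def by (simp, intro continuous_intros)
  have "\<forall>\<^sub>F c in at 0. det (pencil c u) \<noteq> 0"
    using tendsto_imp_eventually_ne[OF cont[unfolded isCont_def]] T.metric_det[OF u] by simp
  moreover have "\<forall>\<^sub>F c :: real in at 0. c \<noteq> 0" by (simp add: eventually_at_filter)
  ultimately have "\<forall>\<^sub>F c in at 0. det (pencil c u) \<noteq> 0 \<and> c \<noteq> 0" by (rule eventually_conj)
  then obtain c0 where c0: "det (pencil c0 u) \<noteq> 0" "c0 \<noteq> 0"
    using eventually_happens'[OF at_neq_bot] by blast
  have "transpose (pencil c0 u) = pencil c0 u"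
    by (simp add: transpose_add transpose_scalar G.metric_sym[OF u] T.metric_sym[OF u])
  then have 1: "hydro_cyclic_condition (pencil_coeff c0) u"
    using quadratic_imp_cyclic[of "pencil c0"] pencil_quadratic_conditions[OF u] assms c0(1) by blast
  have 2: "hydro_cyclic_condition (hydro_coeff g) u"
    by (rule quadratic_imp_cyclic[OF G.metric_quadratic_conditions[OF u] G.metric_det[OF u]
        G.metric_sym[OF u]])
  have 3: "hydro_cyclic_condition (hydro_coeff gt) u"
    by (rule quadratic_imp_cyclic[OF T.metric_quadratic_conditions[OF u] T.metric_det[OF u]
        T.metric_sym[OF u]])
  show ?thesis
    unfolding hydro_cyclic_condition_def
  proof (intro allI)
    fix i j l y
    define P where "P b B l i j = (\<Sum>k\<in>UNIV. (\<Sum>s\<in>UNIV. b k l s u * y $ s) * (\<Sum>s\<in>UNIV. curl B i j k s u *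
        y $ s))" for b B and l i j :: 'n
    let ?b = "hydro_coeff g" and ?bt = "hydro_coeff gt"
    have product: "(\<Sum>k\<in>UNIV. (p k + c * q k) * (p' k + c * q' k))
        = (\<Sum>k\<in>UNIV. p k * p' k) + c * ((\<Sum>k\<in>UNIV. p k * q' k) + (\<Sum>k\<in>UNIV. q k * p' k))
            + c^2 * (\<Sum>k\<in>UNIV. q k * q' k)"
      for p q p' q' :: "'n \<Rightarrow> real" and c
      by (simp add: sum.distrib sum_distrib_left power2_eq_square algebra_simps)
    have expand: "P (pencil_coeff c) (pencil_coeff c) l i j
        = P ?bt ?bt l i j + c * (P ?bt ?b l i j + P ?b ?bt l i j) + c^2 * P ?b ?b l i j" for c l i j
    proof -
      have b: "(\<Sum>s\<in>UNIV. pencil_coeff c k l s u * y $ s) = (\<Sum>s\<in>UNIV. ?bt k l s u * y $ s)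
          + c * (\<Sum>s\<in>UNIV. ?b k l s u * y $ s)" for k
        by (simp add: sum.distrib sum_distrib_left algebra_simps)
      have B: "(\<Sum>s\<in>UNIV. curl (pencil_coeff c) i j k s u * y $ s)
          = (\<Sum>s\<in>UNIV. curl ?bt i j k s u * y $ s) + c * (\<Sum>s\<in>UNIV. curl ?b i j k s u * y $ s)" for k
        by (simp add: curl_pencil[OF u] sum.distrib sum_distrib_left algebra_simps)
      show ?thesis
        unfolding P_def b B by (rule product)
    qed
    have "P (pencil_coeff c0) (pencil_coeff c0) l i j + P (pencil_coeff c0) (pencil_coeff c0) j l i
        + P (pencil_coeff c0) (pencil_coeff c0) i j l = 0"
      using 1 by (simp only: hydro_cyclic_condition_def P_def)
    moreover have gg: "P ?b ?b l i j + P ?b ?b j l i + P ?b ?b i j l = 0"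
      using 2 by (simp only: hydro_cyclic_condition_def P_def)
    moreover have tt: "P ?bt ?bt l i j + P ?bt ?bt j l i + P ?bt ?bt i j l = 0"
      using 3 by (simp only: hydro_cyclic_condition_def P_def)
    moreover define X where "X = (P ?bt ?b l i j + P ?b ?bt l i j) + (P ?bt ?b j l i + P ?b ?bt j l i)
        + (P ?bt ?b i j l + P ?b ?bt i j l)"
    moreover have tot: "P (pencil_coeff c) (pencil_coeff c) l i j + P (pencil_coeff c) (pencil_coeff c) j l i
        + P (pencil_coeff c) (pencil_coeff c) i j l = (P ?bt ?bt l i j + P ?bt ?bt j l i + P ?bt ?bt i j l)
          + c * X + c^2 * (P ?b ?b l i j + P ?b ?b j l i + P ?b ?b i j l)" for c
      unfolding expand X_def by (simp add: algebra_simps)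
    ultimately have "X = 0" using c0(2) tot[of c0] by simp
    with tot[of c] gg tt have "P (pencil_coeff c) (pencil_coeff c) l i j
        + P (pencil_coeff c) (pencil_coeff c) j l i + P (pencil_coeff c) (pencil_coeff c) i j l = 0" by simp
    then show "(\<Sum>k\<in>UNIV. (\<Sum>s\<in>UNIV. pencil_coeff c k l s u * y $ s) * (\<Sum>s\<in>UNIV. curl (pencil_coeff c) i j
        k s u * y $ s))
     + (\<Sum>k\<in>UNIV. (\<Sum>s\<in>UNIV. pencil_coeff c k j s u * y $ s) * (\<Sum>s\<in>UNIV. curl (pencil_coeff c) l i k s u *
         y $ s))
     + (\<Sum>k\<in>UNIV. (\<Sum>s\<in>UNIV. pencil_coeff c k i s u * y $ s) * (\<Sum>s\<in>UNIV. curl (pencil_coeff c) j l k s u *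
         y $ s)) = 0"
      unfolding P_def .
  qed
qed

theorem compatible_iff_conn:
  "compatible U g (hydro_coeff g) gt (hydro_coeff gt) \<longleftrightarrow> (\<forall>u\<in>U. conn_symmetric u \<and> conn_commute u)"
proof
  assume "compatible U g (hydro_coeff g) gt (hydro_coeff gt)"
  then have "hamiltonian U (pencil 1) (pencil_coeff 1)"
    unfolding compatible_def by blast
  note ham = hydro_operator.hamiltonian_imp_quadratic_conditions[OF hydro_operator_pencil this]
  show "\<forall>u\<in>U. conn_symmetric u \<and> conn_commute u"
  proof
    fix u assume u: "u \<in> U"
    show "conn_symmetric u \<and> conn_commute u"
      using iffD1[OF pencil_quadratic_conditions[OF u] ham[OF u]] by simp
  qed
next
  assume conn: "\<forall>u\<in>U. conn_symmetric u \<and> conn_commute u"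
  have "hamiltonian U (pencil c) (pencil_coeff c)" for c
    by (rule hydro_operator.hamiltonianI[OF hydro_operator_pencil])
      (use conn in \<open>simp_all add: pencil_quadratic_conditions pencil_cyclic_condition\<close>)
  moreover have "hamiltonian U g (hydro_coeff g)"
    by (rule G.hamiltonianI[OF G.metric_quadratic_conditions])
      (auto intro: quadratic_imp_cyclic[OF G.metric_quadratic_conditions G.metric_det G.metric_sym])
  moreover have "hamiltonian U gt (hydro_coeff gt)"
    by (rule T.hamiltonianI[OF T.metric_quadratic_conditions])
      (auto intro: quadratic_imp_cyclic[OF T.metric_quadratic_conditions T.metric_det T.metric_sym])
  ultimately show "compatible U g (hydro_coeff g) gt (hydro_coeff gt)"
    by (simp add: compatible_def)
qed

end


section \<open>The Nijenhuis tensor of the affinor\<close>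

context flat_pair
begin

abbreviation aff :: "'n \<Rightarrow> 'n \<Rightarrow> real^'n \<Rightarrow> real" where "aff \<equiv> affinor g gt"

definition affinor_mat :: "real^'n \<Rightarrow> real^'n^'n" where
  "affinor_mat u = (\<chi> i j. aff i j u)"

lemma affinor_mat_eq: "affinor_mat u = gt u ** matrix_inv (g u)"
  by (simp add: affinor_mat_def affinor_def lower_metric_def vec_eq_iff matrix_mult_nth)

lemma affinor_mat_mult: "u \<in> U \<Longrightarrow> affinor_mat u ** g u = gt u"
  by (simp add: affinor_mat_eq matrix_inv_left_right[OF G.metric_det] flip: matrix_mul_assoc)

lemma affinor_contract: "u \<in> U \<Longrightarrow> (\<Sum>b\<in>UNIV. aff i b u * g u $ b $ k) = gt u $ i $ k"
  using affinor_mat_mult[of u] by (simp add: affinor_mat_def matrix_mult_nth vec_eq_iff)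

lemma affinor_contract_mat:
  fixes A :: "real^'n^'n"
  assumes "u \<in> U"
  shows "(\<Sum>b\<in>UNIV. aff i b u * (g u ** A) $ b $ k) = (gt u ** A) $ i $ k"
proof -
  have "(\<Sum>b\<in>UNIV. aff i b u * (g u ** A) $ b $ k) = (affinor_mat u ** (g u ** A)) $ i $ k"
    unfolding matrix_mult_nth[of "affinor_mat u"] by (simp add: affinor_mat_def)
  then show ?thesis by (simp add: matrix_mul_assoc affinor_mat_mult[OF assms])
qed

lemma affinor_up_gt: "u \<in> U \<Longrightarrow> affinor_up g gt i j u = gt u $ i $ j"
  by (rule affinor_up_eq[OF G.metric_det])

lemma affinor_inj:
  assumes u: "u \<in> U" and zero: "\<And>i. (\<Sum>s\<in>UNIV. aff i s u * y s) = 0"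
  shows "y s = 0"
proof -
  have "affinor_mat u *v (\<chi> s. y s) = 0"
    using zero by (simp add: vec_eq_iff matrix_vector_mult_def affinor_mat_def)
  moreover have "det (affinor_mat u) \<noteq> 0"
    using arg_cong[OF affinor_mat_mult[OF u], of det] T.metric_det[OF u] by (auto simp: det_mul)
  ultimately have "(\<chi> s. y s) = (0 :: real^'n)"
    using matrix_inv_left_right(1)[of "affinor_mat u"]
    by (metis matrix_vector_mul_assoc matrix_vector_mul_lid matrix_vector_mult_0_right)
  then show ?thesis by (simp add: vec_eq_iff)
qed

lemma raise_index_inj:
  assumes u: "u \<in> U" and zero: "\<And>c. (\<Sum>k\<in>UNIV. y k * g u $ k $ c) = 0"
  shows "y k = 0"
proof -
  have "g u *v (\<chi> k. y k) = 0"
    using zero by (simp add: vec_eq_iff matrix_vector_mult_def G.metric_sym_nth[OF u] mult.commute)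
  then have "(\<chi> s. y s) = (0 :: real^'n)"
    using matrix_inv_left_right(1)[OF G.metric_det[OF u]]
    by (metis matrix_vector_mul_assoc matrix_vector_mul_lid matrix_vector_mult_0_right)
  then show ?thesis by (simp add: vec_eq_iff)
qed

lemma smooth_affinor: "smooth_fun U (aff i j)"
  unfolding affinor_def[abs_def]
  by (intro phase_fun.smooth_intros T.smooth_metric G.smooth_lower_metric)

lemma pd_metric_mat:
  assumes u: "u \<in> U"
  shows "pd m (\<lambda>u. g u $ i $ k) u = - (g u ** christoffel_mat g k u) $ i $ m
      - (g u ** christoffel_mat g i u) $ k $ m"
    and "pd m (\<lambda>u. gt u $ i $ k) u = - (gt u ** christoffel_mat gt k u) $ i $ m
        - (gt u ** christoffel_mat gt i u) $ k $ m"
  by (simp_all add: G.pd_metric[OF u] T.pd_metric[OF u] G.hydro_coeff_mat T.hydro_coeff_mat)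

text \<open>
  Differentiating \<open>r g = gt\<close> gives the derivative of the affinor without derivatives of the inverse metric.
\<close>

lemma pd_affinor_raised:
  assumes u: "u \<in> U"
  shows "(\<Sum>b\<in>UNIV. pd m (aff i b) u * g u $ b $ k) =
    - (gt u ** conn_diff k u) $ i $ m - (gt u ** christoffel_mat gt i u) $ k $ m
    + (\<Sum>b\<in>UNIV. aff i b u * (g u ** christoffel_mat g b u) $ k $ m)"
proof -
  have "pd m (\<lambda>u. gt u $ i $ k) u = pd m (\<lambda>u. \<Sum>b\<in>UNIV. aff i b u * g u $ b $ k) u"
    by (rule pd_cong[OF _ u]) (simp add: affinor_contract)
  also have "\<dots> = (\<Sum>b\<in>UNIV. pd m (aff i b) u * g u $ b $ k) + (\<Sum>b\<in>UNIV. aff i b u * pd m (\<lambda>u. g u $ b $ k) u)"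
    by (simp add: phase_fun.d_sum phase_fun.d_mult phase_fun.reg_mult phase_fun.smooth_reg[OF
        smooth_affinor] phase_fun.smooth_reg[OF G.smooth_metric] u sum.distrib)
  also have "(\<Sum>b\<in>UNIV. aff i b u * pd m (\<lambda>u. g u $ b $ k) u)
      = - (gt u ** christoffel_mat g k u) $ i $ m - (\<Sum>b\<in>UNIV. aff i b u * (g u ** christoffel_mat g b u)
          $ k $ m)"
    by (simp add: pd_metric_mat[OF u] right_diff_distrib sum_subtractf sum_negf affinor_contract_mat[OF u])
  finally show ?thesis
    by (simp add: pd_metric_mat[OF u] conn_diff_def matrix_mult_diff_ldistrib)
qed

text \<open>
  The tensor \<open>- S^{jsk}\<close> with \<open>j\<close>, \<open>k\<close> as matrix indices.
\<close>

definition conn_up :: "'n \<Rightarrow> real^'n \<Rightarrow> real^'n^'n" where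
  "conn_up s u = gt u ** conn_diff s u ** g u"

lemma conn_diff_sym: "u \<in> U \<Longrightarrow> transpose (conn_diff s u) = conn_diff s u"
  by (simp add: conn_diff_def transpose_diff G.christoffel_mat_sym T.christoffel_mat_sym)

lemma transpose_conn_up: "u \<in> U \<Longrightarrow> transpose (conn_up s u) = g u ** conn_diff s u ** gt u"
  by (simp add: conn_up_def matrix_transpose_mul conn_diff_sym G.metric_sym T.metric_sym matrix_mul_assoc)

lemma conn_symmetric_iff: "u \<in> U \<Longrightarrow> conn_symmetric u \<longleftrightarrow> (\<forall>s. transpose (conn_up s u) = conn_up s u)"
  by (auto simp: conn_symmetric_def transpose_conn_up) (auto simp: conn_up_def)

text \<open>
  Raising both lower indices replaces \<open>r g\<close> by \<open>gt\<close>. Christoffel symbols between two copies of the same metric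
  are symmetric in \<open>j\<close>, \<open>k\<close> and drop out; the others combine to differences of the two connections.
\<close>

lemma nijenhuis_raised:
  assumes u: "u \<in> U"
  shows "(\<Sum>a\<in>UNIV. \<Sum>b\<in>UNIV. nijenhuis aff i a b u * (g u $ a $ j * g u $ b $ k)) =
    (\<Sum>s\<in>UNIV. aff i s u * (conn_up s u $ k $ j - conn_up s u $ j $ k + conn_up k u $ s $ j
        - conn_up k u $ j $ s
      + conn_up j u $ k $ s - conn_up j u $ s $ k))"
proof -
  define X where "X i k m = (\<Sum>b\<in>UNIV. pd m (aff i b) u * g u $ b $ k)" for i k m
  let ?g = "g u" and ?gt = "gt u" and ?\<Gamma> = "\<lambda>s. christoffel_mat g s u" and ?\<Gamma>t = "\<lambda>s. christoffel_mat gt s u"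
  have gs: "?g $ a $ b = ?g $ b $ a" and gts: "?gt $ a $ b = ?gt $ b $ a" for a b
    using G.metric_sym_nth[OF u] T.metric_sym_nth[OF u] by auto
  have swap3: "(\<Sum>a\<in>UNIV. \<Sum>b\<in>UNIV. (\<Sum>s\<in>UNIV. f a b s) * c a b) = (\<Sum>s\<in>UNIV. \<Sum>a\<in>UNIV. \<Sum>b\<in>UNIV. f a b s * c a b)"
    for f :: "'n \<Rightarrow> 'n \<Rightarrow> 'n \<Rightarrow> real" and c :: "'n \<Rightarrow> 'n \<Rightarrow> real"
  proof -
    have "(\<Sum>a\<in>UNIV. \<Sum>b\<in>UNIV. (\<Sum>s\<in>UNIV. f a b s) * c a b) = (\<Sum>a\<in>UNIV. \<Sum>s\<in>UNIV. \<Sum>b\<in>UNIV. f a b s * c a b)"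
      unfolding sum_distrib_right by (intro sum.cong refl sum.swap)
    also have "\<dots> = (\<Sum>s\<in>UNIV. \<Sum>a\<in>UNIV. \<Sum>b\<in>UNIV. f a b s * c a b)" by (rule sum.swap)
    finally show ?thesis .
  qed
  have "(\<Sum>a\<in>UNIV. \<Sum>b\<in>UNIV. nijenhuis aff i a b u * (?g $ a $ j * ?g $ b $ k))
    = (\<Sum>s\<in>UNIV. \<Sum>a\<in>UNIV. \<Sum>b\<in>UNIV.
        (aff s a u * pd s (aff i b) u - aff s b u * pd s (aff i a) u - aff i s u * (pd a (aff s b) u
            - pd b (aff s a) u))
          * (?g $ a $ j * ?g $ b $ k))"
    unfolding nijenhuis_def by (rule swap3)
  also have "\<dots> = (\<Sum>s\<in>UNIV. (\<Sum>a\<in>UNIV. aff s a u * ?g $ a $ j) * X i k s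
      - (\<Sum>b\<in>UNIV. aff s b u * ?g $ b $ k) * X i j s
      - aff i s u * ((\<Sum>a\<in>UNIV. ?g $ a $ j * X s k a) - (\<Sum>b\<in>UNIV. ?g $ b $ k * X s j b)))"
  proof (rule sum.cong[OF refl])
    fix s
    have 1: "(\<Sum>a\<in>UNIV. aff s a u * ?g $ a $ j) * X i k s
        = (\<Sum>a\<in>UNIV. \<Sum>b\<in>UNIV. aff s a u * pd s (aff i b) u * (?g $ a $ j * ?g $ b $ k))"
      unfolding X_def sum_product by (simp add: mult_ac)
    have 2: "(\<Sum>b\<in>UNIV. aff s b u * ?g $ b $ k) * X i j s
        = (\<Sum>a\<in>UNIV. \<Sum>b\<in>UNIV. aff s b u * pd s (aff i a) u * (?g $ a $ j * ?g $ b $ k))"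
      unfolding X_def sum_product by (subst sum.swap) (simp add: mult_ac)
    have 3: "(\<Sum>a\<in>UNIV. ?g $ a $ j * X s k a) = (\<Sum>a\<in>UNIV. \<Sum>b\<in>UNIV. pd a (aff s b) u * (?g $ a $ j * ?g $
        b $ k))"
      unfolding X_def sum_distrib_left by (simp add: mult_ac)
    have 4: "(\<Sum>b\<in>UNIV. ?g $ b $ k * X s j b) = (\<Sum>a\<in>UNIV. \<Sum>b\<in>UNIV. pd b (aff s a) u * (?g $ a $ j * ?g $
        b $ k))"
      unfolding X_def sum_distrib_left by (subst sum.swap) (simp add: mult_ac)
    show "(\<Sum>a\<in>UNIV. \<Sum>b\<in>UNIV.
        (aff s a u * pd s (aff i b) u - aff s b u * pd s (aff i a) u - aff i s u * (pd a (aff s b) u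
            - pd b (aff s a) u))
          * (?g $ a $ j * ?g $ b $ k)) = (\<Sum>a\<in>UNIV. aff s a u * ?g $ a $ j) * X i k s
              - (\<Sum>b\<in>UNIV. aff s b u * ?g $ b $ k) * X i j s
      - aff i s u * ((\<Sum>a\<in>UNIV. ?g $ a $ j * X s k a) - (\<Sum>b\<in>UNIV. ?g $ b $ k * X s j b))"
      unfolding 1 2 3 4 sum_subtractf[symmetric] sum_distrib_left[of "aff i s u"]
      by (intro sum.cong refl) (simp add: algebra_simps)
  qed
  also have "\<dots> = (\<Sum>s\<in>UNIV. ?gt $ s $ j * X i k s) - (\<Sum>s\<in>UNIV. ?gt $ s $ k * X i j s)
      - (\<Sum>s\<in>UNIV. aff i s u * ((\<Sum>a\<in>UNIV. ?g $ a $ j * X s k a) - (\<Sum>b\<in>UNIV. ?g $ b $ k * X s j b)))"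
    by (simp add: affinor_contract[OF u] sum_subtractf)
  also have contract: "(\<Sum>s\<in>UNIV. A $ s $ j * X i k s) = - (?gt ** conn_diff k u ** A) $ i $ j
      - (?gt ** ?\<Gamma>t i ** A) $ k $ j
      + (\<Sum>b\<in>UNIV. aff i b u * (?g ** ?\<Gamma> b ** A) $ k $ j)" for A :: "real^'n^'n" and i j k
  proof -
    have "(\<Sum>s\<in>UNIV. A $ s $ j * (\<Sum>b\<in>UNIV. aff i b u * (?g ** ?\<Gamma> b) $ k $ s))
        = (\<Sum>b\<in>UNIV. aff i b u * (?g ** ?\<Gamma> b ** A) $ k $ j)"
      unfolding matrix_mult_nth[of "?g ** ?\<Gamma> _" A] sum_distrib_left by (subst sum.swap) (simp add: mult_ac)
    then show ?thesis
      unfolding X_def pd_affinor_raised[OF u]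
      by (simp add: matrix_mult_nth[of "?gt ** conn_diff k u" A] matrix_mult_nth[of "?gt ** ?\<Gamma>t i" A]
          distrib_left right_diff_distrib sum.distrib sum_subtractf sum_negf mult.commute)
  qed
  have t: "(?g ** ?\<Gamma> s ** ?gt) $ k $ j = (?gt ** ?\<Gamma> s ** ?g) $ j $ k" "(?gt ** ?\<Gamma>t s ** ?gt) $ k $ j
      = (?gt ** ?\<Gamma>t s ** ?gt) $ j $ k"
    "(?g ** ?\<Gamma> s ** ?g) $ k $ j = (?g ** ?\<Gamma> s ** ?g) $ j $ k" for s j k
    by (subst transpose_nth[symmetric], simp add: matrix_transpose_mul G.metric_sym[OF u] T.metric_sym[OF u]
        G.christoffel_mat_sym[OF u] T.christoffel_mat_sym[OF u] matrix_mul_assoc)+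
  have e: "(?gt ** conn_diff k u ** ?gt) $ i $ j = (\<Sum>s\<in>UNIV. aff i s u * conn_up k u $ j $ s)" for k i j
  proof -
    have "conn_up k u $ j $ s = (?g ** (conn_diff k u ** ?gt)) $ s $ j" for s
      using transpose_conn_up[OF u, of k] by (metis matrix_mul_assoc transpose_nth)
    then have "(\<Sum>s\<in>UNIV. aff i s u * conn_up k u $ j $ s)
        = (\<Sum>s\<in>UNIV. aff i s u * (?g ** (conn_diff k u ** ?gt)) $ s $ j)"
      by (simp only:)
    then show ?thesis unfolding affinor_contract_mat[OF u] by (simp add: matrix_mul_assoc)
  qed
  have f: "(\<Sum>s\<in>UNIV. ?g $ s $ j * X i k s) - (\<Sum>s\<in>UNIV. ?g $ s $ k * X i j s)
      = - conn_up k u $ i $ j + conn_up j u $ i $ k - (?gt ** ?\<Gamma>t i ** ?g) $ k $ j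
          + (?gt ** ?\<Gamma>t i ** ?g) $ j $ k" for i j k
    unfolding contract t(3)[of _ k j] conn_up_def[symmetric] by simp
  have m: "conn_up s u = ?gt ** ?\<Gamma>t s ** ?g - ?gt ** ?\<Gamma> s ** ?g" for s
    by (simp add: conn_up_def conn_diff_def matrix_ring_simps)
  have "(\<Sum>s\<in>UNIV. ?gt $ s $ j * X i k s) - (\<Sum>s\<in>UNIV. ?gt $ s $ k * X i j s)
      - (\<Sum>s\<in>UNIV. aff i s u * ((\<Sum>a\<in>UNIV. ?g $ a $ j * X s k a) - (\<Sum>b\<in>UNIV. ?g $ b $ k * X s j b)))
    = - (\<Sum>s\<in>UNIV. aff i s u * conn_up k u $ j $ s) + (\<Sum>s\<in>UNIV. aff i s u * (?gt ** ?\<Gamma> s ** ?g) $ j $ k)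
      + (\<Sum>s\<in>UNIV. aff i s u * conn_up j u $ k $ s) - (\<Sum>s\<in>UNIV. aff i s u * (?gt ** ?\<Gamma> s ** ?g) $ k $ j)
      - (\<Sum>s\<in>UNIV. aff i s u * (- conn_up k u $ s $ j + conn_up j u $ s $ k
          - (?gt ** ?\<Gamma>t s ** ?g) $ k $ j + (?gt ** ?\<Gamma>t s ** ?g) $ j $ k))"
    unfolding f unfolding contract e t(1) by (simp add: t(2)[of i k j])
  also have "\<dots> = (\<Sum>s\<in>UNIV. aff i s u * (conn_up s u $ k $ j - conn_up s u $ j $ k + conn_up k u $ s $ j
      - conn_up k u $ j $ s
      + conn_up j u $ k $ s - conn_up j u $ s $ k))"
    unfolding sum_negf[symmetric] sum_subtractf[symmetric] sum.distrib[symmetric]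
    by (intro sum.cong refl) (simp add: m[of s for s] algebra_simps)
  finally show ?thesis .
qed

text \<open>
  Let \<open>a\<^sub>s\<close> be the antisymmetric part of the \<open>s\<close>-th matrix. The expression in \<open>nijenhuis_raised\<close> is
  \<open>a\<^sub>s\<^sub>k\<^sub>j + a\<^sub>k\<^sub>s\<^sub>j + a\<^sub>j\<^sub>k\<^sub>s\<close>. Exchanging \<open>s\<close> and \<open>k\<close> only changes the sign of the last term, which therefore
  vanishes if the expression vanishes for all indices.
\<close>

lemma nijenhuis_iff_conn_symmetric:
  assumes u: "u \<in> U"
  shows "(\<forall>i j k. nijenhuis aff i j k u = 0) \<longleftrightarrow> conn_symmetric u"
proof
  assume N: "\<forall>i j k. nijenhuis aff i j k u = 0"
  define a where "a s j k = conn_up s u $ j $ k - conn_up s u $ k $ j" for s j k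
  have Y: "a s k j + a k s j + a j k s = 0" for s j k
  proof -
    have "conn_up s u $ k $ j - conn_up s u $ j $ k + conn_up k u $ s $ j - conn_up k u $ j $ s
        + conn_up j u $ k $ s - conn_up j u $ s $ k = 0"
      by (rule affinor_inj[OF u]) (use nijenhuis_raised[OF u] N in simp)
    then show ?thesis by (simp add: a_def)
  qed
  have "a s j k = 0" for s j k
  proof -
    have "a s j k = - a s k j" "a j k s = - a j s k" "a k s j = - a k j s" by (simp_all add: a_def)
    with Y[of s k j] Y[of s j k] Y[of j k s] Y[of k s j] Y[of j s k] show ?thesis by linarith
  qed
  then show "conn_symmetric u"
    by (simp add: conn_symmetric_iff[OF u] vec_eq_iff transpose_nth a_def)
next
  assume "conn_symmetric u"
  then have M: "conn_up s u $ j $ k = conn_up s u $ k $ j" for s j k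
    by (simp add: conn_symmetric_iff[OF u] symmetric_matrix_nth)
  show "\<forall>i j k. nijenhuis aff i j k u = 0"
  proof (intro allI)
    fix i a b
    have raised: "(\<Sum>a\<in>UNIV. (\<Sum>b\<in>UNIV. nijenhuis aff i a b u * g u $ b $ k) * g u $ a $ j) = 0" for j k
    proof -
      have "(\<Sum>a\<in>UNIV. (\<Sum>b\<in>UNIV. nijenhuis aff i a b u * g u $ b $ k) * g u $ a $ j)
        = (\<Sum>s\<in>UNIV. aff i s u * (conn_up s u $ k $ j - conn_up s u $ j $ k + conn_up k u $ s $ j
            - conn_up k u $ j $ s
          + conn_up j u $ k $ s - conn_up j u $ s $ k))"
        unfolding nijenhuis_raised[OF u, symmetric] by (simp add: sum_distrib_left sum_distrib_right mult_ac)
      also have "\<dots> = 0"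
      proof (intro sum.neutral ballI)
        fix s
        show "aff i s u * (conn_up s u $ k $ j - conn_up s u $ j $ k + conn_up k u $ s $ j
            - conn_up k u $ j $ s
          + conn_up j u $ k $ s - conn_up j u $ s $ k) = 0"
          unfolding M[of s k j] M[of k s j] M[of j k s] by simp
      qed
      finally show ?thesis .
    qed
    have "(\<Sum>b\<in>UNIV. nijenhuis aff i a b u * g u $ b $ k) = 0" for a k
      by (rule raise_index_inj[OF u]) (rule raised)
    then show "nijenhuis aff i a b u = 0"
      by (rule raise_index_inj[OF u])
  qed
qed


section \<open>The coefficients of the second operator\<close>

lemma cov20_affinor_up:
  assumes u: "u \<in> U"
  shows "cov20 g (affinor_up g gt) k i j u = - (gt u ** conn_diff j u) $ i $ k
      - (gt u ** conn_diff i u) $ j $ k"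
proof -
  have "pd k (affinor_up g gt i j) u = pd k (\<lambda>u. gt u $ i $ j) u"
    by (rule pd_cong[OF _ u]) (simp add: affinor_up_gt)
  moreover have "(\<Sum>s\<in>UNIV. christoffel g i k s u * gt u $ s $ j)
      = (gt u ** christoffel_mat g i u) $ j $ k" for i j
    unfolding matrix_mult_nth
    by (intro sum.cong refl) (simp add: christoffel_mat_def G.christoffel_sym[OF u, of i k]
        T.metric_sym_nth[OF u, of j])
  moreover have "(\<Sum>s\<in>UNIV. christoffel g i k s u * gt u $ j $ s)
      = (gt u ** christoffel_mat g i u) $ j $ k" for i j
    unfolding matrix_mult_nth
    by (intro sum.cong refl) (simp add: christoffel_mat_def G.christoffel_sym[OF u, of i k])
  ultimately show ?thesis
    by (simp add: cov20_def affinor_up_gt[OF u] pd_metric_mat[OF u] conn_diff_def matrix_mult_diff_ldistrib)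
qed

lemma cov11_affinor_raised:
  assumes u: "u \<in> U"
  shows "(\<Sum>j\<in>UNIV. cov11 g aff m i j u * g u $ j $ c) = - (gt u ** conn_diff c u) $ i $ m
      - (gt u ** conn_diff i u) $ c $ m"
proof -
  have "(\<Sum>j\<in>UNIV. (\<Sum>s\<in>UNIV. christoffel g i m s u * aff s j u) * g u $ j $ c)
      = (\<Sum>s\<in>UNIV. christoffel g i m s u * (\<Sum>j\<in>UNIV. aff s j u * g u $ j $ c))"
    unfolding sum_distrib_left sum_distrib_right by (subst sum.swap) (simp add: mult_ac)
  also have "\<dots> = (gt u ** christoffel_mat g i u) $ c $ m"
    unfolding affinor_contract[OF u] matrix_mult_nth
    by (intro sum.cong refl) (simp add: christoffel_mat_def G.christoffel_sym[OF u, of i m]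
        T.metric_sym_nth[OF u, of c])
  finally have 1: "(\<Sum>j\<in>UNIV. (\<Sum>s\<in>UNIV. christoffel g i m s u * aff s j u) * g u $ j $ c)
      = (gt u ** christoffel_mat g i u) $ c $ m" .
  have "(\<Sum>j\<in>UNIV. (\<Sum>s\<in>UNIV. christoffel g s m j u * aff i s u) * g u $ j $ c)
      = (\<Sum>s\<in>UNIV. aff i s u * (\<Sum>j\<in>UNIV. christoffel g s m j u * g u $ j $ c))"
    unfolding sum_distrib_left sum_distrib_right by (subst sum.swap) (simp add: mult_ac)
  moreover have "(\<Sum>j\<in>UNIV. christoffel g s m j u * g u $ j $ c)
      = (g u ** christoffel_mat g s u) $ c $ m" for s
    unfolding matrix_mult_nth
    by (intro sum.cong refl) (simp add: christoffel_mat_def G.christoffel_sym[OF u, of s m]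
        G.metric_sym_nth[OF u, of c])
  ultimately have 2: "(\<Sum>j\<in>UNIV. (\<Sum>s\<in>UNIV. christoffel g s m j u * aff i s u) * g u $ j $ c)
      = (\<Sum>s\<in>UNIV. aff i s u * (g u ** christoffel_mat g s u) $ c $ m)" by simp
  show ?thesis
    unfolding cov11_def left_diff_distrib distrib_right sum.distrib sum_subtractf 1 2 pd_affinor_raised[OF u]
    by (simp add: conn_diff_def matrix_mult_diff_ldistrib)
qed

lemma covup11_affinor_raised:
  assumes u: "u \<in> U"
  shows "(\<Sum>k\<in>UNIV. covup11 g aff a i k u * g u $ k $ c) = - conn_up c u $ i $ a - conn_up i u $ c $ a"
proof -
  have "(\<Sum>k\<in>UNIV. covup11 g aff a i k u * g u $ k $ c)
      = (\<Sum>m\<in>UNIV. g u $ a $ m * (\<Sum>k\<in>UNIV. cov11 g aff m i k u * g u $ k $ c))"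
    unfolding covup11_def sum_distrib_left sum_distrib_right by (subst sum.swap) (simp add: mult_ac)
  also have "\<dots> = (\<Sum>m\<in>UNIV. (- (gt u ** conn_diff c u) $ i $ m
      - (gt u ** conn_diff i u) $ c $ m) * g u $ m $ a)"
    unfolding cov11_affinor_raised[OF u] by (simp add: G.metric_sym_nth[OF u, of a] mult.commute)
  also have "\<dots> = - conn_up c u $ i $ a - conn_up i u $ c $ a"
    by (simp add: conn_up_def matrix_mult_nth[of "gt u ** _"] left_diff_distrib sum_subtractf sum_negf)
  finally show ?thesis .
qed

text \<open>
  With the last index raised, both sides are combinations of the matrices \<open>conn_up\<close>, and symmetry of these
  matrices leaves \<open>- 2 conn_up j\<close> from the three covariant derivatives.
\<close>

lemma second_coefficients:
  assumes u: "u \<in> U" and "conn_symmetric u"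
  shows "2 * hydro_coeff gt i j k u = covup11 g aff i j k u - covup11 g aff j i k u
      + cov20 g (affinor_up g gt) k i j u
    + 2 * (\<Sum>s\<in>UNIV. hydro_coeff g s j k u * aff i s u)"
proof -
  define y where "y k = 2 * hydro_coeff gt i j k u - (covup11 g aff i j k u - covup11 g aff j i k u
      + cov20 g (affinor_up g gt) k i j u
    + 2 * (\<Sum>s\<in>UNIV. hydro_coeff g s j k u * aff i s u))" for k
  have M: "conn_up s u $ j $ k = conn_up s u $ k $ j" for s j k
    using assms by (simp add: conn_symmetric_iff symmetric_matrix_nth)
  have bt: "(\<Sum>k\<in>UNIV. hydro_coeff gt i j k u * g u $ k $ c) =
      - (gt u ** christoffel_mat gt j u ** g u) $ i $ c" for c
    by (simp add: T.hydro_coeff_mat matrix_mult_nth[of "gt u ** _"] sum_negf)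
  have "(\<Sum>s\<in>UNIV. hydro_coeff g s j k u * aff i s u) = - (gt u ** christoffel_mat g j u) $ i $ k" for k
    using affinor_contract_mat[OF u, of i "christoffel_mat g j u" k]
        by (simp add: G.hydro_coeff_mat sum_negf mult.commute)
  then have b: "(\<Sum>k\<in>UNIV. (\<Sum>s\<in>UNIV. hydro_coeff g s j k u * aff i s u) * g u $ k $ c) =
      - (gt u ** christoffel_mat g j u ** g u) $ i $ c" for c
    by (simp add: matrix_mult_nth[of "gt u ** _"] sum_negf)
  have c20: "(\<Sum>k\<in>UNIV. cov20 g (affinor_up g gt) k i j u * g u $ k $ c) = - conn_up j u $ i $ c
      - conn_up i u $ j $ c" for c
    by (simp add: cov20_affinor_up[OF u] conn_up_def matrix_mult_nth[of "gt u ** _"] left_diff_distrib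
        sum_subtractf sum_negf)
  have "y k = 0"
  proof (rule raise_index_inj[OF u])
    fix c
    have "(\<Sum>k\<in>UNIV. y k * g u $ k $ c) = 2 * (\<Sum>k\<in>UNIV. hydro_coeff gt i j k u * g u $ k $ c)
      - ((\<Sum>k\<in>UNIV. covup11 g aff i j k u * g u $ k $ c) - (\<Sum>k\<in>UNIV. covup11 g aff j i k u * g u $ k $ c)
        + (\<Sum>k\<in>UNIV. cov20 g (affinor_up g gt) k i j u * g u $ k $ c)
        + 2 * (\<Sum>k\<in>UNIV. (\<Sum>s\<in>UNIV. hydro_coeff g s j k u * aff i s u) * g u $ k $ c))"
      unfolding y_def
      by (simp add: sum_distrib_left sum_distrib_right sum.distrib sum_subtractf algebra_simps)
    also have "\<dots> = 0"
      unfolding bt b c20 covup11_affinor_raised[OF u]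
      using M[of c i j] M[of j i c] M[of i j c]
      by (simp add: conn_up_def conn_diff_def matrix_ring_simps)
    finally show "(\<Sum>k\<in>UNIV. y k * g u $ k $ c) = 0" .
  qed
  then show ?thesis by (simp add: y_def)
qed

end


section \<open>The second-order condition\<close>

text \<open>
  The covariant derivative of a tensor with two upper indices and one lower index, listed in this order.
\<close>

definition cov21 :: "(real^'n \<Rightarrow> real^'n^'n) \<Rightarrow> ('n \<Rightarrow> 'n \<Rightarrow> 'n \<Rightarrow> real^'n \<Rightarrow> real) \<Rightarrow>
    'n \<Rightarrow> 'n \<Rightarrow> 'n \<Rightarrow> 'n \<Rightarrow> real^'n \<Rightarrow> real" where
  "cov21 g X m i j s u = pd m (X i j s) u
     + (\<Sum>p\<in>UNIV. christoffel g i m p u * X p j s u)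
     + (\<Sum>p\<in>UNIV. christoffel g j m p u * X i p s u)
     - (\<Sum>p\<in>UNIV. christoffel g p m s u * X i j p u)"

text \<open>
  Raising an index commutes with covariant differentiation, because the metric is parallel.
\<close>

lemma (in metric) cov30_raise:
  assumes X: "\<And>i j s. smooth_fun U (X i j s)" and u: "u \<in> U"
  shows "cov30 g (\<lambda>i j k u. \<Sum>s\<in>UNIV. X i j s u * g u $ s $ k) m i j k u
    = (\<Sum>s\<in>UNIV. cov21 g X m i j s u * g u $ s $ k)"
proof -
  have 1: "pd m (\<lambda>u. \<Sum>s\<in>UNIV. X i j s u * g u $ s $ k) u
      = (\<Sum>s\<in>UNIV. pd m (X i j s) u * g u $ s $ k)
        - (\<Sum>p\<in>UNIV. christoffel g k m p u * (\<Sum>s\<in>UNIV. X i j s u * g u $ s $ p))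
        - (\<Sum>s\<in>UNIV. (\<Sum>p\<in>UNIV. christoffel g p m s u * X i j p u) * g u $ s $ k)"
  proof -
    have "pd m (\<lambda>u. \<Sum>s\<in>UNIV. X i j s u * g u $ s $ k) u
      = (\<Sum>s\<in>UNIV. pd m (X i j s) u * g u $ s $ k) + (\<Sum>s\<in>UNIV. X i j s u * pd m (\<lambda>u. g u $ s $ k) u)"
      by (simp add: phase_fun.d_sum phase_fun.d_mult phase_fun.reg_mult phase_fun.smooth_reg[OF X]
          phase_fun.smooth_reg[OF smooth_metric] u sum.distrib)
    also have "(\<Sum>s\<in>UNIV. X i j s u * pd m (\<lambda>u. g u $ s $ k) u)
      = - (\<Sum>s\<in>UNIV. X i j s u * (\<Sum>p\<in>UNIV. g u $ s $ p * christoffel g k p m u))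
        - (\<Sum>s\<in>UNIV. X i j s u * (\<Sum>p\<in>UNIV. g u $ k $ p * christoffel g s p m u))"
      by (simp add: pd_metric[OF u] hydro_coeff_def right_diff_distrib sum_subtractf sum_negf)
    also have "(\<Sum>s\<in>UNIV. X i j s u * (\<Sum>p\<in>UNIV. g u $ s $ p * christoffel g k p m u))
        = (\<Sum>p\<in>UNIV. christoffel g k m p u * (\<Sum>s\<in>UNIV. X i j s u * g u $ s $ p))"
      unfolding sum_distrib_left by (subst sum.swap) (simp add: christoffel_sym[OF u, of k m] mult_ac)
    also have "(\<Sum>s\<in>UNIV. X i j s u * (\<Sum>p\<in>UNIV. g u $ k $ p * christoffel g s p m u))
        = (\<Sum>s\<in>UNIV. (\<Sum>p\<in>UNIV. christoffel g p m s u * X i j p u) * g u $ s $ k)"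
      unfolding sum_distrib_left sum_distrib_right
      by (subst sum.swap) (simp add: christoffel_sym[OF u, of _ m] metric_sym_nth[OF u, of k] mult_ac)
    finally show ?thesis by simp
  qed
  have 2: "(\<Sum>p\<in>UNIV. c p * (\<Sum>s\<in>UNIV. f p s * g u $ s $ k)) = (\<Sum>s\<in>UNIV. (\<Sum>p\<in>UNIV. c p * f p s) * g u $ s $ k)"
    for c :: "'n \<Rightarrow> real" and f :: "'n \<Rightarrow> 'n \<Rightarrow> real"
    unfolding sum_distrib_left sum_distrib_right by (subst sum.swap) (simp add: mult_ac)
  show ?thesis
    unfolding cov30_def cov21_def 1 2 left_diff_distrib distrib_right sum.distrib sum_subtractf by simp
qed

context flat_pair
begin

text \<open>
  The tensor \<open>S^{ij}_k\<close>, by which the coefficients of the second operator differ from a multiple of those of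
  the first.
\<close>

definition conn_low :: "'n \<Rightarrow> 'n \<Rightarrow> 'n \<Rightarrow> real^'n \<Rightarrow> real" where
  "conn_low i j k u = - (gt u ** conn_diff j u) $ i $ k"

definition conn_raised :: "'n \<Rightarrow> 'n \<Rightarrow> 'n \<Rightarrow> real^'n \<Rightarrow> real" where
  "conn_raised i j k u = (\<Sum>s\<in>UNIV. conn_low i j s u * g u $ s $ k)"

lemma conn_low_eq:
  "conn_low i j k u = hydro_coeff gt i j k u + (\<Sum>p\<in>UNIV. gt u $ i $ p * christoffel g j p k u)"
  by (simp add: conn_low_def conn_diff_def matrix_mult_diff_ldistrib T.hydro_coeff_mat)
    (simp add: matrix_mult_nth christoffel_mat_def)

lemma smooth_conn_low: "smooth_fun U (conn_low i j k)"
  unfolding conn_low_eq[abs_def]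
  by (intro phase_fun.smooth_intros T.smooth_hydro_coeff T.smooth_metric G.smooth_christoffel)

lemma conn_raised_eq: "conn_raised i j k u = - conn_up j u $ i $ k"
  by (simp add: conn_raised_def conn_low_def conn_up_def matrix_mult_nth[of "gt u ** _"] sum_negf)

lemma smooth_conn_raised: "smooth_fun U (conn_raised i j k)"
  unfolding conn_raised_def[abs_def]
  by (intro phase_fun.smooth_intros smooth_conn_low G.smooth_metric)

text \<open>
  Flatness of both metrics enters here: it removes the second derivatives, and of the quadratic terms only
  those with two factors \<open>conn_diff\<close> survive.
\<close>

lemma curl_conn_low:
  assumes u: "u \<in> U"
  shows "cov21 g conn_low m i j s u - cov21 g conn_low s i j m u
    = (conn_diff i u ** gt u ** conn_diff j u - conn_diff j u ** gt u ** conn_diff i u) $ m $ s"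
proof -
  let ?\<Gamma> = "\<lambda>j. christoffel_mat g j u" and ?\<Gamma>t = "\<lambda>j. christoffel_mat gt j u" and ?gt = "gt u"
  let ?c = "\<lambda>j p s. christoffel g j p s u"
  note sym = T.metric_sym[OF u] G.christoffel_mat_sym[OF u] T.christoffel_mat_sym[OF u]
  define Q where "Q m s = (\<Sum>p\<in>UNIV. hydro_coeff gt i p m u * ?c j p s)" for m s
  define R where "R m s = (\<Sum>p\<in>UNIV. ?gt $ i $ p * (\<Sum>q\<in>UNIV. ?c j m q * ?c q s p))" for m s
  have t: "(A ** ?gt ** B) $ m $ s = (B ** ?gt ** A) $ s $ m" if "transpose A = A" "transpose B = B"
      for A B m s
    using transpose_nth[of "B ** ?gt ** A" m s] that by (simp add: matrix_transpose_mul sym matrix_mul_assoc)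
  have pd: "pd m (conn_low i j s) u = pd m (hydro_coeff gt i j s) u
      + (Q m s - (?\<Gamma>t i ** ?gt ** ?\<Gamma> j) $ m $ s) + (\<Sum>p\<in>UNIV. ?gt $ i $ p * pd m (christoffel g j p s)
          u)" for m s
  proof -
    have "pd m (conn_low i j s) u = pd m (hydro_coeff gt i j s) u
        + (\<Sum>p\<in>UNIV. pd m (\<lambda>u. gt u $ i $ p) u * ?c j p s)
            + (\<Sum>p\<in>UNIV. ?gt $ i $ p * pd m (christoffel g j p s) u)"
      unfolding conn_low_eq[abs_def]
      by (simp add: phase_fun.d_add phase_fun.d_sum phase_fun.d_mult phase_fun.reg_sum
          phase_fun.reg_mult phase_fun.smooth_reg[OF T.smooth_hydro_coeff]
          phase_fun.smooth_reg[OF T.smooth_metric] phase_fun.smooth_reg[OF G.smooth_christoffel] u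
              sum.distrib)
    moreover have "(\<Sum>p\<in>UNIV. pd m (\<lambda>u. gt u $ i $ p) u * ?c j p s) = Q m s - (?\<Gamma>t i ** ?gt ** ?\<Gamma> j) $ m $ s"
    proof -
      have "hydro_coeff gt p i m u = - (?\<Gamma>t i ** ?gt) $ m $ p" for p
        using transpose_nth[of "?gt ** ?\<Gamma>t i" m p] by (simp add: T.hydro_coeff_mat matrix_transpose_mul sym)
      then show ?thesis
        by (simp add: T.pd_metric[OF u] Q_def left_diff_distrib sum_subtractf matrix_mult_nth[of "_ ** ?gt"])
          (simp add: christoffel_mat_def)
    qed
    ultimately show ?thesis by simp
  qed
  have curl: "(\<Sum>p\<in>UNIV. ?gt $ i $ p * pd m (christoffel g j p s) u)
      - (\<Sum>p\<in>UNIV. ?gt $ i $ p * pd s (christoffel g j p m) u)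
      = R s m - R m s"
    unfolding R_def sum_subtractf[symmetric] right_diff_distrib[symmetric] G.curl_christoffel[OF u] ..
  have lower_i: "(\<Sum>p\<in>UNIV. ?c i m p * conn_low p j s u) = - (?\<Gamma> i ** ?gt ** conn_diff j u) $ m $ s" for m s
  proof -
    have "(\<Sum>p\<in>UNIV. ?c i m p * conn_low p j s u) = - (?\<Gamma> i ** (?gt ** conn_diff j u)) $ m $ s"
      unfolding matrix_mult_nth[of "?\<Gamma> i"] by (simp add: conn_low_def christoffel_mat_def sum_negf)
    then show ?thesis by (simp add: matrix_mul_assoc)
  qed
  have lower_j: "(\<Sum>p\<in>UNIV. ?c j m p * conn_low i p s u) = Q s m + R m s" for m s
  proof -
    have "(\<Sum>p\<in>UNIV. ?c j m p * conn_low i p s u)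
        = (\<Sum>p\<in>UNIV. ?c j m p * hydro_coeff gt i p s u)
            + (\<Sum>p\<in>UNIV. ?c j m p * (\<Sum>q\<in>UNIV. ?gt $ i $ q * ?c p q s))"
      by (simp add: conn_low_eq distrib_left sum.distrib)
    moreover have "(\<Sum>p\<in>UNIV. ?c j m p * hydro_coeff gt i p s u) = Q s m"
      by (simp add: Q_def G.christoffel_sym[OF u, of j m] mult.commute)
    moreover have "(\<Sum>p\<in>UNIV. ?c j m p * (\<Sum>q\<in>UNIV. ?gt $ i $ q * ?c p q s)) = R m s"
      unfolding R_def sum_distrib_left
      by (subst sum.swap) (simp add: G.christoffel_sym[OF u, of _ s] mult_ac)
    ultimately show ?thesis by simp
  qed
  have last: "(\<Sum>p\<in>UNIV. ?c p m s * conn_low i j p u) = (\<Sum>p\<in>UNIV. ?c p s m * conn_low i j p u)"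
    by (simp add: G.christoffel_sym[OF u, of _ m s])
  have "pd m (hydro_coeff gt i j s) u - pd s (hydro_coeff gt i j m) u = (?\<Gamma>t i ** ?gt ** ?\<Gamma>t j
      - ?\<Gamma>t j ** ?gt ** ?\<Gamma>t i) $ m $ s"
    using T.curl_hydro_coeff[OF u, of i j m s] by (simp add: curl_def)
  moreover have "transpose (conn_diff j u) = conn_diff j u" by (rule conn_diff_sym[OF u])
  ultimately show ?thesis
    unfolding cov21_def pd lower_i lower_j last
    using curl t[of "?\<Gamma>t i" "?\<Gamma> j" s m] t[of "?\<Gamma> i" "conn_diff j u" s m] sym
    by (simp add: conn_diff_def matrix_ring_simps)
qed

lemma covup20_affinor_up:
  assumes u: "u \<in> U"
  shows "covup20 g (affinor_up g gt) i j k u = conn_raised j k i u + conn_raised k j i u"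
  unfolding covup20_def cov20_affinor_up[OF u] conn_raised_def conn_low_def sum.distrib[symmetric]
  by (intro sum.cong refl) (simp add: G.metric_sym_nth[OF u, of i] algebra_simps)

lemma cov30_covup20:
  assumes u: "u \<in> U"
  shows "cov30 g (covup20 g (affinor_up g gt)) m i j k u
    = cov30 g conn_raised m j k i u + cov30 g conn_raised m k j i u"
proof -
  have "pd m (covup20 g (affinor_up g gt) i j k) u = pd m (\<lambda>u. conn_raised j k i u + conn_raised k j i u) u"
    by (rule pd_cong[OF _ u]) (simp add: covup20_affinor_up)
  also have "\<dots> = pd m (conn_raised j k i) u + pd m (conn_raised k j i) u"
    by (simp add: phase_fun.d_add phase_fun.smooth_reg[OF smooth_conn_raised] u)
  finally show ?thesis
    by (simp add: cov30_def covup20_affinor_up[OF u] distrib_left sum.distrib)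
qed

lemma covup30_covup20:
  "u \<in> U \<Longrightarrow> covup30 g (covup20 g (affinor_up g gt)) l i j k u
    = covup30 g conn_raised l j k i u + covup30 g conn_raised l k j i u"
  by (simp add: covup30_def cov30_covup20 distrib_left sum.distrib)

lemma covup30_conn_raised_curl:
  assumes u: "u \<in> U"
  shows "covup30 g conn_raised l i j k u - covup30 g conn_raised k i j l u
    = (g u ** (conn_diff i u ** gt u ** conn_diff j u
        - conn_diff j u ** gt u ** conn_diff i u) ** g u) $ l $ k"
proof -
  have e: "covup30 g conn_raised l i j k u = (\<Sum>m\<in>UNIV. \<Sum>s\<in>UNIV. g u $ l $ m * cov21 g conn_low m i j s u
      * g u $ s $ k)" for l k
    unfolding covup30_def conn_raised_def[abs_def] G.cov30_raise[OF smooth_conn_low u]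
    by (simp add: sum_distrib_left mult_ac)
  have "covup30 g conn_raised k i j l u = (\<Sum>m\<in>UNIV. \<Sum>s\<in>UNIV. g u $ l $ m * cov21 g conn_low s i j m u *
      g u $ s $ k)"
    unfolding e by (subst sum.swap) (simp add: G.metric_sym_nth[OF u, of k] G.metric_sym_nth[OF u, of _
        l] mult_ac)
  then have "covup30 g conn_raised l i j k u - covup30 g conn_raised k i j l u
    = (\<Sum>m\<in>UNIV. \<Sum>s\<in>UNIV. g u $ l $ m * (cov21 g conn_low m i j s u
        - cov21 g conn_low s i j m u) * g u $ s $ k)"
    unfolding e by (simp add: sum_subtractf algebra_simps)
  also have "\<dots> = (g u ** (conn_diff i u ** gt u ** conn_diff j u
      - conn_diff j u ** gt u ** conn_diff i u) ** g u) $ l $ k"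
    unfolding curl_conn_low[OF u] matrix_mult_nth[of "g u ** _" "g u"] matrix_mult_nth[of "g u" "_
        - _"] sum_distrib_right
    by (rule sum.swap)
  finally show ?thesis .
qed

text \<open>
  Let \<open>K^{l;ijk} = \<nabla>\<^sup>l S^{ijk}\<close>. The difference \<open>z^{lk;ij} = K^{l;ijk} - K^{k;ijl}\<close> is the raised commutator,
  antisymmetric in \<open>i, j\<close>. As \<open>K\<close> is symmetric under exchange of \<open>i\<close> and \<open>k\<close>, the second-order condition for the
  indices \<open>l, i, j, k\<close> reduces to \<open>2 z^{lk;ij} = 0\<close>.
\<close>

lemma second_order_iff_conn_commute:
  assumes u: "u \<in> U" and symm: "\<And>u. u \<in> U \<Longrightarrow> conn_symmetric u"
  defines "H \<equiv> covup30 g (covup20 g (affinor_up g gt))"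
  shows "(\<forall>i j k l. H i j k l u + H k l i j u = H i k j l u + H j l i k u) \<longleftrightarrow> conn_commute u"
proof -
  define K where "K l i j k = covup30 g conn_raised l i j k u" for l i j k
  define z where "z l k i j = (g u ** (conn_diff i u ** gt u ** conn_diff j u
      - conn_diff j u ** gt u ** conn_diff i u) ** g u) $ l $ k" for l k i j
  have H: "H l i j k u = K l j k i + K l k j i" for l i j k
    by (simp add: H_def K_def covup30_covup20[OF u])
  have z: "K l i j k - K k i j l = z l k i j" for l i j k
    by (simp add: K_def z_def covup30_conn_raised_curl[OF u])
  have z_anti: "z l k i j = - z l k j i" for l k i j
    by (simp add: z_def matrix_ring_simps)
  have sw: "conn_raised i j k v = conn_raised k j i v" if "v \<in> U" for i j k v
    using symm[OF that] that by (simp add: conn_raised_eq conn_symmetric_iff symmetric_matrix_nth[of _ i])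
  have "cov30 g conn_raised m i j k u = cov30 g conn_raised m k j i u" for m i j k
  proof -
    have "pd m (conn_raised i j k) u = pd m (conn_raised k j i) u" by (rule pd_cong[OF sw u])
    then show ?thesis by (simp add: cov30_def sw[OF u])
  qed
  then have K: "K l i j k = K l k j i" for l i j k
    unfolding K_def covup30_def by metis
  have defect: "H l i j k u + H j k l i u - (H l j i k u + H i k l j u) = 2 * z l k i j" for l i j k
    unfolding H
    using z[of j l i k] z[of j i l k] z_anti[of j k l i] z[of i l j k] z[of i j l k] z_anti[of i k l j]
      K[of l j k i] K[of k l i j] K[of k i l j] K[of l k j i] K[of l k i j] K[of k l j i]
      z[of l i j k] z[of l j i k] z_anti[of l k i j] by linarith
  have "(\<forall>i j k l. H i j k l u + H k l i j u = H i k j l u + H j l i k u) \<longleftrightarrow> (\<forall>l k i j. z l k i j = 0)"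
    using defect by (metis (no_types) cancel_comm_monoid_add_class.diff_cancel eq_iff_diff_eq_0
        mult_eq_0_iff zero_neq_numeral)
  also have "\<dots> \<longleftrightarrow> (\<forall>i j. g u ** (conn_diff i u ** gt u ** conn_diff j u
      - conn_diff j u ** gt u ** conn_diff i u) ** g u = 0)"
    by (auto simp: z_def vec_eq_iff)
  also have "\<dots> \<longleftrightarrow> conn_commute u"
  proof -
    have "g u ** X ** g u = 0 \<longleftrightarrow> X = 0" for X
      using matrix_right_cancel[OF G.metric_det[OF u], of "g u ** X" 0] matrix_left_cancel[OF
          G.metric_det[OF u], of X 0]
      by simp
    then show ?thesis by (simp add: conn_commute_def)
  qed
  finally show ?thesis .
qed

end

theorem theorem1:
  fixes U :: "(real^'n) set"
    and g gt :: "real^'n \<Rightarrow> real^'n^'n"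
    and b bt :: "'n \<Rightarrow> 'n \<Rightarrow> 'n \<Rightarrow> real^'n \<Rightarrow> real"
    and r r_up :: "'n \<Rightarrow> 'n \<Rightarrow> real^'n \<Rightarrow> real"
  assumes "open U"
    and "flat_metric U g"
    and "flat_metric U gt"
  defines "b \<equiv> hydro_coeff g"
    and "bt \<equiv> hydro_coeff gt"
    and "r \<equiv> affinor g gt"
    and "r_up \<equiv> affinor_up g gt"
  shows "(compatible U g b gt bt \<longleftrightarrow>
            (\<forall>u\<in>U. \<forall>i j k. nijenhuis r i j k u = 0) \<and>
            (\<forall>u\<in>U. \<forall>i j k l.
               covup30 g (covup20 g r_up) i j k l u + covup30 g (covup20 g r_up) k l i j u
             = covup30 g (covup20 g r_up) i k j l u + covup30 g (covup20 g r_up) j l i k u)) \<and>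
         ((\<forall>u\<in>U. \<forall>i j k. nijenhuis r i j k u = 0) \<longrightarrow>
            (\<forall>u\<in>U. \<forall>i j k.
               2 * bt i j k u =
                 covup11 g r i j k u - covup11 g r j i k u + cov20 g r_up k i j u
                 + 2 * (\<Sum>s\<in>UNIV. b s j k u * r i s u)))"
proof -
  interpret flat_pair U g gt
    by unfold_locales (fact assms(1-3))+
  have N: "(\<forall>u\<in>U. \<forall>i j k. nijenhuis r i j k u = 0) \<longleftrightarrow> (\<forall>u\<in>U. conn_symmetric u)"
    unfolding r_def using nijenhuis_iff_conn_symmetric by blast
  have "(\<forall>u\<in>U. \<forall>i j k l.
               covup30 g (covup20 g r_up) i j k l u + covup30 g (covup20 g r_up) k l i j u
             = covup30 g (covup20 g r_up) i k j l u + covup30 g (covup20 g r_up) j l i k u)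
      \<longleftrightarrow> (\<forall>u\<in>U. conn_commute u)" if "\<forall>u\<in>U. conn_symmetric u"
    unfolding r_up_def using second_order_iff_conn_commute that by simp
  moreover have "compatible U g b gt bt \<longleftrightarrow> (\<forall>u\<in>U. conn_symmetric u \<and> conn_commute u)"
    unfolding b_def bt_def by (rule compatible_iff_conn)
  moreover have "2 * bt i j k u = covup11 g r i j k u - covup11 g r j i k u + cov20 g r_up k i j u
                 + 2 * (\<Sum>s\<in>UNIV. b s j k u * r i s u)" if "\<forall>u\<in>U. conn_symmetric u" "u \<in> U" for i j k u
    unfolding b_def bt_def r_def r_up_def using second_coefficients that by blast
  ultimately show ?thesis
    unfolding N by blast
qed

end
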